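(* Let $C\subset\mathbb R^n$ be an $n$-dimensional compact convex set with $C=-C$ and let $f:C\to(0,\infty)$ be log-concave and continuous. Then \[ \frac{1}{|C|}\int_Cf(x)\,dx\leq f_{min}\,\frac{(f(0)/f_{min})^2-1}{\log\big((f(0)/f_{min})^2\big)}, \] where $f_{min}=\min\{f(x):x\in C\}$ (if $f(0)=f_{min}$, the right-hand side is understood as its limit value $f_{min}$). Equality holds if and only if, after applying a suitable rotation, there exist an $(n-1)$-dimensional compact convex set $C_0\subset\mathbb R^{n-1}$ with $C_0=-C_0$ and $x_0\in\mathbb R^n$ with $(x_0)_1>0$ such that \[ C=[-x_0,x_0]+(\{0\}\times C_0) \] and $f=e^u$, where $u:C\to\mathbb R$ is an affine function with $u(-x_0+x)=\log(f_{min})$ for every $x\in\{0\}\times\mathbb R^{n-1}$.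
   Context: $|C|$ denotes the volume (Lebesgue measure) of $C$. A function $f:C\to(0,\infty)$ is log-concave if $\log f$ is concave. $(x_0)_1$ is the first coordinate of $x_0$; $[-x_0,x_0]$ is the line segment with endpoints $-x_0,x_0$, and $+$ between sets is Minkowski addition. At points outside $C$, the affine function $u$ is understood through its affine extension to $\mathbb R^n$.
   Formalization: Equality is characterized as: f(0)=f_min (f constant, where equality holds for every C, e.g. a disc with f=1, so the literal "only if" fails) or the stated form after a rotation; for n=1 the reflection x -> -x is admitted as a rotation. *)

theory Defs
  imports "HOL-Analysis.Analysis"
begin

definition log_concave_on :: "'a::real_vector set \<Rightarrow> ('a \<Rightarrow> real) \<Rightarrow> bool" where
  "log_concave_on C f \<longleftrightarrow> concave_on C (\<lambda>x. ln (f x))"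

definition min_on :: "'a set \<Rightarrow> ('a \<Rightarrow> real) \<Rightarrow> real" where
  "min_on C f = (LEAST y. y \<in> f ` C)"

(* The case a = m is the limit of the generic expression as a tends to m. *)
definition mean_bound :: "real \<Rightarrow> real \<Rightarrow> real" where
  "mean_bound m a = (if a = m then m else m * (((a / m)\<^sup>2 - 1) / ln ((a / m)\<^sup>2)))"

definition affine_fun :: "('a::real_vector \<Rightarrow> real) \<Rightarrow> bool" where
  "affine_fun u \<longleftrightarrow> (\<exists>l c. linear l \<and> (\<forall>x. u x = l x + c))"

(* Proper rotations in dimension at least 2.  In dimension 1, where the only orientation-preserving
   orthogonal map is the identity, the reflection x \<mapsto> -x is admitted as well: it is needed to
   bring a decreasing exponential on an interval [-a, a] into normal form. *)
definition rotation :: "(real^'n \<Rightarrow> real^'n) \<Rightarrow> bool" where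
  "rotation T \<longleftrightarrow> orthogonal_transformation T \<and> (2 \<le> CARD('n) \<longrightarrow> det (matrix T) = 1)"

(* {0} x R^(n-1), where k is the index of the distinguished ("first") coordinate.  Below, a set
   C_0 in R^(n-1) is represented by {0} x C_0, a subset of this hyperplane; this also covers n = 1,
   where R^(n-1) is a point and is not of the form real^'m. *)
definition zero_hyperplane :: "'n \<Rightarrow> (real^'n) set" where
  "zero_hyperplane k = {x. x $ k = 0}"

(* Normal form of the extremal pairs (C, f).  Applying the rotation T to the pair means passing to
   T ` C and f o T^(-1).  Z stands for {0} x C_0.  As C is full-dimensional, an affine function
   on T ` C is the restriction of exactly one affine u on the whole space.

   Constant f (that is, f 0 = min_on C f) attain equality in the integral bound on every symmetric
   convex body, cylinder or not, so they have to be treated separately in an equality criterion. *)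
definition extremal_form :: "'n \<Rightarrow> (real^'n) set \<Rightarrow> (real^'n \<Rightarrow> real) \<Rightarrow> bool" where
  "extremal_form k C f \<longleftrightarrow>
    (\<exists>T Z x\<^sub>0 u.
       rotation T \<and>
       Z \<subseteq> zero_hyperplane k \<and> compact Z \<and> convex Z \<and>
       aff_dim Z = int CARD('n) - 1 \<and> Z = uminus ` Z \<and>
       x\<^sub>0 $ k > 0 \<and>
       T ` C = closed_segment (- x\<^sub>0) x\<^sub>0 + Z \<and>
       affine_fun u \<and>
       (\<forall>x\<in>C. f x = exp (u (T x))) \<and>
       (\<forall>x\<in>zero_hyperplane k. u (- x\<^sub>0 + x) = ln (min_on C f)))"

end

theory Submission
  imports Defs
begin

text \<open>
Write \<open>m\<close> for the minimum of \<open>f\<close> and \<open>h = ln (f 0 / m)\<close>.  If \<open>h = 0\<close> then \<open>f\<close> is constant, so let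
\<open>h > 0\<close>.

The first idea is a reduction to exponentials of linear functions.  The function
\<open>k x = ln (f x) - ln (f 0)\<close> is concave, vanishes at 0 and is at least \<open>- h\<close>.  Since \<open>C\<close> is symmetric,
concavity along lines through 0 also bounds \<open>k\<close> from above by \<open>h\<close> times the gauge of \<open>C\<close>, a convex
function.  Hahn--Banach separation puts a linear function between the two
(\<open>symmetric_convex_sandwich\<close>): there is \<open>v\<close> with \<open>f x \<le> f 0 * exp (v \<bullet> x)\<close> and
\<open>\<bar>v \<bullet> x\<bar> \<le> h\<close> on \<open>C\<close>.

It remains to bound the mean value of \<open>exp (v \<bullet> x)\<close> by \<open>sinh h / h\<close>, the mean value of \<open>cosh\<close> on
\<open>{-h..h}\<close> (\<open>exp_mean_le\<close>).  By the Brunn--Minkowski inequality the measures of the sections of \<open>C\<close>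
orthogonal to \<open>v\<close> form a log-concave function, and by symmetry it is even; so it decreases with the
distance from 0, and mass is moved outwards, where \<open>cosh\<close> is larger, when this function is replaced
by a constant (\<open>symmetric_unimodal_exp_mean\<close>).

Equality forces \<open>f x = f 0 * exp (v \<bullet> x)\<close> and all sections to have the same measure.  That such a body
is a cylinder (\<open>constant_slices_imp_cylinder\<close>) is the equality case of Brunn--Minkowski in the form
needed here.  Cut the sections by the half-spaces \<open>\<tau> \<le> w \<bullet> x\<close> of a further functional \<open>w\<close>.  The
measures of the two parts are both log-concave in position and threshold while their sum is
constant, and this is so rigid that the distributions of \<open>w\<close> on the sections are translates of each
other (\<open>translates_of_log_concave_tails\<close>).  Comparing first moments shows that the shifts depend
linearly on \<open>w\<close>, so they come from one vector.  Conversely, a shear makes a cylinder straight, where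
the mean value is an integral in one variable.
\<close>

section \<open>The Prekopa--Leindler inequality on the line\<close>

text \<open>On the line the Brunn--Minkowski inequality needs only that a sum set contains two translates that
meet in one point: for compact sets, add the first set to the minimum of the second, and the second
set to the maximum of the first.  Inner regularity passes to Borel sets.  The sum set itself need
not be measurable, which is why it is replaced by a measurable superset \<open>M\<close> here and below.\<close>

lemma brunn_minkowski_real:
  fixes A B M :: "real set" and t :: real
  assumes meas: "A \<in> sets borel" "B \<in> sets borel" "M \<in> sets borel"
    and ne: "A \<noteq> {}" "B \<noteq> {}"
    and bdd: "bounded A" "bounded B" "bounded M"
    and t: "0 < t" "t < 1"
    and sub: "\<And>a b. a \<in> A \<Longrightarrow> b \<in> B \<Longrightarrow> (1 - t) * a + t * b \<in> M"
  shows "(1 - t) * measure lborel A + t * measure lborel B \<le> measure lborel M"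
proof -
  have fin: "X \<in> fmeasurable lborel" if "X \<in> sets borel" "bounded X" for X :: "real set"
    using that emeasure_bounded_finite[of X] by (auto simp: fmeasurable_def)
  have inner: "\<exists>K. compact K \<and> K \<noteq> {} \<and> K \<subseteq> X \<and> measure lborel X \<le> measure lborel K + e"
    if X: "X \<in> sets borel" "bounded X" "X \<noteq> {}" and e: "e > 0" for X :: "real set" and e
  proof -
    have "X \<in> sets lebesgue" using X by auto
    then obtain T where T: "closed T" "T \<subseteq> X" "X - T \<in> lmeasurable" "emeasure lebesgue (X - T) < ennreal e"
      using sets_lebesgue_inner_closed e by metis
    obtain x where x: "x \<in> X" using X by auto
    let ?K = "insert x T"
    have "bounded T" using T(2) X(2) bounded_subset by blast
    then have K: "compact ?K" using T(1) by (simp add: compact_eq_bounded_closed closed_insert)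
    have KX: "?K \<subseteq> X" using T x by auto
    have Xf: "X \<in> fmeasurable lborel" and Kf: "?K \<in> fmeasurable lborel"
      using fin X K by (auto simp: fmeasurable_compact)
    have "measure lborel X - measure lborel ?K = measure lborel (X - ?K)"
      using measurable_measure_Diff[OF Xf _ KX] Kf by (auto simp: fmeasurable_def)
    also have "\<dots> \<le> measure lborel (X - T)"
      by (rule measure_mono_fmeasurable) (use X T in \<open>auto intro!: fin\<close>)
    also have "\<dots> = measure lebesgue (X - T)"
      by (rule measure_completion[symmetric]) (use X T in auto)
    also have "\<dots> \<le> e" using T(4) T(3)
      by (simp add: emeasure_eq_measure2 ennreal_less_iff)
    finally show ?thesis using K KX by (intro exI[of _ ?K]) auto
  qed
  have compact_case: "(1 - t) * measure lborel K + t * measure lborel L \<le> measure lborel M"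
    if K: "compact K" "K \<noteq> {}" "K \<subseteq> A" and L: "compact L" "L \<noteq> {}" "L \<subseteq> B" for K L
  proof -
    obtain a where a: "a \<in> K" "\<And>x. x \<in> K \<Longrightarrow> x \<le> a" using compact_attains_sup[OF K(1,2)] by auto
    obtain b where b: "b \<in> L" "\<And>x. x \<in> L \<Longrightarrow> b \<le> x" using compact_attains_inf[OF L(1,2)] by auto
    define K' where "K' = (\<lambda>x. t * b + (1 - t) * x) ` K"
    define L' where "L' = (\<lambda>x. (1 - t) * a + t * x) ` L"
    have K'M: "K' \<subseteq> M" and L'M: "L' \<subseteq> M"
      using sub[OF _ subsetD[OF L(3) b(1)]] sub[OF subsetD[OF K(3) a(1)]] K(3) L(3)
      by (auto simp: K'_def L'_def add.commute)
    have cK: "compact K'" "compact L'"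
      unfolding K'_def L'_def by (auto intro!: compact_continuous_image continuous_intros K L)
    \<comment> \<open>\<open>K'\<close> lies to the left of the point \<open>(1 - t) * a + t * b\<close>, and \<open>L'\<close> to its right.\<close>
    have int: "K' \<inter> L' \<subseteq> {(1 - t) * a + t * b}"
      using a(2) b(2) t
      by (auto simp: K'_def L'_def) (smt (verit, best) mult_left_mono mult_le_cancel_left_pos)
    have mK: "measure lborel K' = (1 - t) * measure lborel K"
      using measure_lebesgue_affine[of "1 - t" "t * b" K] t cK K
      by (simp add: K'_def measure_completion borel_compact compact_imp_closed add.commute)
    have mL: "measure lborel L' = t * measure lborel L"
      using measure_lebesgue_affine[of "t" "(1 - t) * a" L] t cK L
      by (simp add: L'_def measure_completion borel_compact compact_imp_closed add.commute)
    have null: "emeasure lborel (K' \<inter> L') = 0"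
      using emeasure_mono[OF int, of lborel] by simp
    have "measure lborel K' + measure lborel L' = measure lborel (K' \<union> L') + measure lborel (K' \<inter> L')"
      using measure_Un3[of K' lborel L'] cK by (simp add: fmeasurable_compact)
    also have "\<dots> = measure lborel (K' \<union> L')" using null by (simp add: measure_def)
    also have "\<dots> \<le> measure lborel M"
      by (rule measure_mono_fmeasurable) (use K'M L'M meas bdd fin cK in \<open>auto intro!: borel_compact sets.Un\<close>)
    finally show ?thesis by (simp add: mK mL)
  qed
  show ?thesis
  proof (rule field_le_epsilon)
    fix e :: real assume e: "0 < e"
    obtain K where K: "compact K" "K \<noteq> {}" "K \<subseteq> A" "measure lborel A \<le> measure lborel K + e"
      using inner[of A e] meas bdd ne e by auto
    obtain L where L: "compact L" "L \<noteq> {}" "L \<subseteq> B" "measure lborel B \<le> measure lborel L + e"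
      using inner[of B e] meas bdd ne e by auto
    have "(1 - t) * measure lborel A + t * measure lborel B
        \<le> (1 - t) * (measure lborel K + e) + t * (measure lborel L + e)"
      using K L t by (intro add_mono mult_left_mono) auto
    also have "\<dots> = (1 - t) * measure lborel K + t * measure lborel L + e"
      by (simp add: algebra_simps)
    also have "\<dots> \<le> measure lborel M + e" using compact_case K L by simp
    finally show "(1 - t) * measure lborel A + t * measure lborel B \<le> measure lborel M + e" .
  qed
qed

lemma nn_integral_layer_cake:
  fixes f :: "'a \<Rightarrow> real"
  assumes "sigma_finite_measure M" and [measurable]: "f \<in> borel_measurable M"
  shows "(\<integral>\<^sup>+x. ennreal (f x) \<partial>M)
    = (\<integral>\<^sup>+r. emeasure M {x \<in> space M. r \<le> f x} * indicator {0<..} r \<partial>lborel)"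
proof -
  interpret M: sigma_finite_measure M by fact
  interpret pair_sigma_finite lborel M
    by (simp add: pair_sigma_finite_def lborel.sigma_finite_measure_axioms M.sigma_finite_measure_axioms)
  have "(\<integral>\<^sup>+x. ennreal (f x) \<partial>M) = (\<integral>\<^sup>+x. \<integral>\<^sup>+r. indicator {0<..f x} r \<partial>lborel \<partial>M)"
  proof (intro nn_integral_cong)
    fix x
    show "ennreal (f x) = (\<integral>\<^sup>+r. indicator {0<..f x} r \<partial>lborel)"
      by (cases "0 \<le> f x") (auto simp: ennreal_neg)
  qed
  also have "\<dots> = (\<integral>\<^sup>+r. \<integral>\<^sup>+x. indicator {0<..f x} r \<partial>M \<partial>lborel)"
  proof (rule Fubini')
    have "{p \<in> space (lborel \<Otimes>\<^sub>M M). 0 < fst p \<and> fst p \<le> f (snd p)} \<in> sets (lborel \<Otimes>\<^sub>M M)"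
      by measurable
    then have "indicator {p \<in> space (lborel \<Otimes>\<^sub>M M). 0 < fst p \<and> fst p \<le> f (snd p)}
        \<in> borel_measurable (lborel \<Otimes>\<^sub>M M)" (is "?g \<in> _")
      by (rule borel_measurable_indicator)
    then show "(\<lambda>(r, x). indicator {0<..f x} r :: ennreal) \<in> borel_measurable (lborel \<Otimes>\<^sub>M M)"
      by (subst measurable_cong[of _ _ ?g]) (auto simp: indicator_def)
  qed
  also have "\<dots> = (\<integral>\<^sup>+r. emeasure M {x \<in> space M. r \<le> f x} * indicator {0<..} r \<partial>lborel)"
  proof (intro nn_integral_cong)
    fix r :: real
    have "(\<integral>\<^sup>+x. indicator {0<..f x} r \<partial>M) = (\<integral>\<^sup>+x. indicator {x \<in> space M. r \<le> f x} x * indicator {0<..} r \<partial>M)"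
      by (intro nn_integral_cong) (auto simp: indicator_def)
    also have "\<dots> = emeasure M {x \<in> space M. r \<le> f x} * indicator {0<..} r"
      by (subst nn_integral_multc) auto
    finally show "(\<integral>\<^sup>+x. indicator {0<..f x} r \<partial>M) = emeasure M {x \<in> space M. r \<le> f x} * indicator {0<..} r" .
  qed
  finally show ?thesis .
qed

text \<open>When both suprema are 1, the superlevel sets at every height below 1 are nonempty, so that the
one-dimensional Brunn--Minkowski inequality applies to each of them; integrating over the height
even gives an arithmetic mean on the left.\<close>

lemma prekopa_leindler_real_normalized:
  fixes f g h :: "real \<Rightarrow> real"
  assumes [measurable]: "f \<in> borel_measurable borel" "g \<in> borel_measurable borel" "h \<in> borel_measurable borel"
    and le1: "\<And>x. f x \<le> 1" "\<And>x. g x \<le> 1"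
    and sup1: "\<And>r. r < 1 \<Longrightarrow> \<exists>x. r \<le> f x" "\<And>r. r < 1 \<Longrightarrow> \<exists>x. r \<le> g x"
    and supp: "\<And>x. R < \<bar>x\<bar> \<Longrightarrow> f x = 0" "\<And>x. R < \<bar>x\<bar> \<Longrightarrow> g x = 0" "\<And>x. R < \<bar>x\<bar> \<Longrightarrow> h x = 0"
    and t: "0 < t" "t < 1"
    and fgh: "\<And>x y r. 0 < r \<Longrightarrow> r \<le> f x \<Longrightarrow> r \<le> g y \<Longrightarrow> r \<le> h ((1 - t) * x + t * y)"
  shows "ennreal (1 - t) * (\<integral>\<^sup>+x. ennreal (f x) \<partial>lborel) + ennreal t * (\<integral>\<^sup>+x. ennreal (g x) \<partial>lborel)
    \<le> (\<integral>\<^sup>+x. ennreal (h x) \<partial>lborel)"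
proof -
  have bdd: "bounded {x. r \<le> k x}" if "r > 0" "\<And>x. R < \<bar>x\<bar> \<Longrightarrow> k x = 0" for r and k :: "real \<Rightarrow> real"
    using that by (intro boundedI[of _ R]) (auto simp: not_less[symmetric])
  have fin: "emeasure lborel {x. r \<le> k x} = ennreal (measure lborel {x. r \<le> k x})"
    if "r > 0" "\<And>x. R < \<bar>x\<bar> \<Longrightarrow> k x = 0" for r and k :: "real \<Rightarrow> real"
    using emeasure_bounded_finite[OF bdd[of r k, OF that(1) that(2)]]
    by (simp add: emeasure_eq_ennreal_measure less_top[symmetric])
  have level: "ennreal (1 - t) * emeasure lborel {x. r \<le> f x} + ennreal t * emeasure lborel {x. r \<le> g x}
      \<le> emeasure lborel {x. r \<le> h x}" if r: "r > 0" "r \<noteq> 1" for r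
  proof (cases "r < 1")
    case True
    have "(1 - t) * measure lborel {x. r \<le> f x} + t * measure lborel {x. r \<le> g x} \<le> measure lborel {x. r \<le> h x}"
      by (rule brunn_minkowski_real) (use sup1[OF True] t fgh r bdd supp in auto)
    then show ?thesis
      using t r supp by (simp add: fin ennreal_mult[symmetric] ennreal_plus[symmetric] ennreal_leI del: ennreal_plus)
  next
    case False
    with r have "r > 1" by simp
    then have "{x. r \<le> f x} = {}" "{x. r \<le> g x} = {}" using le1 by (auto simp: not_le intro: le_less_trans)
    then show ?thesis by simp
  qed
  have [measurable]: "(\<lambda>r. emeasure lborel {x. r \<le> k x}) \<in> borel_measurable borel"
    if [measurable]: "k \<in> borel_measurable borel" for k :: "real \<Rightarrow> real"
    by measurable
  have "ennreal (1 - t) * (\<integral>\<^sup>+x. ennreal (f x) \<partial>lborel) + ennreal t * (\<integral>\<^sup>+x. ennreal (g x) \<partial>lborel)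
    = (\<integral>\<^sup>+r. (ennreal (1 - t) * emeasure lborel {x. r \<le> f x} + ennreal t * emeasure lborel {x. r \<le> g x})
         * indicator {0<..} r \<partial>lborel)"
    by (simp add: nn_integral_layer_cake[OF lborel.sigma_finite_measure_axioms] nn_integral_cmult[symmetric] nn_integral_add[symmetric] algebra_simps)
  also have "\<dots> \<le> (\<integral>\<^sup>+r. emeasure lborel {x. r \<le> h x} * indicator {0<..} r \<partial>lborel)"
    \<comment> \<open>At height 1 one superlevel set may be empty and the other not, so this height is left out.\<close>
    by (intro nn_integral_mono_AE eventually_mono[OF AE_lborel_singleton[of 1]])
       (auto simp: level split: split_indicator)
  also have "\<dots> = (\<integral>\<^sup>+x. ennreal (h x) \<partial>lborel)"
    by (simp add: nn_integral_layer_cake[OF lborel.sigma_finite_measure_axioms])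
  finally show ?thesis .
qed

lemma weighted_am_gm:
  fixes a b :: real
  assumes "0 \<le> \<alpha>" "0 \<le> \<beta>" "\<alpha> + \<beta> = 1" "0 \<le> a" "0 \<le> b"
  shows "a powr \<alpha> * b powr \<beta> \<le> \<alpha> * a + \<beta> * b"
  using assms Youngs_inequality_0[of \<alpha> \<beta> a b] by (cases "a = 0 \<or> b = 0") auto

text \<open>The Prekopa--Leindler inequality on the line follows from the normalized form by dividing by the
suprema; the arithmetic mean is then weakened to a geometric one.\<close>

lemma prekopa_leindler_real:
  fixes f g h :: "real \<Rightarrow> real"
  assumes [measurable]: "f \<in> borel_measurable borel" "g \<in> borel_measurable borel" "h \<in> borel_measurable borel"
    and nonneg: "\<And>x. 0 \<le> f x" "\<And>x. 0 \<le> g x" "\<And>x. 0 \<le> h x"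
    and bound: "\<And>x. f x \<le> K" "\<And>x. g x \<le> K" "\<And>x. h x \<le> K"
    and supp: "\<And>x. R < \<bar>x\<bar> \<Longrightarrow> f x = 0" "\<And>x. R < \<bar>x\<bar> \<Longrightarrow> g x = 0" "\<And>x. R < \<bar>x\<bar> \<Longrightarrow> h x = 0"
    and t: "0 < t" "t < 1"
    and fgh: "\<And>x y. f x powr (1 - t) * g y powr t \<le> h ((1 - t) * x + t * y)"
  shows "(LINT x|lborel. f x) powr (1 - t) * (LINT x|lborel. g x) powr t \<le> (LINT x|lborel. h x)"
proof -
  have integ: "integrable lborel k"
    if [measurable]: "k \<in> borel_measurable borel" and "\<And>x. 0 \<le> k x" "\<And>x. k x \<le> K" "\<And>x. R < \<bar>x\<bar> \<Longrightarrow> k x = 0"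
    for k :: "real \<Rightarrow> real"
  proof (rule Bochner_Integration.integrable_bound[where f = "\<lambda>x. K * indicator {-R..R} x"])
    show "integrable lborel (\<lambda>x. K * indicator {-R..R} x :: real)"
      by (intro integrable_mult_right integrable_real_indicator) (auto simp: emeasure_lborel_Icc_eq)
    have "norm (k x) \<le> norm (K * indicator {-R..R} x)" for x
      using that(2-4)[of x] by (cases "R < \<bar>x\<bar>") (auto simp: indicator_def abs_if split: if_splits)
    then show "AE x in lborel. norm (k x) \<le> norm (K * indicator {-R..R} x)" by simp
  qed simp
  have integ': "integrable lborel f" "integrable lborel g" "integrable lborel h"
    using nonneg bound supp by (auto intro!: integ)
  show ?thesis
  proof (cases "(\<forall>x. f x = 0) \<or> (\<forall>x. g x = 0)")
    case True
    then have "(LINT x|lborel. f x) = 0 \<or> (LINT x|lborel. g x) = 0" by auto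
    then show ?thesis using nonneg by (auto intro!: integral_nonneg)
  next
    case False
    define \<alpha> \<beta> where "\<alpha> = Sup (range f)" and "\<beta> = Sup (range g)"
    have bf: "bdd_above (range f)" "bdd_above (range g)" using bound by (auto intro!: bdd_aboveI[of _ K])
    have up: "f x \<le> \<alpha>" "g x \<le> \<beta>" for x unfolding \<alpha>_def \<beta>_def using bf by (auto intro: cSup_upper)
    have pos: "\<alpha> > 0" "\<beta> > 0"
      using False up nonneg by (metis less_le_trans order_less_le)+
    define \<gamma> where "\<gamma> = \<alpha> powr (1 - t) * \<beta> powr t"
    have \<gamma>: "\<gamma> > 0" using pos by (simp add: \<gamma>_def)
    have sup: "\<exists>x. r \<le> k x / Sup (range k)" if k: "r < 1" "Sup (range k) > 0" "bdd_above (range k)" for r and k :: "real \<Rightarrow> real"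
    proof -
      have "r * Sup (range k) < Sup (range k)" using k by simp
      then obtain x where "r * Sup (range k) < k x"
        using less_cSup_iff[of "range k" "r * Sup (range k)"] k(3) by auto
      then show ?thesis using k by (intro exI[of _ x]) (simp add: field_simps)
    qed
    have "ennreal (1 - t) * (\<integral>\<^sup>+x. ennreal (f x / \<alpha>) \<partial>lborel) + ennreal t * (\<integral>\<^sup>+x. ennreal (g x / \<beta>) \<partial>lborel)
      \<le> (\<integral>\<^sup>+x. ennreal (h x / \<gamma>) \<partial>lborel)"
    proof (rule prekopa_leindler_real_normalized[where R = R])
      show "f x / \<alpha> \<le> 1" "g x / \<beta> \<le> 1" for x using up[of x] pos by auto
      show "\<exists>x. r \<le> f x / \<alpha>" "\<exists>x. r \<le> g x / \<beta>" if "r < 1" for r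
        using sup[OF that] pos bf by (auto simp: \<alpha>_def \<beta>_def)
      fix x y r :: real assume r: "0 < r" "r \<le> f x / \<alpha>" "r \<le> g y / \<beta>"
      have "r * \<gamma> = (r * \<alpha>) powr (1 - t) * (r * \<beta>) powr t"
      proof -
        have "(r * \<alpha>) powr (1 - t) * (r * \<beta>) powr t = (r powr (1 - t) * r powr t) * \<gamma>"
          using r pos by (simp add: powr_mult \<gamma>_def)
        also have "r powr (1 - t) * r powr t = r" using r by (simp add: powr_add[symmetric])
        finally show ?thesis by simp
      qed
      also have "\<dots> \<le> f x powr (1 - t) * g y powr t"
        using r pos t by (intro mult_mono powr_mono2) (auto simp: field_simps)
      also have "\<dots> \<le> h ((1 - t) * x + t * y)" by (rule fgh)
      finally show "r \<le> h ((1 - t) * x + t * y) / \<gamma>" using \<gamma> by (simp add: field_simps)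
    qed (use supp t in auto)
    also have "(\<integral>\<^sup>+x. ennreal (h x / \<gamma>) \<partial>lborel) = ennreal ((LINT x|lborel. h x) / \<gamma>)"
      using \<gamma> nonneg integ' by (subst nn_integral_eq_integral) auto
    also have "(\<integral>\<^sup>+x. ennreal (f x / \<alpha>) \<partial>lborel) = ennreal ((LINT x|lborel. f x) / \<alpha>)"
      using pos nonneg integ' by (subst nn_integral_eq_integral) auto
    also have "(\<integral>\<^sup>+x. ennreal (g x / \<beta>) \<partial>lborel) = ennreal ((LINT x|lborel. g x) / \<beta>)"
      using pos nonneg integ' by (subst nn_integral_eq_integral) auto
    finally have "(1 - t) * ((LINT x|lborel. f x) / \<alpha>) + t * ((LINT x|lborel. g x) / \<beta>) \<le> (LINT x|lborel. h x) / \<gamma>"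
      using t pos \<gamma> nonneg
      by (simp add: ennreal_mult[symmetric] ennreal_plus[symmetric] ennreal_le_iff integral_nonneg del: ennreal_plus)
    moreover have "((LINT x|lborel. f x) / \<alpha>) powr (1 - t) * ((LINT x|lborel. g x) / \<beta>) powr t
        \<le> (1 - t) * ((LINT x|lborel. f x) / \<alpha>) + t * ((LINT x|lborel. g x) / \<beta>)"
      using t pos nonneg by (intro weighted_am_gm) (auto intro!: integral_nonneg divide_nonneg_pos)
    moreover have "((LINT x|lborel. f x) / \<alpha>) powr (1 - t) * ((LINT x|lborel. g x) / \<beta>) powr t
       = (LINT x|lborel. f x) powr (1 - t) * (LINT x|lborel. g x) powr t / \<gamma>"
      using pos nonneg by (simp add: powr_divide \<gamma>_def integral_nonneg)
    ultimately have "(LINT x|lborel. f x) powr (1 - t) * (LINT x|lborel. g x) powr t / \<gamma> \<le> (LINT x|lborel. h x) / \<gamma>"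
      by linarith
    then show ?thesis using \<gamma> by (simp add: divide_le_cancel)
  qed
qed

section \<open>The Brunn--Minkowski inequality in finite products of lines\<close>

text \<open>The sets \<open>X\<close> live in a product of lines indexed by \<open>insert i I\<close>; a fibre is obtained by
fixing the coordinate \<open>i\<close>.\<close>

definition fibre_measure :: "'i set \<Rightarrow> 'i \<Rightarrow> ('i \<Rightarrow> real) set \<Rightarrow> real \<Rightarrow> real" where
  "fibre_measure I i X s = measure (PiM I (\<lambda>_. lborel)) {y \<in> space (PiM I (\<lambda>_. lborel)). y(i := s) \<in> X}"

lemma box_finite:
  assumes "finite I" "Y \<in> sets (PiM I (\<lambda>_. lborel))" "Y \<subseteq> PiE I (\<lambda>_. {-R..R::real})"
  shows "Y \<in> fmeasurable (PiM I (\<lambda>_. lborel))"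
    and "measure (PiM I (\<lambda>_. lborel)) Y \<le> measure (PiM I (\<lambda>_. lborel)) (PiE I (\<lambda>_. {-R..R}))"
proof -
  interpret product_sigma_finite "\<lambda>_. lborel :: real measure"
    by (simp add: product_sigma_finite_def lborel.sigma_finite_measure_axioms)
  have box: "PiE I (\<lambda>_. {-R..R}) \<in> fmeasurable (PiM I (\<lambda>_. lborel))"
    using assms(1) by (auto simp: fmeasurable_def emeasure_PiM emeasure_lborel_Icc_eq prod_ennreal
        simp del: prod_constant intro!: sets_PiM_I_finite)
  show "Y \<in> fmeasurable (PiM I (\<lambda>_. lborel))" by (rule fmeasurableI2[OF box assms(3,2)])
  show "measure (PiM I (\<lambda>_. lborel)) Y \<le> measure (PiM I (\<lambda>_. lborel)) (PiE I (\<lambda>_. {-R..R}))"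
    by (rule measure_mono_fmeasurable[OF assms(3,2) box])
qed

context
  fixes I :: "'i set" and i :: 'i and X :: "('i \<Rightarrow> real) set" and R :: real
  assumes I: "finite I" "i \<notin> I"
    and X [measurable]: "X \<in> sets (PiM (insert i I) (\<lambda>_. lborel))"
    and box: "X \<subseteq> PiE (insert i I) (\<lambda>_. {-R..R})"
begin

interpretation product_sigma_finite "\<lambda>_. lborel :: real measure"
  by (simp add: product_sigma_finite_def lborel.sigma_finite_measure_axioms)

interpretation sigma_finite_measure "PiM I (\<lambda>_. lborel :: real measure)"
  by (rule sigma_finite[OF I(1)])

lemma fibre_sets [measurable]: "{y \<in> space (PiM I (\<lambda>_. lborel)). y(i := s) \<in> X} \<in> sets (PiM I (\<lambda>_. lborel))"
  by measurable

lemma fibre_subset_box: "{y \<in> space (PiM I (\<lambda>_. lborel)). y(i := s) \<in> X} \<subseteq> PiE I (\<lambda>_. {-R..R})"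
proof
  fix y assume "y \<in> {y \<in> space (PiM I (\<lambda>_. lborel)). y(i := s) \<in> X}"
  then have y: "y \<in> space (PiM I (\<lambda>_. lborel))" "y(i := s) \<in> X" by auto
  have "y(i := s) \<in> PiE (insert i I) (\<lambda>_. {-R..R})" using box y by auto
  then show "y \<in> PiE I (\<lambda>_. {-R..R})"
    using I y(1) by (auto simp: space_PiM PiE_iff extensional_def split: if_splits)
qed

lemma fibre_measure_eq: "ennreal (fibre_measure I i X s) = (\<integral>\<^sup>+y. indicator X (y(i := s)) \<partial>PiM I (\<lambda>_. lborel))"
proof -
  have "(\<integral>\<^sup>+y. indicator X (y(i := s)) \<partial>PiM I (\<lambda>_. lborel))
      = (\<integral>\<^sup>+y. indicator {y \<in> space (PiM I (\<lambda>_. lborel)). y(i := s) \<in> X} y \<partial>PiM I (\<lambda>_. lborel))"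
    by (intro nn_integral_cong) (auto simp: indicator_def)
  also have "\<dots> = emeasure (PiM I (\<lambda>_. lborel)) {y \<in> space (PiM I (\<lambda>_. lborel)). y(i := s) \<in> X}"
    by (rule nn_integral_indicator) (rule fibre_sets)
  also have "\<dots> = ennreal (fibre_measure I i X s)"
    unfolding fibre_measure_def
    by (intro emeasure_eq_ennreal_measure fmeasurableD2 box_finite(1)[OF I(1) fibre_sets fibre_subset_box])
  finally show ?thesis by simp
qed

lemma fibre_measure_measurable [measurable]: "fibre_measure I i X \<in> borel_measurable borel"
proof -
  have "(\<lambda>s. \<integral>\<^sup>+y. indicator X (y(i := s)) \<partial>PiM I (\<lambda>_. lborel :: real measure)) \<in> borel_measurable (borel :: real measure)"
    by measurable
  then have "(\<lambda>s. enn2real (\<integral>\<^sup>+y. indicator X (y(i := s)) \<partial>PiM I (\<lambda>_. lborel :: real measure))) \<in> borel_measurable borel"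
    by measurable
  moreover have "fibre_measure I i X = (\<lambda>s. enn2real (\<integral>\<^sup>+y. indicator X (y(i := s)) \<partial>PiM I (\<lambda>_. lborel)))"
    by (simp add: fun_eq_iff fibre_measure_eq[symmetric]) (simp add: fibre_measure_def)
  ultimately show ?thesis by simp
qed

lemma fibre_measure_nonneg: "0 \<le> fibre_measure I i X s"
  by (simp add: fibre_measure_def)

lemma fibre_measure_bounded: "fibre_measure I i X s \<le> measure (PiM I (\<lambda>_. lborel)) (PiE I (\<lambda>_. {-R..R}))"
  unfolding fibre_measure_def using box_finite(2)[OF I(1) fibre_sets fibre_subset_box] .

lemma fibre_measure_support:
  assumes "R < \<bar>s\<bar>"
  shows "fibre_measure I i X s = 0"
proof -
  have "y(i := s) \<notin> X" for y
  proof
    assume "y(i := s) \<in> X"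
    then have "(y(i := s)) i \<in> {-R..R}" using box by blast
    then show False using assms by auto
  qed
  then show ?thesis by (simp add: fibre_measure_def)
qed

lemma nn_integral_PiM_fibre:
  assumes [measurable]: "\<phi> \<in> borel_measurable borel"
  shows "(\<integral>\<^sup>+x. \<phi> (x i) * indicator X x \<partial>PiM (insert i I) (\<lambda>_. lborel))
    = (\<integral>\<^sup>+s. \<phi> s * ennreal (fibre_measure I i X s) \<partial>lborel)"
proof -
  have "(\<integral>\<^sup>+x. \<phi> (x i) * indicator X x \<partial>PiM (insert i I) (\<lambda>_. lborel))
    = (\<integral>\<^sup>+s. \<integral>\<^sup>+y. \<phi> ((y(i := s)) i) * indicator X (y(i := s)) \<partial>PiM I (\<lambda>_. lborel) \<partial>lborel)"
    by (rule product_nn_integral_insert_rev[OF I]) measurable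
  also have "\<dots> = (\<integral>\<^sup>+s. \<phi> s * ennreal (fibre_measure I i X s) \<partial>lborel)"
    by (simp add: fibre_measure_eq nn_integral_cmult)
  finally show ?thesis .
qed

lemma measure_PiM_fibre: "measure (PiM (insert i I) (\<lambda>_. lborel)) X = (LINT s|lborel. fibre_measure I i X s)"
proof -
  have "emeasure (PiM (insert i I) (\<lambda>_. lborel)) X = (\<integral>\<^sup>+s. ennreal (fibre_measure I i X s) \<partial>lborel)"
    using nn_integral_PiM_fibre[of "\<lambda>_. 1"] by simp
  then show ?thesis
    by (simp add: measure_def integral_eq_nn_integral fibre_measure_nonneg)
qed

end

text \<open>The multiplicative form of the Brunn--Minkowski inequality passes to one more dimension: by
induction the fibre measures satisfy the hypothesis of the Prekopa--Leindler inequality on the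
line, and their integrals are the measures of the sets.  Working with finite products of lines
makes this induction on the dimension possible; the common box keeps all measures finite.\<close>

lemma brunn_minkowski_PiM:
  fixes A B M :: "('i \<Rightarrow> real) set"
  assumes "finite I" and t: "0 < t" "t < 1"
    and "A \<in> sets (PiM I (\<lambda>_. lborel))" "B \<in> sets (PiM I (\<lambda>_. lborel))" "M \<in> sets (PiM I (\<lambda>_. lborel))"
    and "A \<subseteq> PiE I (\<lambda>_. {-R..R})" "B \<subseteq> PiE I (\<lambda>_. {-R..R})" "M \<subseteq> PiE I (\<lambda>_. {-R..R})"
    and "\<And>a b. a \<in> A \<Longrightarrow> b \<in> B \<Longrightarrow> (\<lambda>j\<in>I. (1 - t) * a j + t * b j) \<in> M"
  shows "measure (PiM I (\<lambda>_. lborel)) A powr (1 - t) * measure (PiM I (\<lambda>_. lborel)) B powr t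
    \<le> measure (PiM I (\<lambda>_. lborel)) M"
  using assms(1,4-)
proof (induction I arbitrary: A B M)
  case empty
  show ?case
  proof (cases "A = {} \<or> B = {}")
    case False
    then obtain a b where ab: "a \<in> A" "b \<in> B" by auto
    then have "(\<lambda>_. undefined) \<in> M" using empty.prems(7)[OF ab] by (simp add: restrict_def)
    then have M: "M = {\<lambda>_. undefined}" using empty.prems(3) sets.sets_into_space[of M "PiM {} (\<lambda>_. lborel)"] by (auto simp: space_PiM)
    have "measure (PiM {} (\<lambda>_. lborel)) M = 1" by (simp add: M measure_def)
    moreover have "measure (PiM {} (\<lambda>_. lborel)) X \<le> 1" if "X \<in> sets (PiM {} (\<lambda>_. lborel))" for X :: "('i \<Rightarrow> real) set"
    proof -
      have "X \<subseteq> {\<lambda>_. undefined}" using that sets.sets_into_space[of X "PiM {} (\<lambda>_. lborel)"] by (auto simp: space_PiM)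
      then have "X = {} \<or> X = {\<lambda>_. undefined}" by auto
      then show ?thesis by (auto simp: measure_def)
    qed
    ultimately show ?thesis
      using empty.prems(1,2) t powr_mono2[of "1 - t" _ 1] powr_mono2[of t _ 1]
      by (auto intro!: mult_le_one)
  qed auto
next
  case (insert i I)
  have sets: "X \<in> sets (PiM (insert i I) (\<lambda>_. lborel))" "X \<subseteq> PiE (insert i I) (\<lambda>_. {-R..R})" if "X \<in> {A, B, M}" for X
    using that insert.prems by auto
  note fibre = insert.hyps(1,2) sets
  show ?case
    unfolding measure_PiM_fibre[OF fibre, of A, simplified] measure_PiM_fibre[OF fibre, of B, simplified]
      measure_PiM_fibre[OF fibre, of M, simplified]
  proof (rule prekopa_leindler_real[where R = R and K = "measure (PiM I (\<lambda>_. lborel)) (PiE I (\<lambda>_. {-R..R}))"])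
    fix r s :: real
    let ?F = "\<lambda>X s. {y \<in> space (PiM I (\<lambda>_. lborel)). y(i := s) \<in> X}"
    show "fibre_measure I i A r powr (1 - t) * fibre_measure I i B s powr t \<le> fibre_measure I i M ((1 - t) * r + t * s)"
      unfolding fibre_measure_def
    proof (rule insert.IH)
      fix a b assume ab: "a \<in> ?F A r" "b \<in> ?F B s"
      have "(\<lambda>j\<in>insert i I. (1 - t) * (a(i := r)) j + t * (b(i := s)) j) \<in> M"
        using insert.prems(7) ab by blast
      moreover have "(\<lambda>j\<in>insert i I. (1 - t) * (a(i := r)) j + t * (b(i := s)) j)
          = (\<lambda>j\<in>I. (1 - t) * a j + t * b j)(i := (1 - t) * r + t * s)"
        using insert.hyps(2) by (auto simp: fun_eq_iff restrict_def)
      ultimately show "(\<lambda>j\<in>I. (1 - t) * a j + t * b j) \<in> ?F M ((1 - t) * r + t * s)"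
        by (auto simp: space_PiM)
    qed (use fibre_sets[OF fibre] fibre_subset_box[OF fibre] in auto)
  qed (use t fibre_measure_measurable[OF fibre] fibre_measure_nonneg[OF fibre] fibre_measure_bounded[OF fibre]
      fibre_measure_support[OF fibre] in auto)
qed

section \<open>Sections by coordinate hyperplanes\<close>

text \<open>This makes the slice function of a symmetric body even at every point, and not only almost
everywhere.\<close>

lemma PiM_lborel_reflect:
  assumes "finite I"
  shows "distr (PiM I (\<lambda>_. lborel)) (PiM I (\<lambda>_. lborel)) (\<lambda>f. \<lambda>i\<in>I. - f i) = PiM I (\<lambda>_. lborel :: real measure)"
proof -
  interpret product_sigma_finite "\<lambda>_. lborel :: real measure"
    by (simp add: product_sigma_finite_def lborel.sigma_finite_measure_axioms)
  have meas: "(\<lambda>f. \<lambda>i\<in>I. - f i) \<in> PiM I (\<lambda>_. lborel :: real measure) \<rightarrow>\<^sub>M PiM I (\<lambda>_. lborel :: real measure)"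
    by measurable
  show ?thesis
  proof (rule PiM_eqI[OF assms])
    fix A :: "'a \<Rightarrow> real set" assume A: "\<And>i. i \<in> I \<Longrightarrow> A i \<in> sets lborel"
    have neg: "uminus -` A i \<in> sets borel \<and> emeasure lborel (uminus -` A i) = emeasure lborel (A i)" if "i \<in> I" for i
    proof -
      have "emeasure (distr lborel borel uminus) (A i) = emeasure lborel (uminus -` A i)"
        using A[OF that] by (subst emeasure_distr) auto
      moreover have "uminus -` A i \<in> sets borel"
        using A[OF that] measurable_sets[of uminus borel borel "A i"] by simp
      ultimately show ?thesis by (simp add: lborel_distr_uminus)
    qed
    have pre: "(\<lambda>f. \<lambda>i\<in>I. - f i) -` Pi\<^sub>E I A \<inter> space (PiM I (\<lambda>_. lborel)) = Pi\<^sub>E I (\<lambda>i. uminus -` A i)"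
      by (auto simp: space_PiM PiE_iff)
    have "emeasure (distr (PiM I (\<lambda>_. lborel)) (PiM I (\<lambda>_. lborel)) (\<lambda>f. \<lambda>i\<in>I. - f i)) (Pi\<^sub>E I A)
        = emeasure (PiM I (\<lambda>_. lborel)) (Pi\<^sub>E I (\<lambda>i. uminus -` A i))"
      using A assms by (subst emeasure_distr[OF meas]) (auto simp: pre intro!: sets_PiM_I_finite)
    also have "\<dots> = (\<Prod>i\<in>I. emeasure lborel (A i))"
      using assms neg by (subst emeasure_PiM) auto
    finally show "emeasure (distr (PiM I (\<lambda>_. lborel)) (PiM I (\<lambda>_. lborel)) (\<lambda>f. \<lambda>i\<in>I. - f i)) (Pi\<^sub>E I A)
        = (\<Prod>i\<in>I. emeasure lborel (A i))" .
  qed simp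
qed

definition of_coords :: "('a::euclidean_space \<Rightarrow> real) \<Rightarrow> 'a" where
  "of_coords y = (\<Sum>b\<in>Basis. y b *\<^sub>R b)"

lemma of_coords_inner: "b \<in> Basis \<Longrightarrow> of_coords y \<bullet> b = y b"
  by (simp add: of_coords_def inner_sum_left inner_Basis if_distrib cong: if_cong)

lemma of_coords_measurable [measurable]: "of_coords \<in> PiM Basis (\<lambda>_. lborel) \<rightarrow>\<^sub>M borel"
proof -
  have "(\<lambda>y. \<Sum>b\<in>Basis. y b *\<^sub>R b) \<in> PiM Basis (\<lambda>_. lborel) \<rightarrow>\<^sub>M borel"
    by measurable
  then show ?thesis by (simp add: of_coords_def[abs_def])
qed

definition coord_set :: "'a::euclidean_space set \<Rightarrow> ('a \<Rightarrow> real) set" where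
  "coord_set A = {y \<in> space (PiM Basis (\<lambda>_. lborel)). of_coords y \<in> A}"

lemma coord_set_sets: "A \<in> sets borel \<Longrightarrow> coord_set A \<in> sets (PiM Basis (\<lambda>_. lborel))"
  using measurable_sets[OF of_coords_measurable, of A]
  by (simp add: coord_set_def vimage_def Int_def conj_commute)

lemma coord_set_box:
  assumes "A \<subseteq> cball 0 R"
  shows "coord_set A \<subseteq> PiE Basis (\<lambda>_. {-R..R})"
proof
  fix y assume y: "y \<in> coord_set A"
  have "\<bar>y b\<bar> \<le> R" if "b \<in> Basis" for b
  proof -
    have "\<bar>of_coords y \<bullet> b\<bar> \<le> norm (of_coords y)" using that by (rule Basis_le_norm)
    also have "\<dots> \<le> R" using y assms by (auto simp: coord_set_def)
    finally show ?thesis using that by (simp add: of_coords_inner)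
  qed
  then show "y \<in> PiE Basis (\<lambda>_. {-R..R})"
    using y by (auto simp: coord_set_def space_PiM PiE_iff abs_le_iff) force
qed

text \<open>This is the (n-1)-dimensional measure of the section of \<open>A\<close> by the hyperplane \<open>x \<bullet> e = s\<close>,
computed in the coordinates other than \<open>e\<close>.\<close>

definition slice_measure :: "'a::euclidean_space \<Rightarrow> 'a set \<Rightarrow> real \<Rightarrow> real" where
  "slice_measure e A = fibre_measure (Basis - {e}) e (coord_set A)"

abbreviation slice_space :: "'a::euclidean_space \<Rightarrow> ('a \<Rightarrow> real) measure" where
  "slice_space e \<equiv> PiM (Basis - {e}) (\<lambda>_. lborel)"

lemma slice_measure_eq:
  assumes "e \<in> Basis"
  shows "slice_measure e A s = measure (slice_space e) {y \<in> space (slice_space e). of_coords (y(e := s)) \<in> A}"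
proof -
  have "y(e := s) \<in> space (PiM Basis (\<lambda>_. lborel))" if "y \<in> space (slice_space e)" for y :: "'a \<Rightarrow> real"
    using that assms by (auto simp: space_PiM PiE_iff extensional_def)
  then show ?thesis
    unfolding slice_measure_def fibre_measure_def coord_set_def
    by (intro arg_cong[where f = "measure _"]) auto
qed

context
  fixes e :: "'a::euclidean_space"
  assumes e: "e \<in> Basis"
begin

lemma slice_coord_measurable [measurable]:
  "(\<lambda>y. of_coords (y(e := s))) \<in> slice_space e \<rightarrow>\<^sub>M borel"
proof -
  have "(\<lambda>y. y(e := s)) \<in> slice_space e \<rightarrow>\<^sub>M PiM (insert e (Basis - {e})) (\<lambda>_. lborel :: real measure)"
    by (rule measurable_fun_upd[where J = "Basis - {e}"]) (use e in auto)
  then show ?thesis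
    using e measurable_compose[OF _ of_coords_measurable] by (simp add: insert_absorb)
qed

lemma of_coords_slice: "of_coords (y(e := s)) \<bullet> e = s"
  using e by (simp add: of_coords_inner)

lemma slice_box:
  assumes "A \<in> sets borel" "A \<subseteq> cball 0 R"
  shows "finite (Basis - {e})" "e \<notin> Basis - {e}"
    "coord_set A \<in> sets (PiM (insert e (Basis - {e})) (\<lambda>_. lborel))"
    "coord_set A \<subseteq> PiE (insert e (Basis - {e})) (\<lambda>_. {-R..R})"
  using e coord_set_sets[OF assms(1)] coord_set_box[OF assms(2)] by (auto simp: insert_absorb)

lemma slice_measure_nonneg: "0 \<le> slice_measure e A s"
  by (simp add: slice_measure_def fibre_measure_def)

lemma slice_measure_measurable:
  assumes "A \<in> sets borel" "A \<subseteq> cball 0 R"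
  shows "slice_measure e A \<in> borel_measurable borel"
  unfolding slice_measure_def by (rule fibre_measure_measurable[OF slice_box[OF assms]])

lemma slice_fmeasurable:
  assumes "A \<in> sets borel" "A \<subseteq> cball 0 R"
  shows "{y \<in> space (slice_space e). of_coords (y(e := s)) \<in> A} \<in> fmeasurable (slice_space e)"
proof -
  have eq: "{y \<in> space (slice_space e). of_coords (y(e := s)) \<in> A} = {y \<in> space (slice_space e). y(e := s) \<in> coord_set A}"
    using e by (auto simp: coord_set_def space_PiM PiE_iff extensional_def)
  show ?thesis
    unfolding eq
    by (rule box_finite(1)[OF _ fibre_sets[OF slice_box[OF assms]] fibre_subset_box[OF slice_box[OF assms]]]) simp
qed

lemma nn_integral_slice:
  assumes "A \<in> sets borel" "A \<subseteq> cball 0 R" and [measurable]: "\<phi> \<in> borel_measurable borel"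
  shows "(\<integral>\<^sup>+x. \<phi> (x \<bullet> e) * indicator A x \<partial>lborel) = (\<integral>\<^sup>+s. \<phi> s * ennreal (slice_measure e A s) \<partial>lborel)"
proof -
  have "(\<integral>\<^sup>+x. \<phi> (x \<bullet> e) * indicator A x \<partial>lborel)
     = (\<integral>\<^sup>+x. \<phi> (x \<bullet> e) * indicator A x \<partial>distr (PiM Basis (\<lambda>_. lborel)) borel of_coords)"
    by (subst lborel_eq) (simp add: of_coords_def[abs_def])
  also have "\<dots> = (\<integral>\<^sup>+y. \<phi> (of_coords y \<bullet> e) * indicator A (of_coords y) \<partial>PiM Basis (\<lambda>_. lborel))"
    using assms(1) by (subst nn_integral_distr) auto
  also have "\<dots> = (\<integral>\<^sup>+y. \<phi> (y e) * indicator (coord_set A) y \<partial>PiM (insert e (Basis - {e})) (\<lambda>_. lborel))"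
    using e by (auto simp: insert_absorb of_coords_inner coord_set_def indicator_def intro!: nn_integral_cong)
  also have "\<dots> = (\<integral>\<^sup>+s. \<phi> s * ennreal (slice_measure e A s) \<partial>lborel)"
    unfolding slice_measure_def by (rule nn_integral_PiM_fibre[OF slice_box[OF assms(1,2)] assms(3)])
  finally show ?thesis .
qed

lemma integral_slice:
  assumes "A \<in> sets borel" "A \<subseteq> cball 0 R" and [measurable]: "\<phi> \<in> borel_measurable borel" and "\<And>s. 0 \<le> \<phi> s"
  shows "(LINT x:A|lborel. \<phi> (x \<bullet> e)) = (LINT s|lborel. \<phi> s * slice_measure e A s)"
proof -
  have [measurable]: "A \<in> sets borel" "slice_measure e A \<in> borel_measurable borel"
    using assms slice_measure_measurable by auto
  have "(LINT x:A|lborel. \<phi> (x \<bullet> e)) = enn2real (\<integral>\<^sup>+x. ennreal (indicator A x * \<phi> (x \<bullet> e)) \<partial>lborel)"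
    unfolding set_lebesgue_integral_def
    by (subst integral_eq_nn_integral) (use assms(4) in auto)
  also have "(\<integral>\<^sup>+x. ennreal (indicator A x * \<phi> (x \<bullet> e)) \<partial>lborel)
      = (\<integral>\<^sup>+x. ennreal (\<phi> (x \<bullet> e)) * indicator A x \<partial>lborel)"
    by (intro nn_integral_cong) (auto simp: indicator_def)
  also have "\<dots> = (\<integral>\<^sup>+s. ennreal (\<phi> s * slice_measure e A s) \<partial>lborel)"
    using assms(4) by (subst nn_integral_slice[OF assms(1,2)]) (auto simp: ennreal_mult' slice_measure_nonneg)
  also have "enn2real \<dots> = (LINT s|lborel. \<phi> s * slice_measure e A s)"
    by (subst integral_eq_nn_integral) (use assms(4) slice_measure_nonneg in auto)
  finally show ?thesis .
qed

text \<open>Only points of the two given sections enter the hypothesis; for a convex set \<open>A = B = M\<close> the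
conclusion says that the section function is log-concave.\<close>

lemma slice_measure_log_concave:
  assumes "A \<in> sets borel" "A \<subseteq> cball 0 R" "B \<in> sets borel" "B \<subseteq> cball 0 R" "M \<in> sets borel" "M \<subseteq> cball 0 R"
    and t: "0 < t" "t < 1"
    and sub: "\<And>a b. a \<in> A \<Longrightarrow> b \<in> B \<Longrightarrow> a \<bullet> e = r \<Longrightarrow> b \<bullet> e = s \<Longrightarrow> (1 - t) *\<^sub>R a + t *\<^sub>R b \<in> M"
  shows "slice_measure e A r powr (1 - t) * slice_measure e B s powr t \<le> slice_measure e M ((1 - t) * r + t * s)"
  unfolding slice_measure_def fibre_measure_def
proof (rule brunn_minkowski_PiM[where R = R])
  fix a b
  assume a: "a \<in> {y \<in> space (slice_space e). y(e := r) \<in> coord_set A}"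
    and b: "b \<in> {y \<in> space (slice_space e). y(e := s) \<in> coord_set B}"
  let ?c = "(\<lambda>j\<in>Basis - {e}. (1 - t) * a j + t * b j)"
  have "of_coords (?c(e := (1 - t) * r + t * s)) = (1 - t) *\<^sub>R of_coords (a(e := r)) + t *\<^sub>R of_coords (b(e := s))"
    by (rule euclidean_eqI) (auto simp: of_coords_inner inner_add_left)
  also have "\<dots> \<in> M"
    using a b by (intro sub) (auto simp: coord_set_def of_coords_slice)
  finally show "?c \<in> {y \<in> space (slice_space e). y(e := (1 - t) * r + t * s) \<in> coord_set M}"
    using e by (auto simp: coord_set_def space_PiM PiE_iff extensional_def)
qed (use t fibre_sets[OF slice_box] fibre_subset_box[OF slice_box] assms in auto)

lemma slice_measure_mono:
  assumes "A \<in> sets borel" "B \<in> sets borel" "B \<subseteq> cball 0 R" "\<And>x. x \<in> A \<Longrightarrow> x \<bullet> e = s \<Longrightarrow> x \<in> B"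
  shows "slice_measure e A s \<le> slice_measure e B s"
  unfolding slice_measure_eq[OF e]
proof (rule measure_mono_fmeasurable)
  have "(\<lambda>y. of_coords (y(e := s))) -` A \<inter> space (slice_space e) \<in> sets (slice_space e)"
    using assms(1) by (intro measurable_sets[OF slice_coord_measurable]) auto
  then show "{y \<in> space (slice_space e). of_coords (y(e := s)) \<in> A} \<in> sets (slice_space e)"
    by (simp add: vimage_def Int_def conj_commute)
qed (use assms slice_fmeasurable[OF assms(2,3)] of_coords_slice in auto)

lemma slice_measure_Diff:
  assumes "A \<in> sets borel" "A \<subseteq> cball 0 R" "B \<in> sets borel"
  shows "slice_measure e (A - B) s = slice_measure e A s - slice_measure e (A \<inter> B) s"
proof -
  have sub: "A \<inter> B \<subseteq> cball 0 R" using assms by auto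
  have "{y \<in> space (slice_space e). of_coords (y(e := s)) \<in> A - B}
      = {y \<in> space (slice_space e). of_coords (y(e := s)) \<in> A} - {y \<in> space (slice_space e). of_coords (y(e := s)) \<in> A \<inter> B}"
    by auto
  then show ?thesis
    unfolding slice_measure_eq[OF e]
    using measurable_measure_Diff[OF slice_fmeasurable[OF assms(1,2), of s] fmeasurableD[OF slice_fmeasurable[OF sets.Int[OF assms(1,3)] sub, of s]]]
    by auto
qed

lemma slice_measure_reflect:
  assumes "A \<in> sets borel"
  shows "slice_measure e (uminus ` A) (- s) = slice_measure e A s"
proof -
  let ?f = "\<lambda>y. \<lambda>i\<in>Basis - {e}. - y i :: real"
  have meas: "?f \<in> slice_space e \<rightarrow>\<^sub>M slice_space e" by measurable
  have uA: "uminus ` A = uminus -` A" by (auto simp: image_iff) (metis minus_minus)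
  have "{y \<in> space (slice_space e). of_coords (y(e := s)) \<in> A} = (\<lambda>y. of_coords (y(e := s))) -` A \<inter> space (slice_space e)"
    by auto
  then have setsA: "{y \<in> space (slice_space e). of_coords (y(e := s)) \<in> A} \<in> sets (slice_space e)"
    using assms measurable_sets[OF slice_coord_measurable] by auto
  have neg: "of_coords ((?f y)(e := s)) = - of_coords (y(e := - s))" for y
    by (rule euclidean_eqI) (use e in \<open>auto simp: of_coords_inner\<close>)
  have "slice_measure e A s = measure (distr (slice_space e) (slice_space e) ?f) {y \<in> space (slice_space e). of_coords (y(e := s)) \<in> A}"
    by (simp add: slice_measure_eq[OF e] PiM_lborel_reflect)
  also have "\<dots> = measure (slice_space e) (?f -` {y \<in> space (slice_space e). of_coords (y(e := s)) \<in> A} \<inter> space (slice_space e))"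
    by (rule measure_distr[OF meas setsA])
  also have "?f -` {y \<in> space (slice_space e). of_coords (y(e := s)) \<in> A} \<inter> space (slice_space e)
      = {y \<in> space (slice_space e). of_coords (y(e := - s)) \<in> uminus ` A}"
    unfolding uA using neg by (auto simp: space_PiM)
  finally show ?thesis by (simp add: slice_measure_eq[OF e])
qed

lemma slice_measure_pos:
  assumes "A \<in> sets borel" "A \<subseteq> cball 0 R" "x \<in> interior A" "x \<bullet> e = s"
  shows "0 < slice_measure e A s"
proof -
  interpret product_sigma_finite "\<lambda>_. lborel :: real measure"
    by (simp add: product_sigma_finite_def lborel.sigma_finite_measure_axioms)
  obtain d where d: "d > 0" "cball x d \<subseteq> A" using assms(3) by (auto simp: mem_interior_cball)
  define \<delta> where "\<delta> = d / DIM('a)"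
  have \<delta>: "\<delta> > 0" using d by (simp add: \<delta>_def)
  \<comment> \<open>A cube around the interior point lies in the section and has positive measure.\<close>
  let ?Q = "PiE (Basis - {e}) (\<lambda>b. {x \<bullet> b - \<delta>..x \<bullet> b + \<delta>})"
  have "?Q \<subseteq> {y \<in> space (slice_space e). of_coords (y(e := s)) \<in> A}"
  proof
    fix y assume y: "y \<in> ?Q"
    have "\<bar>(of_coords (y(e := s)) - x) \<bullet> b\<bar> \<le> \<delta>" if "b \<in> Basis" for b
      using y that assms(4) \<delta> by (cases "b = e") (auto simp: of_coords_inner inner_diff_left PiE_iff abs_le_iff algebra_simps)
    then have "norm (of_coords (y(e := s)) - x) \<le> (\<Sum>b\<in>(Basis::'a set). \<delta>)"
      by (intro order_trans[OF norm_le_l1] sum_mono)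
    also have "\<dots> = d" by (simp add: \<delta>_def)
    finally have "of_coords (y(e := s)) \<in> cball x d" by (simp add: dist_norm norm_minus_commute)
    then show "y \<in> {y \<in> space (slice_space e). of_coords (y(e := s)) \<in> A}"
      using d y by (auto simp: space_PiM PiE_iff)
  qed
  then have "measure (slice_space e) ?Q \<le> slice_measure e A s"
    unfolding slice_measure_eq[OF e]
    by (rule measure_mono_fmeasurable) (use slice_fmeasurable[OF assms(1,2)] in \<open>auto intro!: sets_PiM_I_finite\<close>)
  moreover have "emeasure (slice_space e) ?Q = ennreal ((2 * \<delta>) ^ card (Basis - {e}))"
    using \<delta> by (subst emeasure_PiM) (auto simp: prod_ennreal ennreal_power)
  then have "measure (slice_space e) ?Q = (2 * \<delta>) ^ card (Basis - {e})"
    using \<delta> by (simp add: measure_def)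
  ultimately show ?thesis using \<delta> by (smt (verit) zero_less_power)
qed

end

section \<open>Mean values and linear bijections\<close>

lemma nn_integral_lborel_affine:
  fixes f :: "'a::euclidean_space \<Rightarrow> ennreal"
  assumes [measurable]: "f \<in> borel_measurable borel" and "\<bar>c\<bar> = 1"
  shows "(\<integral>\<^sup>+x. f (a + c *\<^sub>R x) \<partial>lborel) = (\<integral>\<^sup>+x. f x \<partial>lborel)"
proof -
  have "c \<noteq> 0" using assms(2) by auto
  have "(\<integral>\<^sup>+x. f x \<partial>lborel) = (\<integral>\<^sup>+x. f x \<partial>density (distr lborel borel (\<lambda>x. a + c *\<^sub>R x)) (\<lambda>_. \<bar>c\<bar> ^ DIM('a)))"
    using lborel_affine[OF \<open>c \<noteq> 0\<close>, of a] by simp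
  also have "\<dots> = (\<integral>\<^sup>+x. f (a + c *\<^sub>R x) \<partial>lborel)"
    using assms(2) by (simp add: density_1 nn_integral_distr)
  finally show ?thesis by simp
qed

text \<open>The uniqueness argument for Haar measure, with \<open>T\<close> built in: both sides are the double integral of
\<open>f (T x) * g (T x + y)\<close>, evaluated in two orders with translation invariance in between.  So the
image of Lebesgue measure under \<open>T\<close> is a multiple of it.  The factor cancels in mean values.\<close>

lemma nn_integral_linear_image_proportional:
  fixes T :: "'a::euclidean_space \<Rightarrow> 'a" and f g :: "'a \<Rightarrow> ennreal"
  assumes T: "linear T" "bij T" and f [measurable]: "f \<in> borel_measurable borel" and g [measurable]: "g \<in> borel_measurable borel"
  shows "(\<integral>\<^sup>+x. f (T x) \<partial>lborel) * (\<integral>\<^sup>+x. g x \<partial>lborel) = (\<integral>\<^sup>+x. g (T x) \<partial>lborel) * (\<integral>\<^sup>+x. f x \<partial>lborel)"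
proof -
  obtain S where S: "linear S" "\<And>x. S (T x) = x" "\<And>x. T (S x) = x"
    using T linear_injective_left_inverse[of T] by (metis bij_def eq_id_iff isomorphism_expand linear_surjective_right_inverse o_apply left_right_inverse_eq)
  have [measurable]: "T \<in> borel_measurable borel" "S \<in> borel_measurable borel"
    using T S by (auto intro!: borel_measurable_continuous_onI linear_continuous_on linear_conv_bounded_linear[THEN iffD1])
  have "(\<integral>\<^sup>+x. f (T x) \<partial>lborel) * (\<integral>\<^sup>+y. g y \<partial>lborel) = (\<integral>\<^sup>+x. f (T x) * (\<integral>\<^sup>+y. g (T x + 1 *\<^sub>R y) \<partial>lborel) \<partial>lborel)"
    by (subst nn_integral_lborel_affine) (auto simp: nn_integral_multc)
  also have "\<dots> = (\<integral>\<^sup>+x. \<integral>\<^sup>+y. f (T x) * g (T x + y) \<partial>lborel \<partial>lborel)"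
    by (simp add: nn_integral_cmult)
  also have "\<dots> = (\<integral>\<^sup>+y. \<integral>\<^sup>+x. f (T x) * g (T x + y) \<partial>lborel \<partial>lborel)"
    by (rule lborel_pair.Fubini') measurable
  also have "\<dots> = (\<integral>\<^sup>+y. \<integral>\<^sup>+x. f (T x + (-1) *\<^sub>R y) * g (T x) \<partial>lborel \<partial>lborel)"
  proof (rule nn_integral_cong)
    fix y
    have "(\<integral>\<^sup>+x. f (T x + (-1) *\<^sub>R y) * g (T x) \<partial>lborel)
        = (\<integral>\<^sup>+x. f (T (S y + 1 *\<^sub>R x) + (-1) *\<^sub>R y) * g (T (S y + 1 *\<^sub>R x)) \<partial>lborel)"
      by (rule nn_integral_lborel_affine[symmetric]) auto
    also have "\<dots> = (\<integral>\<^sup>+x. f (T x) * g (T x + y) \<partial>lborel)"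
      using T S by (simp add: linear_add algebra_simps)
    finally show "(\<integral>\<^sup>+x. f (T x) * g (T x + y) \<partial>lborel) = (\<integral>\<^sup>+x. f (T x + (-1) *\<^sub>R y) * g (T x) \<partial>lborel)" ..
  qed
  also have "\<dots> = (\<integral>\<^sup>+x. \<integral>\<^sup>+y. f (T x + (-1) *\<^sub>R y) * g (T x) \<partial>lborel \<partial>lborel)"
    by (rule lborel_pair.Fubini') measurable
  also have "\<dots> = (\<integral>\<^sup>+x. (\<integral>\<^sup>+y. f (T x + (-1) *\<^sub>R y) \<partial>lborel) * g (T x) \<partial>lborel)"
    by (intro nn_integral_cong nn_integral_multc) measurable
  also have "\<dots> = (\<integral>\<^sup>+x. (\<integral>\<^sup>+y. f y \<partial>lborel) * g (T x) \<partial>lborel)"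
    by (subst nn_integral_lborel_affine) auto
  also have "\<dots> = (\<integral>\<^sup>+x. g (T x) \<partial>lborel) * (\<integral>\<^sup>+x. f x \<partial>lborel)"
    by (simp add: nn_integral_cmult mult.commute)
  finally show ?thesis .
qed

lemma integral_linear_image:
  fixes T :: "'a::euclidean_space \<Rightarrow> 'a"
  assumes T: "linear T" "bij T"
  shows "\<exists>c::real>0. \<forall>f::'a \<Rightarrow> real. f \<in> borel_measurable borel \<longrightarrow> (\<forall>x. 0 \<le> f x) \<longrightarrow> (LINT x|lborel. f (T x)) = c * (LINT x|lborel. f x)"
proof -
  let ?g = "indicator (ball 0 1) :: 'a \<Rightarrow> ennreal"
  obtain S where S: "linear S" "\<And>x. S (T x) = x" "\<And>x. T (S x) = x"
    using T linear_injective_left_inverse[of T] by (metis bij_def eq_id_iff isomorphism_expand linear_surjective_right_inverse o_apply left_right_inverse_eq)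
  have TS: "T -` ball 0 1 = S ` ball 0 1" 
  proof (intro equalityI subsetI)
    show "x \<in> S ` ball 0 1" if "x \<in> T -` ball 0 1" for x
      using that S(2)[of x] by (metis imageI vimage_eq)
  qed (auto simp: S(3))
  have cont: "continuous_on UNIV T" "continuous_on UNIV S"
    using T S by (auto intro!: linear_continuous_on linear_conv_bounded_linear[THEN iffD1])
  then have [measurable]: "T \<in> borel_measurable borel" by (auto intro!: borel_measurable_continuous_onI)
  have op: "open (T -` ball 0 1)" using cont by (intro open_vimage) auto
  have bd: "bounded (T -` ball 0 1)" unfolding TS
    by (rule bounded_linear_image) (use S in \<open>auto simp: linear_conv_bounded_linear\<close>)
  have "0 \<in> T -` ball 0 1" using T by (simp add: linear_0)
  then obtain r where r: "r > 0" "ball 0 r \<subseteq> T -` ball 0 1" using openE[OF op] by blast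
  have "0 < measure lborel (ball (0::'a) r)" using r by (simp add: content_ball_pos)
  then have "0 < emeasure lborel (ball (0::'a) r)" unfolding measure_def by (metis enn2real_0 gr_zeroI less_irrefl)
  also have "\<dots> \<le> emeasure lborel (T -` ball 0 1)" using r op by (intro emeasure_mono) auto
  finally have pos: "emeasure lborel (T -` ball 0 1) > 0" .
  have fin: "emeasure lborel (T -` ball 0 1) < \<infinity>" using bd by (rule emeasure_bounded_finite)
  have gT: "(\<integral>\<^sup>+x. ?g (T x) \<partial>lborel) = emeasure lborel (T -` ball 0 1)"
  proof -
    have "(\<integral>\<^sup>+x. ?g (T x) \<partial>lborel) = (\<integral>\<^sup>+x. indicator (T -` ball 0 1) x \<partial>lborel)"
      by (intro nn_integral_cong) (simp add: indicator_def)
    then show ?thesis using op by simp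
  qed
  have g: "(\<integral>\<^sup>+x. ?g x \<partial>lborel) = emeasure lborel (ball 0 1 :: 'a set)" by simp
  have bpos: "measure lborel (ball (0::'a) 1) > 0" by (simp add: content_ball_pos)
  define c where "c = measure lborel (T -` ball 0 1) / measure lborel (ball (0::'a) 1)"
  have mpos: "measure lborel (T -` ball 0 1) > 0" using pos fin by (simp add: measure_def enn2real_positive_iff)
  show ?thesis
  proof (intro exI[of _ c] conjI allI impI)
    show "c > 0" using mpos bpos by (simp add: c_def)
    fix f :: "'a \<Rightarrow> real" assume f[measurable]: "f \<in> borel_measurable borel" and nn: "\<forall>x. 0 \<le> f x"
    have "(\<integral>\<^sup>+x. ennreal (f (T x)) \<partial>lborel) * emeasure lborel (ball 0 1 :: 'a set)
       = emeasure lborel (T -` ball 0 1) * (\<integral>\<^sup>+x. ennreal (f x) \<partial>lborel)"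
    proof -
      have "?g \<in> borel_measurable borel" by (intro borel_measurable_indicator) simp
      then show ?thesis
        using nn_integral_linear_image_proportional[OF T, of "\<lambda>x. ennreal (f x)" ?g] unfolding gT g by simp
    qed
    then have "enn2real (\<integral>\<^sup>+x. ennreal (f (T x)) \<partial>lborel) * measure lborel (ball 0 1 :: 'a set)
       = measure lborel (T -` ball 0 1) * enn2real (\<integral>\<^sup>+x. ennreal (f x) \<partial>lborel)"
      unfolding measure_def by (metis enn2real_mult)
    then show "(LINT x|lborel. f (T x)) = c * (LINT x|lborel. f x)"
      using nn bpos by (simp add: integral_eq_nn_integral c_def field_simps)
  qed
qed

definition mean :: "'a::euclidean_space set \<Rightarrow> ('a \<Rightarrow> real) \<Rightarrow> real" where
  "mean C f = (LINT x:C|lborel. f x) / measure lborel C"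

lemma mean_linear_image:
  fixes T :: "'a::euclidean_space \<Rightarrow> 'a"
  assumes T: "linear T" "bij T" and C: "compact C" and f: "continuous_on (T ` C) f" "\<And>x. x \<in> T ` C \<Longrightarrow> 0 \<le> f x"
  shows "mean (T ` C) f = mean C (f \<circ> T)"
proof -
  obtain c :: real where c: "c > 0" "\<And>f :: 'a \<Rightarrow> real. f \<in> borel_measurable borel \<Longrightarrow> (\<And>x. 0 \<le> f x) \<Longrightarrow> (LINT x|lborel. f (T x)) = c * (LINT x|lborel. f x)"
    using integral_linear_image[OF T] by blast
  have "continuous_on C T" using T by (intro linear_continuous_on) (simp add: linear_conv_bounded_linear)
  then have TC: "compact (T ` C)" using C by (rule compact_continuous_image)
  have ind: "indicator (T ` C) (T x) = (indicator C x :: real)" for x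
    using T by (auto simp: indicator_def bij_def inj_def)
  have "(LINT x|lborel. indicator (T ` C) (T x) * f (T x)) = c * (LINT x|lborel. indicator (T ` C) x * f x)"
  proof (rule c(2))
    show "(\<lambda>x. indicator (T ` C) x * f x) \<in> borel_measurable borel"
      using borel_measurable_continuous_on_indicator[OF _ f(1)] TC by (simp add: borel_compact)
  qed (use f in \<open>auto simp: indicator_def\<close>)
  moreover have "(LINT x|lborel. indicator (T ` C) (T x)) = c * (LINT x|lborel. indicator (T ` C) x)"
    by (rule c(2)) (use TC in \<open>auto intro!: borel_measurable_indicator borel_compact\<close>)
  ultimately show ?thesis
    using c(1) C TC by (simp add: ind mean_def set_lebesgue_integral_def borel_compact)
qed

lemma measure_pos_of_interior:
  fixes C :: "'a::euclidean_space set"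
  assumes "compact C" "interior C \<noteq> {}"
  shows "0 < measure lborel C"
proof -
  obtain x d where d: "d > 0" "ball x d \<subseteq> C" using assms(2) by (auto simp: mem_interior)
  have "0 < measure lborel (ball x d)" using d by (simp add: content_ball_pos)
  also have "\<dots> \<le> measure lborel C"
    using d assms(1) by (intro measure_mono_fmeasurable) (auto intro: fmeasurable_compact)
  finally show ?thesis .
qed

lemma compact_set_integrable:
  fixes f :: "'a::euclidean_space \<Rightarrow> real"
  assumes "compact C" "continuous_on C f"
  shows "set_integrable lborel C f"
  using borel_integrable_compact[OF assms] by (simp add: set_integrable_def)

lemma mean_cmult: "mean C (\<lambda>x. a * f x) = a * mean C f"
  by (simp add: mean_def set_integral_mult_right)

lemma mean_const:
  fixes C :: "'a::euclidean_space set"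
  assumes "compact C" "interior C \<noteq> {}"
  shows "mean C (\<lambda>_. a) = a"
  using measure_pos_of_interior[OF assms] emeasure_compact_finite[OF assms(1)] assms(1)
  by (simp add: mean_def set_lebesgue_integral_def borel_compact)

lemma mean_cong: "(\<And>x. x \<in> C \<Longrightarrow> f x = g x) \<Longrightarrow> mean C f = mean C g"
  unfolding mean_def set_lebesgue_integral_def
  by (intro arg_cong2[where f = "(/)"] Bochner_Integration.integral_cong) (auto simp: indicator_def)

lemma mean_mono:
  assumes "compact C" "continuous_on C f" "continuous_on C g" "\<And>x. x \<in> C \<Longrightarrow> f x \<le> g x"
  shows "mean C f \<le> mean C g"
  unfolding mean_def
  using assms by (intro divide_right_mono set_integral_mono compact_set_integrable) auto

text \<open>A continuous nonnegative function with integral zero vanishes on the interior, which is dense in the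
convex set.\<close>

lemma mean_eq_imp_eq:
  fixes C :: "'a::euclidean_space set"
  assumes C: "compact C" "convex C" "interior C \<noteq> {}"
    and fg: "continuous_on C f" "continuous_on C g" "\<And>x. x \<in> C \<Longrightarrow> f x \<le> g x"
    and eq: "mean C f = mean C g" and x: "x \<in> C"
  shows "f x = g x"
proof (rule ccontr)
  assume "f x \<noteq> g x"
  then have pos: "0 < g x - f x" using fg(3)[OF x] by simp
  let ?d = "\<lambda>x. g x - f x"
  have cont: "continuous_on C ?d" using fg by (intro continuous_intros)
  obtain d where d: "d > 0" "\<And>y. y \<in> C \<Longrightarrow> dist y x < d \<Longrightarrow> dist (?d y) (?d x) < ?d x"
    using cont[unfolded continuous_on_iff, rule_format, OF x pos] by auto
  have dpos: "0 < ?d y" if "y \<in> C" "y \<in> ball x d" for y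
    using d(2)[of y] that by (auto simp: dist_real_def dist_commute)
  have "x \<in> closure (interior C)"
    using convex_closure_interior[OF C(2,3)] x closure_subset by blast
  then have "ball x d \<inter> interior C \<noteq> {}"
    using d(1) by (metis closure_iff_nhds_not_empty Int_commute centre_in_ball open_ball order_refl interior_open disjoint_iff closure_approachable mem_ball dist_commute)
  then obtain y r where r: "r > 0" "ball y r \<subseteq> ball x d \<inter> interior C"
    using open_Int[OF open_ball open_interior] open_contains_ball by (metis all_not_in_conv)
  have "(LINT x:C|lborel. f x) = (LINT x:C|lborel. g x)"
    using eq measure_pos_of_interior[OF C(1,3)] by (simp add: mean_def)
  then have zero: "(LINT x:C|lborel. ?d x) = 0"
    using compact_set_integrable[OF C(1)] fg by simp
  have "AE z in lborel. indicator C z *\<^sub>R ?d z = 0"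
    using zero compact_set_integrable[OF C(1) cont] fg(3)
    unfolding set_lebesgue_integral_def set_integrable_def
    by (subst (asm) integral_nonneg_eq_0_iff_AE) (auto simp: indicator_def)
  then have "AE z in lborel. z \<notin> ball y r"
  proof eventually_elim
    case (elim z)
    show ?case
    proof
      assume "z \<in> ball y r"
      then have z: "z \<in> C" "z \<in> ball x d" using r(2) interior_subset[of C] by blast+
      show False using dpos[OF z] elim z(1) by simp
    qed
  qed
  then have "emeasure lborel (ball y r) = 0" by (subst (asm) AE_iff_measurable[of "ball y r"]) auto
  then show False using r(1) content_ball_pos[of r y] by (simp add: measure_def)
qed

section \<open>Even unimodal functions on an interval\<close>

text \<open>By evenness \<open>exp\<close> may be replaced by \<open>cosh\<close>.  Its mean value over \<open>{-b..b}\<close> is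
\<open>sinh (c * b) / (c * b)\<close>; let \<open>z > 0\<close> be a point where the mean value is attained.  Then
\<open>cosh (c * s)\<close> minus its mean and \<open>g s - g z\<close> have opposite signs, as the first increases in
\<open>\<bar>s\<bar>\<close> and the second decreases.  Integrating the product gives the inequality.  In the case of
equality the product vanishes almost everywhere, and monotonicity turns \<open>g s = g z\<close> for almost all
\<open>s\<close> into equality at all points of the open interval other than the centre.\<close>

lemma symmetric_unimodal_exp_mean:
  fixes g :: "real \<Rightarrow> real"
  assumes [measurable]: "g \<in> borel_measurable borel"
    and nonneg: "\<And>s. 0 \<le> g s" and supp: "\<And>s. b < \<bar>s\<bar> \<Longrightarrow> g s = 0"
    and even: "\<And>s. g (- s) = g s" and mono: "\<And>r s. \<bar>r\<bar> \<le> \<bar>s\<bar> \<Longrightarrow> g s \<le> g r"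
    and b: "b > 0" and c: "c > 0"
  shows "(LINT s|lborel. exp (c * s) * g s) \<le> sinh (c * b) / (c * b) * (LINT s|lborel. g s)"
    and "(LINT s|lborel. exp (c * s) * g s) = sinh (c * b) / (c * b) * (LINT s|lborel. g s)
      \<Longrightarrow> \<exists>\<gamma>. \<forall>s. 0 < \<bar>s\<bar> \<longrightarrow> \<bar>s\<bar> < b \<longrightarrow> g s = \<gamma>"
proof -
  let ?I = "indicator {-b..b} :: real \<Rightarrow> real"
  define A where "A = sinh (c * b) / (c * b)"
  have integ: "integrable lborel (\<lambda>s. k s * g s)" if k: "continuous_on UNIV k" for k
  proof -
    have [measurable]: "k \<in> borel_measurable borel" using k by (rule borel_measurable_continuous_onI)
    obtain B where "\<forall>x\<in>k ` {-b..b}. norm x \<le> B"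
      using compact_imp_bounded[OF compact_continuous_image[OF continuous_on_subset[OF k], of "{-b..b}"]]
      unfolding bounded_iff by auto
    then have B: "\<bar>k s\<bar> \<le> B" if "s \<in> {-b..b}" for s using that by fastforce
    show ?thesis
    proof (rule Bochner_Integration.integrable_bound[where f = "\<lambda>s. (B * g 0) * ?I s"])
      show "integrable lborel (\<lambda>s. (B * g 0) * ?I s)"
        by (intro integrable_mult_right integrable_real_indicator) (auto simp: emeasure_lborel_Icc_eq)
      have "norm (k s * g s) \<le> norm ((B * g 0) * ?I s)" for s
      proof (cases "\<bar>s\<bar> \<le> b")
        case True
        then have "\<bar>k s\<bar> \<le> B" by (intro B) auto
        moreover from this have B0: "0 \<le> B" by linarith
        ultimately have "\<bar>k s\<bar> * g s \<le> B * g 0" using mono[of 0 s] nonneg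
          by (intro mult_mono) auto
        then show ?thesis using True B0 nonneg[of s] nonneg[of 0] by (auto simp: abs_mult indicator_def abs_le_iff)
      qed (use supp in auto)
      then show "AE s in lborel. norm (k s * g s) \<le> norm ((B * g 0) * ?I s)" by simp
    qed measurable
  qed
  have cosh: "(LINT s|lborel. exp (c * s) * g s) = (LINT s|lborel. cosh (c * s) * g s)"
  proof -
    have "(LINT s|lborel. exp (c * s) * g s) = (LINT s|lborel. exp (- (c * s)) * g s)"
      using lborel_integral_real_affine[of "-1" "\<lambda>s. exp (c * s) * g s" 0] by (simp add: even)
    moreover have "(LINT s|lborel. cosh (c * s) * g s)
        = (LINT s|lborel. (1/2) * (exp (c * s) * g s) + (1/2) * (exp (- (c * s)) * g s))"
      by (intro Bochner_Integration.integral_cong) (auto simp: cosh_field_def algebra_simps)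
    moreover have "\<dots> = (1/2) * (LINT s|lborel. exp (c * s) * g s) + (1/2) * (LINT s|lborel. exp (- (c * s)) * g s)"
    proof -
      have "integrable lborel (\<lambda>s. exp (c * s) * g s)" "integrable lborel (\<lambda>s. exp (- (c * s)) * g s)"
        by (intro integ continuous_intros)+
      then show ?thesis by simp
    qed
    ultimately show ?thesis by simp
  qed
  have "((\<lambda>s. sinh (c * s)) has_real_derivative c * cosh (c * s)) (at s)" for s
    by (auto intro!: derivative_eq_intros)
  then obtain z where z: "0 < z" "z < b" "sinh (c * b) - sinh (c * 0) = (b - 0) * (c * cosh (c * z))"
    using MVT2[OF b, of "\<lambda>s. sinh (c * s)" "\<lambda>s. c * cosh (c * s)"] by blast
  have Az: "A = cosh (c * z)" using z b c by (simp add: A_def field_simps)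
  let ?D = "\<lambda>s. ?I s * ((A - cosh (c * s)) * (g s - g z))"
  have D_nonneg: "0 \<le> ?D s" for s
  proof (cases "\<bar>s\<bar> \<le> z")
    case True
    then have "cosh (c * s) \<le> A" unfolding Az
      using cosh_real_nonneg_le_iff[of "\<bar>c * s\<bar>" "c * z"] c z by (subst cosh_real_abs[symmetric]) (simp add: abs_mult del: cosh_real_abs)
    then show ?thesis using mono[of s z] True z by (auto intro!: mult_nonneg_nonneg)
  next
    case False
    then have "A \<le> cosh (c * s)" unfolding Az
      using cosh_real_nonneg_le_iff[of "c * z" "\<bar>c * s\<bar>"] c z by (subst (2) cosh_real_abs[symmetric]) (simp add: abs_mult del: cosh_real_abs)
    then show ?thesis using mono[of z s] False z by (intro mult_nonneg_nonneg mult_nonpos_nonpos) auto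
  qed
  have FTC: "has_bochner_integral lborel (\<lambda>s. (A - cosh (c * s)) * ?I s) ((A * b - sinh (c * b) / c) - (A * (-b) - sinh (c * (-b)) / c))"
  proof (rule has_bochner_integral_FTC_Icc_real)
    show "-b \<le> b" using b by simp
    show "((\<lambda>s. A * s - sinh (c * s) / c) has_real_derivative A - cosh (c * s)) (at s)" for s
      using c by (auto intro!: derivative_eq_intros)
  qed (auto intro!: continuous_intros)
  have "A * b - sinh (c * b) / c - (A * (-b) - sinh (c * (-b)) / c) = 0"
    using b c by (simp add: A_def field_simps)
  then have zero: "has_bochner_integral lborel (\<lambda>s. ?I s *\<^sub>R (A - cosh (c * s))) 0" using FTC by (simp add: mult.commute)
  have D_eq: "?D s = A * g s - cosh (c * s) * g s - g z * (?I s *\<^sub>R (A - cosh (c * s)))" for s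
    using supp[of s] by (auto simp: indicator_def algebra_simps abs_if split: if_splits)
  have "has_bochner_integral lborel ?D (A * (LINT s|lborel. g s) - (LINT s|lborel. cosh (c * s) * g s) - g z * 0)"
  proof -
    have "integrable lborel (\<lambda>s. cosh (c * s) * g s)" by (intro integ continuous_intros)
    moreover have "integrable lborel g" using integ[of "\<lambda>_. 1"] by simp
    ultimately show ?thesis
      unfolding D_eq
      by (intro has_bochner_integral_diff has_bochner_integral_mult_right zero has_bochner_integral_integrable)
  qed
  then have intD: "integrable lborel ?D" "(LINT s|lborel. ?D s) = A * (LINT s|lborel. g s) - (LINT s|lborel. cosh (c * s) * g s)"
    by (auto simp: has_bochner_integral_iff)
  then show "(LINT s|lborel. exp (c * s) * g s) \<le> sinh (c * b) / (c * b) * (LINT s|lborel. g s)"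
    using Bochner_Integration.integral_nonneg[of lborel ?D, OF D_nonneg] intD(2) unfolding cosh A_def by simp
  assume "(LINT s|lborel. exp (c * s) * g s) = sinh (c * b) / (c * b) * (LINT s|lborel. g s)"
  then have "(LINT s|lborel. ?D s) = 0" using intD(2) unfolding cosh A_def by simp
  then have "AE s in lborel. ?D s = 0"
    using integral_nonneg_eq_0_iff_AE[OF intD(1)] D_nonneg by auto
  then have AE: "AE s in lborel. s \<in> {0<..<b} \<longrightarrow> g s = g z"
    using AE_lborel_singleton[of z]
  proof eventually_elim
    case (elim s)
    show ?case
    proof
      assume s: "s \<in> {0<..<b}"
      then have "A \<noteq> cosh (c * s)" unfolding Az using elim c z by (auto simp: cosh_real_nonneg_less_iff)
      then show "g s = g z" using elim s by auto
    qed
  qed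
  have ex: "\<exists>s\<in>{l<..<u}. g s = g z" if "0 \<le> l" "l < u" "u \<le> b" for l u
  proof (rule ccontr)
    assume "\<not> ?thesis"
    then have "AE s in lborel. s \<notin> {l<..<u}" using AE that by (auto elim!: eventually_mono)
    then have "emeasure lborel {l<..<u} = 0" by (subst (asm) AE_iff_measurable[of "{l<..<u}"]) auto
    then show False using that by simp
  qed
  show "\<exists>\<gamma>. \<forall>s. 0 < \<bar>s\<bar> \<longrightarrow> \<bar>s\<bar> < b \<longrightarrow> g s = \<gamma>"
  proof (intro exI[of _ "g z"] allI impI)
    fix s :: real assume s: "0 < \<bar>s\<bar>" "\<bar>s\<bar> < b"
    obtain l u where "l \<in> {0<..<\<bar>s\<bar>}" "g l = g z" "u \<in> {\<bar>s\<bar><..<b}" "g u = g z"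
      using ex[of 0 "\<bar>s\<bar>"] ex[of "\<bar>s\<bar>" b] s by auto
    then show "g s = g z" using mono[of l s] mono[of s u] by auto
  qed
qed

section \<open>A linear function between a concave and a convex function\<close>

lemma symmetric_interior_zero:
  fixes C :: "'a::euclidean_space set"
  assumes "convex C" "uminus ` C = C" "interior C \<noteq> {}"
  shows "0 \<in> interior C"
proof -
  obtain q where q: "q \<in> interior C" using assms(3) by auto
  then have "- q \<in> C" using assms(2) interior_subset by blast
  then have "- q - (1/2) *\<^sub>R (- q - q) \<in> interior C"
    using mem_interior_convex_shrink[OF assms(1) q, of "- q" "1/2"] by simp
  moreover have "- q - (1/2) *\<^sub>R (- q - q) = 0"
    by (rule euclidean_eqI) (simp add: inner_diff_left inner_add_left)
  ultimately show ?thesis by metis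
qed

text \<open>A concave function \<open>k\<close> with \<open>k 0 = 0\<close> has a linear majorant \<open>v \<bullet> x\<close>; the point is that
the majorant can be chosen with the same lower bound \<open>- h0\<close> as \<open>k\<close>.  Concavity on the segment from
\<open>- c\<close> through 0 to \<open>\<rho> *\<^sub>R c\<close> gives \<open>k (\<rho> *\<^sub>R c) \<le> \<rho> * h0\<close>.  Hence \<open>k\<close> lies below \<open>h0\<close> times
the gauge of \<open>C\<close>, and the open hypograph of \<open>k\<close> is disjoint from the cone with vertex 0 over
\<open>C\<close> lifted to height \<open>h0\<close>.  A hyperplane that separates them is the graph of the majorant: it lies
above \<open>k\<close>, and it is at most \<open>h0\<close> on \<open>C\<close>, so by symmetry at least \<open>- h0\<close>.\<close>

lemma symmetric_convex_sandwich:
  fixes C :: "'a::euclidean_space set" and k :: "'a \<Rightarrow> real"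
  assumes C: "convex C" "uminus ` C = C" "interior C \<noteq> {}"
    and k: "concave_on C k" "k 0 = 0" "\<And>x. x \<in> C \<Longrightarrow> - h0 \<le> k x"
  obtains v where "\<And>x. x \<in> C \<Longrightarrow> k x \<le> v \<bullet> x" "\<And>x. x \<in> C \<Longrightarrow> \<bar>v \<bullet> x\<bar> \<le> h0"
proof -
  have neg: "- x \<in> C" if "x \<in> C" for x using that C(2) by blast
  obtain p where p: "p \<in> C" using C(3) interior_subset by blast
  have zero: "0 \<in> C" using convexD[OF C(1) p neg[OF p], of "1/2" "1/2"] by simp
  have kconc: "k (u *\<^sub>R x + w *\<^sub>R y) \<ge> u * k x + w * k y"
    if "x \<in> C" "y \<in> C" "u \<ge> 0" "w \<ge> 0" "u + w = 1" for x y u w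
    using k(1) that unfolding concave_on_iff by blast
  have ray: "k (\<rho> *\<^sub>R c) \<le> \<rho> * h0" if c: "c \<in> C" and \<rho>: "0 \<le> \<rho>" "\<rho> \<le> 1" for c \<rho>
  proof -
    have \<rho>c: "\<rho> *\<^sub>R c \<in> C" using convexD[OF C(1) c zero, of \<rho> "1 - \<rho>"] \<rho> by simp
    have "(1 / (1 + \<rho>)) *\<^sub>R (\<rho> *\<^sub>R c) + (\<rho> / (1 + \<rho>)) *\<^sub>R (- c) = 0" by simp
    then have "0 \<ge> (1 / (1 + \<rho>)) * k (\<rho> *\<^sub>R c) + (\<rho> / (1 + \<rho>)) * k (- c)"
      using kconc[OF \<rho>c neg[OF c], of "1 / (1 + \<rho>)" "\<rho> / (1 + \<rho>)"] \<rho> k(2)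
      by (simp add: add_divide_distrib[symmetric])
    then have "0 \<ge> (k (\<rho> *\<^sub>R c) + \<rho> * k (- c)) / (1 + \<rho>)" by (simp add: add_divide_distrib)
    then have "k (\<rho> *\<^sub>R c) + \<rho> * k (- c) \<le> 0" using \<rho> by (simp add: divide_le_0_iff)
    moreover have "\<rho> * k (- c) \<ge> \<rho> * - h0" using mult_left_mono[OF k(3)[OF neg[OF c]] \<rho>(1)] .
    ultimately show ?thesis by simp
  qed
  define A where "A = {(x, r). x \<in> C \<and> r < k x}"
  define B where "B = (\<lambda>(\<rho>, c). (\<rho> *\<^sub>R c, \<rho> * h0)) ` ({0..1} \<times> C)"
  have convA: "convex A"
  proof (rule convexI)
    fix x y u w assume xy: "x \<in> A" "y \<in> A" and uw: "(0::real) \<le> u" "0 \<le> w" "u + w = 1"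
    obtain x1 x2 y1 y2 where eq: "x = (x1, x2)" "y = (y1, y2)" by (metis surj_pair)
    have "u * x2 + w * y2 < u * k x1 + w * k y1"
      using xy uw unfolding eq A_def
      by (auto intro: add_le_less_mono add_less_le_mono mult_left_mono mult_strict_left_mono
          simp: le_less)
    also have "\<dots> \<le> k (u *\<^sub>R x1 + w *\<^sub>R y1)" using xy uw unfolding eq A_def by (intro kconc) auto
    finally show "u *\<^sub>R x + w *\<^sub>R y \<in> A"
      using xy uw convexD[OF C(1)] unfolding eq A_def by auto
  qed
  have convB: "convex B"
  proof (rule convexI)
    fix x y u w assume xy: "x \<in> B" "y \<in> B" and uw: "(0::real) \<le> u" "0 \<le> w" "u + w = 1"
    obtain \<rho> c where x: "x = (\<rho> *\<^sub>R c, \<rho> * h0)" "c \<in> C" "\<rho> \<in> {0..1}"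
    proof -
      obtain q where "q \<in> {0..1} \<times> C" "x = (case q of (\<rho>, c) \<Rightarrow> (\<rho> *\<^sub>R c, \<rho> * h0))"
        using xy(1) unfolding B_def by blast
      then show thesis using that[of "fst q" "snd q"] by (auto simp: case_prod_unfold)
    qed
    obtain \<sigma> d where y: "y = (\<sigma> *\<^sub>R d, \<sigma> * h0)" "d \<in> C" "\<sigma> \<in> {0..1}"
    proof -
      obtain q where "q \<in> {0..1} \<times> C" "y = (case q of (\<rho>, c) \<Rightarrow> (\<rho> *\<^sub>R c, \<rho> * h0))"
        using xy(2) unfolding B_def by blast
      then show thesis using that[of "fst q" "snd q"] by (auto simp: case_prod_unfold)
    qed
    note eq = x(1) y(1) and in_C = x(2) y(2) x(3) y(3)
    define \<tau> where "\<tau> = u * \<rho> + w * \<sigma>"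
    have \<tau>: "0 \<le> \<tau>" "\<tau> \<le> 1"
      using in_C uw convex_bound_le[of \<rho> 1 \<sigma> u w] by (auto simp: \<tau>_def)
    have \<tau>0: "u * \<rho> = 0 \<and> w * \<sigma> = 0" if "\<tau> = 0"
      using that in_C uw unfolding \<tau>_def by (metis add_nonneg_eq_0_iff atLeastAtMost_iff mult_nonneg_nonneg)
    show "u *\<^sub>R x + w *\<^sub>R y \<in> B"
    proof (cases "\<tau> = 0")
      case True
      then have "u *\<^sub>R x + w *\<^sub>R y = (0 *\<^sub>R c, 0 * h0)" using \<tau>0[OF True] unfolding eq by auto
      then show ?thesis unfolding B_def using in_C by (intro image_eqI[of _ _ "(0, c)"]) auto
    next
      case False
      let ?c = "(u * \<rho> / \<tau>) *\<^sub>R c + (w * \<sigma> / \<tau>) *\<^sub>R d"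
      have "?c \<in> C"
        using in_C uw \<tau> False by (intro convexD[OF C(1)]) (auto simp: \<tau>_def add_divide_distrib[symmetric])
      moreover have "u *\<^sub>R x + w *\<^sub>R y = (\<tau> *\<^sub>R ?c, \<tau> * h0)"
        using False by (simp add: eq scaleR_add_right) (simp add: \<tau>_def algebra_simps)
      ultimately show ?thesis unfolding B_def using \<tau> by (intro image_eqI[of _ _ "(\<tau>, ?c)"]) auto
    qed
  qed
  have disj: "A \<inter> B = {}"
  proof (intro equals0I)
    fix z assume z: "z \<in> A \<inter> B"
    then obtain q where q: "q \<in> {0..1} \<times> C" "z = (case q of (\<rho>, c) \<Rightarrow> (\<rho> *\<^sub>R c, \<rho> * h0))"
      unfolding B_def by blast
    then show False
      using ray[of "snd q" "fst q"] z unfolding A_def by (auto simp: case_prod_unfold)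
  qed
  have A0: "(0, r) \<in> A" if "r < 0" for r using that zero k(2) by (simp add: A_def)
  have B0: "(0, 0) \<in> B" unfolding B_def using zero by (intro image_eqI[of _ _ "(0, 0)"]) auto
  have "A \<noteq> {}" "B \<noteq> {}" using A0[of "-1"] B0 by auto
  then obtain a \<beta> where a: "a \<noteq> 0" and Ale: "\<forall>x\<in>A. a \<bullet> x \<le> \<beta>" and Bge: "\<forall>x\<in>B. a \<bullet> x \<ge> \<beta>"
    using separating_hyperplane_sets[OF convA convB _ _ disj] by auto
  obtain w \<mu> where aw: "a = (w, \<mu>)" by (metis surj_pair)
  have \<beta>0: "\<beta> \<le> 0" using Bge B0 by (force simp: aw)
  have r\<beta>: "\<mu> * r \<le> \<beta>" if "r < 0" for r using Ale A0[OF that] by (force simp: aw)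
  have \<mu>0: "\<mu> \<ge> 0" using r\<beta>[of "-1"] \<beta>0 by simp
  have \<beta>: "\<beta> = 0"
  proof (rule ccontr)
    assume "\<beta> \<noteq> 0"
    then have "\<beta> < 0" using \<beta>0 by simp
    then show False using r\<beta>[of "\<beta> / (2 * (\<mu> + 1))"] \<mu>0 mult_nonpos_nonneg[OF \<beta>0 \<mu>0] \<open>\<beta> < 0\<close> by (auto simp: field_simps divide_neg_pos mult_le_0_iff)
  qed
  have top: "w \<bullet> c + \<mu> * h0 \<ge> 0" if "c \<in> C" for c
  proof -
    have "(c, h0) \<in> B" unfolding B_def using that by (intro image_eqI[of _ _ "(1, c)"]) auto
    then show ?thesis using Bge by (force simp: aw \<beta>)
  qed
  \<comment> \<open>A vertical separating hyperplane would have a normal \<open>w\<close> orthogonal to the whole body \<open>C\<close>.\<close>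
  have \<mu>: "\<mu> > 0"
  proof (rule ccontr)
    assume "\<not> \<mu> > 0"
    then have \<mu>: "\<mu> = 0" using \<mu>0 by simp
    have orth: "w \<bullet> c = 0" if "c \<in> C" for c using top[OF that] top[OF neg[OF that]] by (simp add: \<mu>)
    obtain q where q: "q \<in> interior C" using C(3) by auto
    then obtain d where d: "d > 0" "cball q d \<subseteq> C" by (auto simp: mem_interior_cball)
    have "w \<noteq> 0" using a by (auto simp: aw \<mu> zero_prod_def)
    have "q + (d / norm w) *\<^sub>R w \<in> C" using d \<open>w \<noteq> 0\<close> by (intro subsetD[OF d(2)]) (simp add: dist_norm)
    moreover have "q \<in> C" using q interior_subset by blast
    ultimately have "w \<bullet> ((d / norm w) *\<^sub>R w) = 0" using orth by (metis add_cancel_right_right inner_add_right)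
    then show False using \<open>w \<noteq> 0\<close> d by simp
  qed
  define v where "v = - (1 / \<mu>) *\<^sub>R w"
  show thesis
  proof
    fix x assume x: "x \<in> C"
    have "k x \<le> v \<bullet> x"
    proof (rule dense_ge_bounded[where y = "k x" and z = "k x"]; fail | rule field_le_epsilon)
      fix e :: real assume "e > 0"
      then have "(x, k x - e) \<in> A" using x by (simp add: A_def)
      then have "w \<bullet> x + \<mu> * (k x - e) \<le> 0" using Ale by (force simp: aw \<beta>)
      then show "k x \<le> v \<bullet> x + e" using \<mu> by (simp add: v_def field_simps)
    qed
    then show "k x \<le> v \<bullet> x" .
    show "\<bar>v \<bullet> x\<bar> \<le> h0" using top[OF x] top[OF neg[OF x]] \<mu> by (simp add: v_def field_simps abs_le_iff)
  qed
qed

section \<open>Rigidity of log-concave families of tails\<close>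

text \<open>The second differences of a midpoint concave function telescope: summed over a partition into \<open>n\<close>
steps they are bounded by a single first difference, which is of order \<open>1 / n\<close>.  So the total
variation of \<open>e\<close> is zero.\<close>

lemma controlled_by_second_differences_constant:
  fixes p e :: "real \<Rightarrow> real"
  assumes antimono: "\<And>v w. v \<le> w \<Longrightarrow> w < B \<Longrightarrow> p w \<le> p v"
    and diff: "\<And>v w. v < B \<Longrightarrow> w < B \<Longrightarrow> K * \<bar>e v - e w\<bar> \<le> 2 * p ((v + w) / 2) - p v - p w"
    and K: "K > 0" and vw: "v < B" "w < B"
  shows "e v = e w"
proof -
  have main: "e v = e w" if vw: "v < w" "w < B" for v w
  proof -
    \<comment> \<open>To bound the last first difference, the partition is continued beyond \<open>w\<close> by \<open>2 * n\<close> steps; they cover the length \<open>(w - v) / m\<close>, which has to fit below \<open>B\<close>.\<close>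
    obtain m :: nat where m: "m > 0" "w + (w - v) / m < B"
    proof -
      obtain m :: nat where "(w - v) / (B - w) < m" using reals_Archimedean2 by blast
      moreover have "0 < (w - v) / (B - w)" using vw by simp
      ultimately have "m > 0" by (intro gr0I) auto
      then have "w + (w - v) / m < B"
        using \<open>(w - v) / (B - w) < m\<close> vw by (simp add: field_simps)
      with \<open>m > 0\<close> show thesis by (rule that)
    qed
    have bound: "n * (2 * K * \<bar>e w - e v\<bar>) \<le> p w - p (w + (w - v) / m)" if n: "n > 0" for n :: nat
    proof -
      define h where "h = (w - v) / (2 * m * n)"
      define x where "x i = v + real i * h" for i
      define D where "D i = p (x i) - p (x (Suc i))" for i
      have h: "h > 0" using vw m n by (simp add: h_def)
      have x_mono: "x i \<le> x j" if "i \<le> j" for i j using that h by (simp add: x_def)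
      have x0: "x 0 = v" by (simp add: x_def)
      have xw: "x (2 * m * n) = w" using m n by (simp add: x_def h_def)
      have xend: "x (2 * m * n + 2 * n) = w + (w - v) / m"
        using m n by (simp add: x_def h_def field_simps)
      have x_lt: "x i < B" if "i \<le> 2 * m * n + 2 * n" for i
        using x_mono[OF that] m(2) unfolding xend by simp
      have diff2: "K * \<bar>e (x (Suc (Suc i))) - e (x i)\<bar> \<le> D (Suc i) - D i" if "Suc (Suc i) \<le> 2 * m * n + 2 * n" for i
      proof -
        have "(x (Suc (Suc i)) + x i) / 2 = x (Suc i)" by (simp add: x_def field_simps)
        then show ?thesis using diff[of "x (Suc (Suc i))" "x i"] that by (simp add: x_lt D_def)
      qed
      have D_step: "D i \<le> D (Suc i)" if "Suc (Suc i) \<le> 2 * m * n + 2 * n" for i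
        using diff2[OF that] K by (smt (verit) mult_nonneg_nonneg abs_ge_zero)
      have D_mono: "D k \<le> D (k + i)" if "Suc (k + i) \<le> 2 * m * n + 2 * n" for k i
        using that by (induction i) (auto intro: order_trans[OF _ D_step])
      have left: "K * \<bar>e (x (2 * j)) - e v\<bar> \<le> D (2 * j)" if "Suc (2 * j) \<le> 2 * m * n + 2 * n" for j
        using that
      proof (induction j)
        case 0
        then show ?case using antimono[of "x 0" "x 1"] x_mono[of 0 1] x_lt[of 1] by (simp add: x0 D_def)
      next
        case (Suc j)
        have "K * \<bar>e (x (2 * Suc j)) - e v\<bar> \<le> K * (\<bar>e (x (Suc (Suc (2 * j)))) - e (x (2 * j))\<bar> + \<bar>e (x (2 * j)) - e v\<bar>)"
          using K by (intro mult_left_mono) auto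
        also have "\<dots> \<le> D (Suc (2 * j)) - D (2 * j) + D (2 * j)"
          using diff2[of "2 * j"] Suc by (simp add: distrib_left)
        also have "\<dots> \<le> D (2 * Suc j)" using D_step[of "Suc (2 * j)"] Suc.prems by simp
        finally show ?case .
      qed
      have right: "real i * D k \<le> p (x k) - p (x (k + i))" if "k + i \<le> 2 * m * n + 2 * n" for i k
        using that
      proof (induction i)
        case (Suc i)
        then have "real i * D k + D k \<le> (p (x k) - p (x (k + i))) + D (k + i)"
          using D_mono[of k i] by (intro add_mono) auto
        then show ?case by (simp add: D_def algebra_simps)
      qed simp
      have "real n * (2 * K * \<bar>e w - e v\<bar>) = real (2 * n) * (K * \<bar>e (x (2 * (m * n))) - e v\<bar>)"
        using xw by (simp add: mult.assoc)
      also have "\<dots> \<le> real (2 * n) * D (2 * (m * n))"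
        using n by (intro mult_left_mono left) auto
      also have "\<dots> \<le> p w - p (w + (w - v) / m)"
        using right[of "2 * m * n" "2 * n"] unfolding xw xend by (simp add: mult.assoc)
      finally show ?thesis .
    qed
    show ?thesis
    proof (rule ccontr)
      assume "e v \<noteq> e w"
      then have "2 * K * \<bar>e w - e v\<bar> > 0" using K by simp
      then obtain n :: nat where n: "p w - p (w + (w - v) / m) < n * (2 * K * \<bar>e w - e v\<bar>)"
        using reals_Archimedean3 by blast
      have "p (w + (w - v) / m) \<le> p w" using vw m by (intro antimono) auto
      then have "n > 0" using n by (intro gr0I) auto
      then show False using bound[of n] n by simp
    qed
  qed
  show ?thesis using main[OF _ vw(2)] main[OF _ vw(1)] by (metis linorder_neqE_linordered_idom)
qed

text \<open>Read \<open>N s \<tau>\<close> as the measure of the part of the section at \<open>s\<close> where a linear functional is at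
least \<open>\<tau>\<close>; all sections have the same measure \<open>\<kappa>\<close>.  Let \<open>H v s\<close> be the threshold beyond
which this measure is less than \<open>exp v\<close>.  Log-concavity of \<open>N\<close> makes \<open>H\<close> jointly concave, and log-concavity of
\<open>\<kappa> - N\<close> makes it convex in \<open>s\<close>, so \<open>H v s = H v 0 + E v * s\<close>.  Joint concavity at points
\<open>(v, q)\<close> and \<open>(w, - q)\<close> then bounds \<open>\<bar>E v - E w\<bar>\<close> by a second difference of \<open>H\<close> at \<open>s = 0\<close>, and
therefore \<open>E\<close> is a constant \<open>\<epsilon>\<close>.  So the distributions at different \<open>s\<close> are translates of
each other.  The strict inequality in the conclusion allows for jumps of \<open>N\<close>.\<close>

lemma translates_of_log_concave_tails:
  fixes N :: "real \<Rightarrow> real \<Rightarrow> real"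
  assumes b: "b > 0" and \<kappa>: "\<kappa> > 0"
    and range: "\<And>s \<tau>. 0 \<le> N s \<tau>" "\<And>s \<tau>. \<bar>s\<bar> < b \<Longrightarrow> N s \<tau> \<le> \<kappa>"
    and antimono: "\<And>s \<tau> \<tau>'. \<tau> \<le> \<tau>' \<Longrightarrow> N s \<tau>' \<le> N s \<tau>"
    and low: "\<And>s. \<bar>s\<bar> < b \<Longrightarrow> N s (- R) = \<kappa>" and high: "\<And>s \<tau>. R < \<tau> \<Longrightarrow> N s \<tau> = 0"
    and upper: "\<And>r s t \<tau> \<sigma>. \<bar>r\<bar> < b \<Longrightarrow> \<bar>s\<bar> < b \<Longrightarrow> 0 < t \<Longrightarrow> t < 1 \<Longrightarrow>
        N r \<tau> powr (1 - t) * N s \<sigma> powr t \<le> N ((1 - t) * r + t * s) ((1 - t) * \<tau> + t * \<sigma>)"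
    and lower: "\<And>r s t \<tau> \<sigma>. \<bar>r\<bar> < b \<Longrightarrow> \<bar>s\<bar> < b \<Longrightarrow> 0 < t \<Longrightarrow> t < 1 \<Longrightarrow>
        (\<kappa> - N r \<tau>) powr (1 - t) * (\<kappa> - N s \<sigma>) powr t \<le> \<kappa> - N ((1 - t) * r + t * s) ((1 - t) * \<tau> + t * \<sigma>)"
  obtains \<epsilon> where "\<And>s s' \<tau> \<tau>'. \<bar>s\<bar> < b \<Longrightarrow> \<bar>s'\<bar> < b \<Longrightarrow> \<tau>' - \<epsilon> * s' < \<tau> - \<epsilon> * s \<Longrightarrow> N s \<tau> \<le> N s' \<tau>'"
proof -
  define H where "H v s = Sup {\<tau>. exp v \<le> N s \<tau>}" for v s
  have bdd: "bdd_above {\<tau>. exp v \<le> N s \<tau>}" for v s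
    using high by (intro bdd_aboveI[of _ R]) (metis exp_gt_zero mem_Collect_eq not_le)
  have le_H: "\<tau> \<le> H v s" if "exp v \<le> N s \<tau>" for v s \<tau>
    unfolding H_def using that bdd by (intro cSup_upper) auto
  have below_H: "exp v \<le> N s \<tau>" if v: "exp v < \<kappa>" and s: "\<bar>s\<bar> < b" and "\<tau> < H v s" for v s \<tau>
  proof -
    have "- R \<in> {\<tau>. exp v \<le> N s \<tau>}" using low s v by auto
    then obtain \<sigma> where "exp v \<le> N s \<sigma>" "\<tau> < \<sigma>"
      using \<open>\<tau> < H v s\<close> less_cSup_iff[OF _ bdd, of v s \<tau>] unfolding H_def by blast
    then show ?thesis using antimono[of \<tau> \<sigma> s] by linarith
  qed
  have mix: "\<bar>(1 - t) * r + t * s\<bar> < b" if "\<bar>r\<bar> < b" "\<bar>s\<bar> < b" "0 < t" "t < 1" for r s t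
    using that convex_bound_lt[of r b s "1 - t" t] convex_bound_lt[of "- r" b "- s" "1 - t" t]
    by (simp add: abs_less_iff)
  have concave: "(1 - t) * H v r + t * H w s \<le> H ((1 - t) * v + t * w) ((1 - t) * r + t * s)"
    if v: "exp v < \<kappa>" "exp w < \<kappa>" and rs: "\<bar>r\<bar> < b" "\<bar>s\<bar> < b" and t: "0 < t" "t < 1" for v w r s t
  proof (rule field_le_epsilon)
    fix d :: real assume d: "d > 0"
    have "exp ((1 - t) * v + t * w) = exp v powr (1 - t) * exp w powr t"
      by (simp add: exp_add powr_def)
    also have "\<dots> \<le> N r (H v r - d) powr (1 - t) * N s (H w s - d) powr t"
      using v rs t d below_H by (intro mult_mono powr_mono2) auto
    also have "\<dots> \<le> N ((1 - t) * r + t * s) ((1 - t) * (H v r - d) + t * (H w s - d))"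
      by (rule upper) (use rs t in auto)
    finally have "(1 - t) * (H v r - d) + t * (H w s - d) \<le> H ((1 - t) * v + t * w) ((1 - t) * r + t * s)"
      by (rule le_H)
    then show "(1 - t) * H v r + t * H w s \<le> H ((1 - t) * v + t * w) ((1 - t) * r + t * s) + d"
      by (simp add: algebra_simps)
  qed
  have convex: "H v ((1 - t) * r + t * s) \<le> (1 - t) * H v r + t * H v s"
    if v: "exp v < \<kappa>" and rs: "\<bar>r\<bar> < b" "\<bar>s\<bar> < b" and t: "0 < t" "t < 1" for v r s t
  proof (rule field_le_epsilon)
    fix d :: real assume d: "d > 0"
    have less: "N s (H v s + d) < exp v" for s using le_H[of v s "H v s + d"] d by force
    have "\<kappa> - exp v = (\<kappa> - exp v) powr (1 - t) * (\<kappa> - exp v) powr t"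
      using v by (simp add: powr_add[symmetric])
    also have "\<dots> < (\<kappa> - N r (H v r + d)) powr (1 - t) * (\<kappa> - N s (H v s + d)) powr t"
      using v t less[of r] less[of s] by (intro mult_strict_mono powr_less_mono2) auto
    also have "\<dots> \<le> \<kappa> - N ((1 - t) * r + t * s) ((1 - t) * (H v r + d) + t * (H v s + d))"
      by (rule lower) (use rs t in auto)
    finally have "N ((1 - t) * r + t * s) ((1 - t) * (H v r + d) + t * (H v s + d)) < exp v" by simp
    then have "H v ((1 - t) * r + t * s) \<le> (1 - t) * (H v r + d) + t * (H v s + d)"
      using below_H[OF v mix[OF rs t]] by (meson not_le)
    then show "H v ((1 - t) * r + t * s) \<le> (1 - t) * H v r + t * H v s + d"
      by (simp add: algebra_simps)
  qed
  define q where "q = b / 2"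
  have q: "q > 0" "\<bar>q\<bar> < b" "\<bar>- q\<bar> < b" using b by (auto simp: q_def)
  define E where "E v = (H v q - H v 0) / q" for v
  have collinear: "(z - x) * H v y = (z - y) * H v x + (y - x) * H v z"
    if v: "exp v < \<kappa>" and xyz: "\<bar>x\<bar> < b" "\<bar>z\<bar> < b" "x < y" "y < z" for v x y z
  proof -
    define t where "t = (y - x) / (z - x)"
    have t5: "(z - x) * t = y - x" using xyz by (simp add: t_def)
    have "(1 - t) * x + t * z = x + (z - x) * t" by (simp add: algebra_simps)
    then have t3: "(1 - t) * x + t * z = y" unfolding t5 by simp
    have t4: "(z - x) * (1 - t) = z - y" using t5 by (simp add: right_diff_distrib)
    have t: "0 < t" "t < 1" using xyz by (auto simp: t_def field_simps)
    have "(1 - t) * v + t * v = v" by (simp add: algebra_simps)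
    then have "H v y = (1 - t) * H v x + t * H v z"
      using concave[OF v v xyz(1,2) t(1,2)] convex[OF v xyz(1,2) t(1,2)] t3 by simp
    then have "(z - x) * H v y = (z - x) * ((1 - t) * H v x + t * H v z)"
      by (rule arg_cong)
    also have "\<dots> = ((z - x) * (1 - t)) * H v x + ((z - x) * t) * H v z"
      by (simp add: algebra_simps)
    finally show ?thesis unfolding t4 t5 .
  qed
  have affine: "H v s = H v 0 + E v * s" if v: "exp v < \<kappa>" and s: "\<bar>s\<bar> < b" for v s
  proof -
    have "q * H v s = q * H v 0 + (H v q - H v 0) * s"
    proof -
      consider "s < 0" | "s = 0" | "0 < s" "s < q" | "s = q" | "q < s" by linarith
      then show "q * H v s = q * H v 0 + (H v q - H v 0) * s"
      proof cases
        case 1 then show ?thesis using collinear[OF v s q(2), of 0] q by (simp add: algebra_simps)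
      next
        case 3 then show ?thesis using collinear[OF v _ q(2), of 0 s] b by (simp add: algebra_simps)
      next
        case 5 then show ?thesis using collinear[OF v _ s, of 0 q] b q by (simp add: algebra_simps)
      qed (auto simp: algebra_simps)
    qed
    then show ?thesis using q by (simp add: E_def field_simps)
  qed
  have lnk: "v < ln \<kappa> \<longleftrightarrow> exp v < \<kappa>" for v using \<kappa> by (metis exp_less_mono exp_ln exp_less_cancel_iff)
  have E_const: "E v = E w" if "exp v < \<kappa>" "exp w < \<kappa>" for v w
  proof (rule controlled_by_second_differences_constant[where p = "\<lambda>v. H v 0" and e = E and B = "ln \<kappa>" and K = q])
    fix v w assume "v \<le> w" "w < ln \<kappa>"
    then show "H w 0 \<le> H v 0"
      unfolding H_def using low[of 0] b bdd
      by (intro cSup_subset_mono) (auto simp: lnk intro: order_trans less_imp_le)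
  next
    fix v w assume "v < ln \<kappa>" "w < ln \<kappa>"
    then have vw: "exp v < \<kappa>" "exp w < \<kappa>" by (auto simp: lnk)
    have "(1/2) * H v q + (1/2) * H w (- q) \<le> H ((v + w) / 2) 0"
      "(1/2) * H w q + (1/2) * H v (- q) \<le> H ((v + w) / 2) 0"
      using concave[OF vw q(2,3), of "1/2"] concave[OF vw(2,1) q(2,3), of "1/2"] by (auto simp: add_divide_distrib add.commute)
    then show "q * \<bar>E v - E w\<bar> \<le> 2 * H ((v + w) / 2) 0 - H v 0 - H w 0"
      using q(1) unfolding affine[OF vw(1) q(2)] affine[OF vw(2) q(2)] affine[OF vw(1) q(3)] affine[OF vw(2) q(3)]
      by (simp add: abs_if algebra_simps)
  qed (use that q lnk in auto)
  \<comment> \<open>Any level below \<open>ln \<kappa>\<close> would do.\<close>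
  define \<epsilon> where "\<epsilon> = E (ln \<kappa> - 1)"
  have \<epsilon>: "H v s = H v 0 + \<epsilon> * s" if v: "exp v < \<kappa>" and s: "\<bar>s\<bar> < b" for v s
    using affine[OF v s] E_const[OF v, of "ln \<kappa> - 1"] by (simp add: \<epsilon>_def lnk[symmetric])
  have transfer: "N s \<tau> \<le> N s' \<tau>'" if s: "\<bar>s\<bar> < b" "\<bar>s'\<bar> < b" and less: "\<tau>' - \<epsilon> * s' < \<tau> - \<epsilon> * s" for s s' \<tau> \<tau>'
  proof (cases "N s \<tau> = 0")
    case False
    then have "0 < N s \<tau>" using range(1)[of s \<tau>] by simp
    then show ?thesis
    proof (rule dense_le_bounded)
      fix p assume p: "0 < p" "p < N s \<tau>"
      define v where "v = ln p"
      have v: "exp v = p" using p by (simp add: v_def)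
      have pk: "exp v < \<kappa>" using p range(2)[OF s(1), of \<tau>] v by simp
      have "\<tau> \<le> H v s" using p v by (intro le_H) simp
      then have "\<tau>' < H v s'" using less \<epsilon>[OF pk s(1)] \<epsilon>[OF pk s(2)] by simp
      then show "p \<le> N s' \<tau>'" using below_H[OF pk s(2)] v by simp
    qed
  qed (use range in auto)
  show thesis by (rule that[of \<epsilon>]) (rule transfer)
qed

section \<open>Symmetric convex bodies with constant sections\<close>

context
  fixes e :: "'a::euclidean_space" and C :: "'a set"
  assumes e: "e \<in> Basis" and C: "compact C" "convex C" "uminus ` C = C"
begin

lemma body_bounded: obtains R where "R > 0" "C \<subseteq> cball 0 R"
proof -
  obtain B where "\<And>x. x \<in> C \<Longrightarrow> norm x \<le> B" using C(1) compact_imp_bounded bounded_iff by metis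
  then show thesis by (intro that[of "\<bar>B\<bar> + 1"]) fastforce+
qed

lemma body_borel: "C \<in> sets borel"
  using C(1) by (rule borel_compact)

lemma slice_even: "slice_measure e C (- s) = slice_measure e C s"
  using slice_measure_reflect[OF e body_borel, of s] by (simp add: C(3))

lemma slice_log_concave:
  assumes "0 < t" "t < 1"
  shows "slice_measure e C r powr (1 - t) * slice_measure e C s powr t \<le> slice_measure e C ((1 - t) * r + t * s)"
proof -
  obtain R where R: "C \<subseteq> cball 0 R" by (rule body_bounded)
  show ?thesis
    using body_borel R assms C(2) by (intro slice_measure_log_concave[OF e]) (auto simp: convexD)
qed

text \<open>For \<open>\<bar>r\<bar> < \<bar>s\<bar>\<close> the section at \<open>r\<close> contains a convex combination of the sections at \<open>s\<close> and
\<open>- s\<close>, which are reflections of each other and so have the same measure.\<close>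

lemma slice_unimodal:
  assumes "\<bar>r\<bar> \<le> \<bar>s\<bar>"
  shows "slice_measure e C s \<le> slice_measure e C r"
proof (cases "\<bar>r\<bar> = \<bar>s\<bar>")
  case True
  then show ?thesis using slice_even[of s] by (auto simp: abs_eq_iff)
next
  case False
  then have rs: "\<bar>r\<bar> < \<bar>s\<bar>" "s \<noteq> 0" using assms by auto
  define t where "t = (1 - r / s) / 2"
  have "\<bar>r / s\<bar> < 1" using rs by (simp add: abs_divide)
  then have "r / s < 1" "- 1 < r / s" by linarith+
  then have t: "0 < t" "t < 1" by (auto simp: t_def)
  have "(1 - t) * s + t * - s = r" using rs by (simp add: t_def field_simps)
  then have "slice_measure e C s powr (1 - t) * slice_measure e C s powr t \<le> slice_measure e C r"
    using slice_log_concave[OF t, of s "- s"] by (simp add: slice_even)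
  then show ?thesis
    using slice_measure_nonneg[OF e, of C s] by (simp add: powr_add[symmetric])
qed

definition tail_measure :: "'a \<Rightarrow> real \<Rightarrow> real \<Rightarrow> real" where
  "tail_measure v s \<tau> = slice_measure e (C \<inter> {x. \<tau> \<le> v \<bullet> x}) s"

text \<open>Up to the factor \<open>slice_measure e C s\<close> this is the value of \<open>v\<close> at the centroid of the section.  Its
linearity in \<open>v\<close> turns translations found for each functional separately into one translation
vector.\<close>

definition slice_moment :: "'a \<Rightarrow> real \<Rightarrow> real" where
  "slice_moment v s = (LINT y|slice_space e. indicator C (of_coords (y(e := s))) * (v \<bullet> of_coords (y(e := s))))"

lemma halfspace_borel: "C \<inter> {x. \<tau> \<le> v \<bullet> x} \<in> sets borel" "C - {x. \<tau> \<le> v \<bullet> x} \<in> sets borel"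
  using body_borel by auto

lemma slice_indicator_integrable:
  assumes "continuous_on UNIV h"
  shows "integrable (slice_space e) (\<lambda>y. indicator C (of_coords (y(e := s))) * h (of_coords (y(e := s))) :: real)"
proof -
  obtain R where R: "C \<subseteq> cball 0 R" by (rule body_bounded)
  let ?S = "{y \<in> space (slice_space e). of_coords (y(e := s)) \<in> C}"
  have S: "?S \<in> fmeasurable (slice_space e)" by (rule slice_fmeasurable[OF e body_borel R])
  have "bounded (h ` C)"
    using compact_continuous_image[OF continuous_on_subset[OF assms] C(1)] compact_imp_bounded by auto
  then obtain B where "\<forall>x\<in>h ` C. norm x \<le> B" unfolding bounded_iff by auto
  then have B: "\<bar>h x\<bar> \<le> \<bar>B\<bar>" if "x \<in> C" for x using that by fastforce
  have [measurable]: "C \<in> sets borel" "h \<in> borel_measurable borel"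
    using body_borel assms by (auto intro: borel_measurable_continuous_onI)
  note [measurable] = slice_coord_measurable[OF e]
  show ?thesis
  proof (rule Bochner_Integration.integrable_bound)
    show "integrable (slice_space e) (\<lambda>y. \<bar>B\<bar> * indicator ?S y)"
      using S by (intro integrable_mult_right integrable_real_indicator) (auto simp: fmeasurable_def)
    show "AE y in slice_space e. norm (indicator C (of_coords (y(e := s))) * h (of_coords (y(e := s))) :: real) \<le> norm (\<bar>B\<bar> * indicator ?S y :: real)"
      using B by (intro AE_I2) (auto simp: indicator_def)
  qed measurable
qed

lemma slice_moment_linear: "linear (\<lambda>v. slice_moment v s)"
proof (rule linearI)
  have int: "integrable (slice_space e) (\<lambda>y. indicator C (of_coords (y(e := s))) * (v \<bullet> of_coords (y(e := s))) :: real)" for v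
    by (rule slice_indicator_integrable) (intro continuous_intros)
  show "slice_moment (v + w) s = slice_moment v s + slice_moment w s" for v w
    unfolding slice_moment_def using int by (simp add: inner_add_left distrib_left)
  show "slice_moment (c *\<^sub>R v) s = c *\<^sub>R slice_moment v s" for c v
    unfolding slice_moment_def by (simp add: mult.left_commute)
qed

lemma slice_moment_axis: "slice_moment e s = s * slice_measure e C s"
proof -
  obtain R where R: "C \<subseteq> cball 0 R" by (rule body_bounded)
  let ?S = "{y \<in> space (slice_space e). of_coords (y(e := s)) \<in> C}"
  have S: "?S \<in> fmeasurable (slice_space e)" by (rule slice_fmeasurable[OF e body_borel R])
  have "slice_moment e s = (LINT y|slice_space e. s * indicator ?S y)"
    unfolding slice_moment_def using of_coords_slice[OF e]
    by (intro Bochner_Integration.integral_cong) (auto simp: indicator_def inner_commute)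
  also have "\<dots> = s * slice_measure e C s"
    using S by (simp add: slice_measure_eq[OF e] fmeasurable_def)
  finally show ?thesis .
qed

lemma tail_measure_antimono: "\<tau> \<le> \<tau>' \<Longrightarrow> tail_measure v s \<tau>' \<le> tail_measure v s \<tau>"
proof -
  obtain R where R: "C \<subseteq> cball 0 R" by (rule body_bounded)
  show "\<tau> \<le> \<tau>' \<Longrightarrow> tail_measure v s \<tau>' \<le> tail_measure v s \<tau>"
    unfolding tail_measure_def using R halfspace_borel
    by (intro slice_measure_mono[OF e, where R = R]) auto
qed

lemma tail_measure_le: "tail_measure v s \<tau> \<le> slice_measure e C s"
proof -
  obtain R where R: "C \<subseteq> cball 0 R" by (rule body_bounded)
  show ?thesis
    unfolding tail_measure_def using R halfspace_borel body_borel
    by (intro slice_measure_mono[OF e, where R = R]) auto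
qed

text \<open>The first moment depends only on the distribution of \<open>v\<close> on the section, that is, on its tails.
The shift by \<open>R\<close> makes the integrand nonnegative.\<close>

lemma slice_moment_layer_cake:
  assumes R: "\<And>x. x \<in> C \<Longrightarrow> - R \<le> v \<bullet> x"
  shows "slice_moment v s + R * slice_measure e C s
    = enn2real (\<integral>\<^sup>+r. ennreal (tail_measure v s (r - R)) * indicator {0<..} r \<partial>lborel)"
proof -
  obtain R' where R': "C \<subseteq> cball 0 R'" by (rule body_bounded)
  have sf: "sigma_finite_measure (slice_space e)"
    by (rule product_sigma_finite.sigma_finite)
       (auto simp: product_sigma_finite_def lborel.sigma_finite_measure_axioms)
  let ?X = "\<lambda>y. of_coords (y(e := s))"
  let ?f = "\<lambda>y. indicator C (?X y) * (v \<bullet> ?X y + R) :: real"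
  have [measurable]: "C \<in> sets borel" by (rule body_borel)
  note [measurable] = slice_coord_measurable[OF e]
  have meas: "?f \<in> borel_measurable (slice_space e)" by measurable
  have i1: "integrable (slice_space e) (\<lambda>y. indicator C (?X y) * (v \<bullet> ?X y) :: real)"
    by (rule slice_indicator_integrable) (intro continuous_intros)
  have i2: "integrable (slice_space e) (\<lambda>y. indicator C (?X y) * R :: real)"
    using slice_indicator_integrable[of "\<lambda>_. R"] by simp
  have "(LINT y|slice_space e. indicator C (?X y) * R) = R * slice_measure e C s"
  proof -
    have "(LINT y|slice_space e. indicator C (?X y) * R) = (LINT y|slice_space e. R * indicator {y \<in> space (slice_space e). ?X y \<in> C} y)"
      by (intro Bochner_Integration.integral_cong) (auto simp: indicator_def)
    also have "\<dots> = R * slice_measure e C s"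
      using slice_fmeasurable[OF e body_borel R', of s] by (simp add: slice_measure_eq[OF e] fmeasurable_def)
    finally show ?thesis .
  qed
  then have "slice_moment v s + R * slice_measure e C s = (LINT y|slice_space e. ?f y)"
    unfolding slice_moment_def by (simp only: distrib_left Bochner_Integration.integral_add[OF i1 i2])
  also have "\<dots> = enn2real (\<integral>\<^sup>+y. ennreal (?f y) \<partial>slice_space e)"
    using R meas by (intro integral_eq_nn_integral) (force simp: indicator_def)+
  also have "(\<integral>\<^sup>+y. ennreal (?f y) \<partial>slice_space e)
      = (\<integral>\<^sup>+r. emeasure (slice_space e) {y \<in> space (slice_space e). r \<le> ?f y} * indicator {0<..} r \<partial>lborel)"
    by (rule nn_integral_layer_cake[OF sf meas])
  also have "\<dots> = (\<integral>\<^sup>+r. ennreal (tail_measure v s (r - R)) * indicator {0<..} r \<partial>lborel)"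
  proof (intro nn_integral_cong)
    fix r :: real
    have "emeasure (slice_space e) {y \<in> space (slice_space e). r \<le> ?f y} = ennreal (tail_measure v s (r - R))" if "r > 0"
    proof -
      have eq: "{y \<in> space (slice_space e). r \<le> ?f y} = {y \<in> space (slice_space e). ?X y \<in> C \<inter> {x. r - R \<le> v \<bullet> x}}"
        using that by (auto simp: indicator_def)
      have sub: "C \<inter> {x. r - R \<le> v \<bullet> x} \<subseteq> cball 0 R'" using R' by auto
      show ?thesis
        unfolding eq tail_measure_def slice_measure_eq[OF e]
        by (intro emeasure_eq_ennreal_measure fmeasurableD2 slice_fmeasurable[OF e halfspace_borel(1) sub])
    qed
    then show "emeasure (slice_space e) {y \<in> space (slice_space e). r \<le> ?f y} * indicator {0<..} r
        = ennreal (tail_measure v s (r - R)) * indicator {0<..} r"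
      by (cases "r > 0") auto
  qed
  finally show ?thesis .
qed

lemma tail_measure_low:
  assumes "\<And>x. x \<in> C \<Longrightarrow> \<tau> \<le> v \<bullet> x"
  shows "tail_measure v s \<tau> = slice_measure e C s"
  using assms by (auto simp: tail_measure_def intro!: arg_cong[where f = "\<lambda>A. slice_measure e A s"])

lemma slice_measure_pos_imp_point:
  assumes "0 < slice_measure e A s"
  obtains x where "x \<in> A" "x \<bullet> e = s"
proof -
  have "{y \<in> space (slice_space e). of_coords (y(e := s)) \<in> A} \<noteq> {}"
  proof
    assume "{y \<in> space (slice_space e). of_coords (y(e := s)) \<in> A} = {}"
    then have "slice_measure e A s = 0" by (simp only: slice_measure_eq[OF e] measure_empty)
    then show False using assms by simp
  qed
  then show thesis using that of_coords_slice[OF e] by blast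
qed

lemma tail_measure_high:
  assumes "\<And>x. x \<in> C \<Longrightarrow> v \<bullet> x < \<tau>"
  shows "tail_measure v s \<tau> = 0"
proof -
  have "\<not> 0 < slice_measure e (C \<inter> {x. \<tau> \<le> v \<bullet> x}) s"
    by (rule notI, erule slice_measure_pos_imp_point) (use assms in force)
  then show ?thesis
    using slice_measure_nonneg[OF e, of "C \<inter> {x. \<tau> \<le> v \<bullet> x}" s] by (simp add: tail_measure_def)
qed

context
  fixes b \<kappa> :: real
  assumes b: "b > 0" and \<kappa>: "\<kappa> > 0" and const: "\<And>s. \<bar>s\<bar> < b \<Longrightarrow> slice_measure e C s = \<kappa>"
    and width: "\<And>x. x \<in> C \<Longrightarrow> \<bar>x \<bullet> e\<bar> \<le> b" and int: "interior C \<noteq> {}"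
begin

text \<open>A convex combination of points with \<open>v \<bullet> x \<ge> \<tau>\<close> and \<open>v \<bullet> y \<ge> \<sigma>\<close> satisfies the bound
with the combined threshold, and the same holds for the reversed strict inequalities.  So the
Brunn--Minkowski inequality applies to the tails and to their complements in the sections.\<close>

lemma tails_translate:
  obtains \<epsilon> where "\<And>s s' \<tau> \<tau>'. \<bar>s\<bar> < b \<Longrightarrow> \<bar>s'\<bar> < b \<Longrightarrow> \<tau>' - \<epsilon> * s' < \<tau> - \<epsilon> * s \<Longrightarrow> tail_measure v s \<tau> \<le> tail_measure v s' \<tau>'"
proof -
  obtain R where R: "R > 0" "C \<subseteq> cball 0 R" by (rule body_bounded)
  define Q where "Q = norm v * R"
  have Q: "\<bar>v \<bullet> x\<bar> \<le> Q" if "x \<in> C" for x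
  proof -
    have "\<bar>v \<bullet> x\<bar> \<le> norm v * norm x" by (rule Cauchy_Schwarz_ineq2)
    also have "\<dots> \<le> Q" using R that by (auto simp: Q_def intro!: mult_left_mono)
    finally show ?thesis .
  qed
  have compl: "\<kappa> - tail_measure v s \<tau> = slice_measure e (C - {x. \<tau> \<le> v \<bullet> x}) s" if "\<bar>s\<bar> < b" for s \<tau>
    using slice_measure_Diff[OF e body_borel R(2), of "{x. \<tau> \<le> v \<bullet> x}" s] that
    by (simp add: tail_measure_def const)
  have mix: "\<bar>(1 - t) * r + t * s\<bar> < b" if "\<bar>r\<bar> < b" "\<bar>s\<bar> < b" "0 < t" "t < 1" for r s t
    using that convex_bound_lt[of r b s "1 - t" t] convex_bound_lt[of "- r" b "- s" "1 - t" t]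
    by (simp add: abs_less_iff)
  show thesis
  proof (rule translates_of_log_concave_tails[OF b \<kappa>, of "tail_measure v" Q])
    show "0 \<le> tail_measure v s \<tau>" for s \<tau> by (simp add: tail_measure_def slice_measure_nonneg[OF e])
    show "tail_measure v s \<tau> \<le> \<kappa>" if "\<bar>s\<bar> < b" for s \<tau> using tail_measure_le[of v s \<tau>] const[OF that] by simp
    show "tail_measure v s \<tau>' \<le> tail_measure v s \<tau>" if "\<tau> \<le> \<tau>'" for s \<tau> \<tau>' using that by (rule tail_measure_antimono)
    show "tail_measure v s (- Q) = \<kappa>" if "\<bar>s\<bar> < b" for s
      using Q const[OF that] by (subst tail_measure_low) (force simp: abs_le_iff)+
    show "tail_measure v s \<tau> = 0" if "Q < \<tau>" for s \<tau>
      using Q that by (intro tail_measure_high) force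
    fix r s t \<tau> \<sigma> :: real assume rs: "\<bar>r\<bar> < b" "\<bar>s\<bar> < b" and t: "0 < t" "t < 1"
    show "tail_measure v r \<tau> powr (1 - t) * tail_measure v s \<sigma> powr t \<le> tail_measure v ((1 - t) * r + t * s) ((1 - t) * \<tau> + t * \<sigma>)"
      unfolding tail_measure_def
    proof (rule slice_measure_log_concave[OF e _ _ _ _ _ _ t])
      fix x y assume "x \<in> C \<inter> {x. \<tau> \<le> v \<bullet> x}" "y \<in> C \<inter> {x. \<sigma> \<le> v \<bullet> x}"
      then show "(1 - t) *\<^sub>R x + t *\<^sub>R y \<in> C \<inter> {x. (1 - t) * \<tau> + t * \<sigma> \<le> v \<bullet> x}"
        using t C(2) by (auto simp: convexD inner_add_right intro!: add_mono mult_left_mono)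
    qed (use halfspace_borel R in auto)
    show "(\<kappa> - tail_measure v r \<tau>) powr (1 - t) * (\<kappa> - tail_measure v s \<sigma>) powr t
        \<le> \<kappa> - tail_measure v ((1 - t) * r + t * s) ((1 - t) * \<tau> + t * \<sigma>)"
      unfolding compl[OF rs(1)] compl[OF rs(2)] compl[OF mix[OF rs t]]
    proof (rule slice_measure_log_concave[OF e _ _ _ _ _ _ t])
      fix x y assume "x \<in> C - {x. \<tau> \<le> v \<bullet> x}" "y \<in> C - {x. \<sigma> \<le> v \<bullet> x}"
      then show "(1 - t) *\<^sub>R x + t *\<^sub>R y \<in> C - {x. (1 - t) * \<tau> + t * \<sigma> \<le> v \<bullet> x}"
        using t C(2) by (auto simp: convexD inner_add_right not_le intro!: add_strict_mono mult_strict_left_mono)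
    qed (use halfspace_borel R in auto)
  qed (rule that)
qed

text \<open>The tails at \<open>s\<close> are at most those at \<open>s'\<close> after an arbitrarily small shift \<open>\<delta>\<close> of the
threshold, and such a shift changes the integral of the tails by at most \<open>\<delta> * \<kappa>\<close>.\<close>

lemma slice_moment_le:
  assumes le: "\<And>\<tau> \<tau>'. \<tau>' < \<tau> \<Longrightarrow> tail_measure w s \<tau> \<le> tail_measure w s' \<tau>'" and s: "\<bar>s\<bar> < b" "\<bar>s'\<bar> < b"
  shows "slice_moment w s \<le> slice_moment w s'"
proof (rule field_le_epsilon)
  fix d :: real assume d: "d > 0"
  define \<delta> where "\<delta> = d / \<kappa>"
  have \<delta>: "\<delta> > 0" "\<delta> * \<kappa> = d" using d \<kappa> by (auto simp: \<delta>_def)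
  obtain R where R: "R > 0" "C \<subseteq> cball 0 R" by (rule body_bounded)
  define Q where "Q = norm w * R"
  have Q: "- Q \<le> w \<bullet> x" "w \<bullet> x \<le> Q" if "x \<in> C" for x
  proof -
    have "\<bar>w \<bullet> x\<bar> \<le> norm w * norm x" by (rule Cauchy_Schwarz_ineq2)
    also have "\<dots> \<le> Q" using R that by (auto simp: Q_def intro!: mult_left_mono)
    finally show "- Q \<le> w \<bullet> x" "w \<bullet> x \<le> Q" by auto
  qed
  have [measurable]: "tail_measure w s \<in> borel_measurable borel" for s
  proof -
    have "(\<lambda>\<tau>. - tail_measure w s \<tau>) \<in> borel_measurable borel"
      by (intro borel_measurable_mono monoI) (simp add: tail_measure_antimono)
    then have "(\<lambda>\<tau>. - (- tail_measure w s \<tau>)) \<in> borel_measurable borel" by measurable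
    then show ?thesis by simp
  qed
  let ?M = "\<lambda>s. \<integral>\<^sup>+r. ennreal (tail_measure w s (r - Q)) * indicator {0<..} r \<partial>lborel"
  have fin: "?M s < \<infinity>" if "\<bar>s\<bar> < b" for s
  proof -
    have "?M s \<le> (\<integral>\<^sup>+r. ennreal \<kappa> * indicator {0..2 * Q} r \<partial>lborel)"
    proof (intro nn_integral_mono)
      fix r :: real
      show "ennreal (tail_measure w s (r - Q)) * indicator {0<..} r \<le> ennreal \<kappa> * indicator {0..2 * Q} r"
      proof (cases "r > 2 * Q")
        case True
        then have "tail_measure w s (r - Q) = 0" using Q(2) by (intro tail_measure_high) force
        then show ?thesis by simp
      next
        case False
        then show ?thesis using tail_measure_le[of w s "r - Q"] const[OF that] by (auto simp: indicator_def intro: ennreal_leI)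
      qed
    qed
    also have "\<dots> = ennreal \<kappa> * emeasure lborel {0..2 * Q}" by (simp add: nn_integral_cmult)
    also have "\<dots> < \<infinity>" by (auto simp: emeasure_lborel_Icc_eq ennreal_mult_less_top)
    finally show ?thesis .
  qed
  have "?M s \<le> (\<integral>\<^sup>+r. ennreal (tail_measure w s' ((- \<delta> + 1 * r) - Q)) * indicator {0<..} ((- \<delta> + 1 * r) + \<delta>) \<partial>lborel)"
    using \<delta> by (intro nn_integral_mono) (auto simp: indicator_def intro!: ennreal_leI le)
  also have "\<dots> = (\<integral>\<^sup>+r. ennreal (tail_measure w s' (r - Q)) * indicator {0<..} (r + \<delta>) \<partial>lborel)"
    using nn_integral_real_affine[of "\<lambda>r. ennreal (tail_measure w s' (r - Q)) * indicator {0<..} (r + \<delta>)" 1 "- \<delta>"] by simp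
  also have "\<dots> \<le> (\<integral>\<^sup>+r. ennreal (tail_measure w s' (r - Q)) * indicator {0<..} r + ennreal \<kappa> * indicator {- \<delta>..0} r \<partial>lborel)"
    using tail_measure_le[of w s'] const[OF s(2)]
    by (intro nn_integral_mono) (auto simp: indicator_def intro: ennreal_leI)
  also have "\<dots> = ?M s' + ennreal d"
    using \<delta> \<kappa> by (subst nn_integral_add) (auto simp: nn_integral_cmult ennreal_mult[symmetric] mult.commute)
  finally have "enn2real (?M s) \<le> enn2real (?M s' + ennreal d)"
    using fin[OF s(2)] by (intro enn2real_mono) (auto simp: ennreal_add_less_top)
  also have "\<dots> = enn2real (?M s') + d"
    using fin[OF s(2)] d by (subst enn2real_plus) auto
  finally show "slice_moment w s \<le> slice_moment w s' + d"
    using slice_moment_layer_cake[OF Q(1), of s] slice_moment_layer_cake[OF Q(1), of s'] const s by simp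
qed

lemma slice_interior_point:
  assumes s: "\<bar>s\<bar> < b"
  obtains p where "p \<in> interior C" "p \<bullet> e = s"
proof -
  have neg: "- x \<in> C" if "x \<in> C" for x using that C(3) by blast
  obtain z where z: "z \<in> C" "z \<bullet> e = (\<bar>s\<bar> + b) / 2"
    using slice_measure_pos_imp_point[of C "(\<bar>s\<bar> + b) / 2"] const[of "(\<bar>s\<bar> + b) / 2"] s \<kappa> by auto
  have zero: "0 \<in> interior C" by (rule symmetric_interior_zero[OF C(2,3) int])
  define t where "t = s / ((\<bar>s\<bar> + b) / 2)"
  have t: "\<bar>t\<bar> < 1" using s by (simp add: t_def abs_divide field_simps)
  have shrink: "r *\<^sub>R x \<in> interior C" if "x \<in> C" "0 \<le> r" "r < 1" for r x
    using mem_interior_convex_shrink[OF C(2) zero that(1), of "1 - r"] that(2,3) by (simp add: algebra_simps)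
  have "t *\<^sub>R z \<in> interior C"
  proof (cases "t \<ge> 0")
    case True then show ?thesis using shrink[OF z(1), of t] t by simp
  next
    case False then show ?thesis using shrink[OF neg[OF z(1)], of "- t"] t by simp
  qed
  moreover have "(t *\<^sub>R z) \<bullet> e = s" using z(2) s by (simp add: t_def field_simps)
  ultimately show thesis by (rule that)
qed

text \<open>The section meets the interior of the body; moving the given point slightly towards such a point
makes it interior.\<close>

lemma tail_measure_pos:
  assumes x: "x \<in> C" "x \<bullet> e = s" "\<tau> < v \<bullet> x" and s: "\<bar>s\<bar> < b"
  shows "0 < tail_measure v s \<tau>"
proof -
  obtain R where R: "C \<subseteq> cball 0 R" by (rule body_bounded)
  obtain p where p: "p \<in> interior C" "p \<bullet> e = s" using slice_interior_point[OF s] .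
  define d where "d = min 1 ((v \<bullet> x - \<tau>) / (2 * (\<bar>v \<bullet> (x - p)\<bar> + 1)))"
  have d: "0 < d" "d \<le> 1" using x(3) by (auto simp: d_def)
  define y where "y = x - d *\<^sub>R (x - p)"
  have y: "y \<in> interior C" unfolding y_def using mem_interior_convex_shrink[OF C(2) p(1) x(1) d] .
  have "d * (v \<bullet> (x - p)) \<le> d * (\<bar>v \<bullet> (x - p)\<bar> + 1)" using d by (intro mult_left_mono) auto
  also have "\<dots> \<le> ((v \<bullet> x - \<tau>) / (2 * (\<bar>v \<bullet> (x - p)\<bar> + 1))) * (\<bar>v \<bullet> (x - p)\<bar> + 1)"
    by (intro mult_right_mono) (auto simp: d_def)
  also have "\<dots> = (v \<bullet> x - \<tau>) / 2" by (simp add: field_simps)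
  also have "\<dots> < v \<bullet> x - \<tau>" using x(3) by simp
  finally have vy: "\<tau> < v \<bullet> y" by (simp add: y_def inner_diff_right)
  have "open (interior C \<inter> {x. \<tau> < v \<bullet> x})" by (intro open_Int open_interior open_halfspace_gt)
  then have "y \<in> interior (C \<inter> {x. \<tau> \<le> v \<bullet> x})"
    by (rule interiorI) (use y vy interior_subset in auto)
  moreover have "y \<bullet> e = s" using x(2) p(2) by (simp add: y_def inner_diff_left)
  ultimately show ?thesis
    unfolding tail_measure_def using halfspace_borel R by (intro slice_measure_pos[OF e, where R = R]) auto
qed

text \<open>For each functional \<open>v\<close> the distributions of \<open>v\<close> on the sections are translates of each other, and
the shift is proportional to \<open>s\<close>.  The shift is also the displacement of the first moment, so it is
linear in \<open>v\<close> and is given by one vector \<open>x0\<close>.  Hence the supports of \<open>v\<close> on the sections are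
translated by multiples of \<open>x0\<close> for all \<open>v\<close>, and separation of a point from a closed convex
section shows that the sections themselves are.  The moments are essential: the shifts of the
supports alone would not have to be linear in \<open>v\<close>.\<close>

lemma constant_slices_imp_cylinder:
  obtains x0 where "x0 \<bullet> e = b"
    and "C = {x. \<exists>r z. \<bar>r\<bar> \<le> 1 \<and> z \<in> C \<and> z \<bullet> e = 0 \<and> x = r *\<^sub>R x0 + z}"
proof -
  define q where "q = b / 2"
  have q: "q > 0" "\<bar>q\<bar> < b" using b by (auto simp: q_def)
  define L where "L v = b * (slice_moment v q - slice_moment v 0) / (q * \<kappa>)" for v
  have L_alt: "L = (\<lambda>v. (b / (q * \<kappa>)) *\<^sub>R (slice_moment v q - slice_moment v 0))"
    by (simp add: L_def fun_eq_iff)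
  have "linear L" unfolding L_alt
    by (intro linear_compose_scale_right linear_compose_sub slice_moment_linear)
  define x0 where "x0 = (\<Sum>i\<in>Basis. L i *\<^sub>R i)"
  have L: "L v = v \<bullet> x0" for v
  proof -
    have "L v = L (\<Sum>i\<in>Basis. (v \<bullet> i) *\<^sub>R i)" by (simp add: euclidean_representation)
    also have "\<dots> = (\<Sum>i\<in>Basis. (v \<bullet> i) * L i)"
      using \<open>linear L\<close> by (simp add: linear_sum linear_scale)
    also have "\<dots> = v \<bullet> x0" by (simp add: x0_def inner_sum_right mult.commute)
    finally show ?thesis .
  qed
  have x0e: "x0 \<bullet> e = b"
    using L[of e] q \<kappa> b by (simp add: L_def slice_moment_axis const inner_commute)
  have shift: "tail_measure v s \<tau> \<le> tail_measure v s' \<tau>'"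
    if s: "\<bar>s\<bar> < b" "\<bar>s'\<bar> < b" and less: "\<tau>' - (v \<bullet> x0) / b * s' < \<tau> - (v \<bullet> x0) / b * s" for v s s' \<tau> \<tau>'
  proof -
    obtain \<epsilon> where \<epsilon>: "\<And>s s' \<tau> \<tau>'. \<bar>s\<bar> < b \<Longrightarrow> \<bar>s'\<bar> < b \<Longrightarrow> \<tau>' - \<epsilon> * s' < \<tau> - \<epsilon> * s \<Longrightarrow> tail_measure v s \<tau> \<le> tail_measure v s' \<tau>'"
      by (rule tails_translate[of v], rule that, blast)
    \<comment> \<open>The functional \<open>w\<close> takes out the shift, so its first moment is the same on all sections.\<close>
    define w where "w = v - \<epsilon> *\<^sub>R e"
    have tail_w: "tail_measure w s \<tau> = tail_measure v s (\<tau> + \<epsilon> * s)" for s \<tau>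
    proof -
      obtain R where R: "C \<subseteq> cball 0 R" by (rule body_bounded)
      then have sub: "C \<inter> {x. t \<le> u \<bullet> x} \<subseteq> cball 0 R" for t u by auto
      show ?thesis
        unfolding tail_measure_def
        by (intro antisym slice_measure_mono[OF e halfspace_borel(1) halfspace_borel(1) sub])
           (auto simp: w_def inner_diff_left inner_commute[of e])
    qed
    have w_le: "slice_moment w s \<le> slice_moment w s'" if "\<bar>s\<bar> < b" "\<bar>s'\<bar> < b" for s s'
      by (rule slice_moment_le) (use \<epsilon>[OF that] that in \<open>auto simp: tail_w\<close>)
    have "slice_moment w q = slice_moment w 0" using w_le[of q 0] w_le[of 0 q] q b by simp
    moreover have "slice_moment w s = slice_moment v s - \<epsilon> * (s * \<kappa>)" if "\<bar>s\<bar> < b" for s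
      using that linear_diff[OF slice_moment_linear[of s], of v "\<epsilon> *\<^sub>R e"]
        linear_scale[OF slice_moment_linear[of s], of \<epsilon> e]
      by (simp add: w_def slice_moment_axis const)
    ultimately have "slice_moment v q - slice_moment v 0 = \<epsilon> * (q * \<kappa>)" using q b by simp
    then have "v \<bullet> x0 = b * \<epsilon>" using L[of v] q \<kappa> by (simp add: L_def)
    then have "(v \<bullet> x0) / b = \<epsilon>" using b by simp
    then show ?thesis using \<epsilon>[OF s] less by simp
  qed
  have move: "x + ((s' - s) / b) *\<^sub>R x0 \<in> C"
    if x: "x \<in> C" "x \<bullet> e = s" and s: "\<bar>s\<bar> < b" "\<bar>s'\<bar> < b" for x s s'
  proof (rule ccontr)
    let ?y = "x + ((s' - s) / b) *\<^sub>R x0"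
    assume y: "?y \<notin> C"
    have ye: "?y \<bullet> e = s'" using x x0e b by (simp add: inner_add_left)
    let ?S = "C \<inter> {x. e \<bullet> x = s'}"
    have "convex ?S" "closed ?S" "?y \<notin> ?S"
      using C y by (auto intro!: convex_Int closed_Int compact_imp_closed closed_hyperplane convex_hyperplane)
    then obtain a \<beta> where a: "a \<bullet> ?y < \<beta>" "\<And>z. z \<in> ?S \<Longrightarrow> \<beta> < a \<bullet> z"
      using separating_hyperplane_closed_point[of ?S ?y] by blast
    have "\<exists>\<gamma>>0. A = B - 3 * \<gamma>" if "A < B" for A B :: real
      using that by (intro exI[of _ "(B - A) / 3"]) (simp add: field_simps)
    from this[OF a(1)] obtain \<gamma> where \<gamma>: "\<gamma> > 0" "a \<bullet> ?y = \<beta> - 3 * \<gamma>" by blast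
    have "0 < tail_measure (- a) s (- a \<bullet> x - \<gamma>)" using \<gamma> by (intro tail_measure_pos[OF x _ s(1)]) simp
    also have "\<dots> \<le> tail_measure (- a) s' (- \<beta>)"
    proof (rule shift[OF s])
      have "a \<bullet> ?y = a \<bullet> x + (s' - s) / b * (a \<bullet> x0)" by (simp add: inner_add_right)
      then show "- \<beta> - (- a \<bullet> x0) / b * s' < - a \<bullet> x - \<gamma> - (- a \<bullet> x0) / b * s"
        using \<gamma> by (simp add: diff_divide_distrib algebra_simps)
    qed
    finally obtain z where "z \<in> C" "- \<beta> \<le> - a \<bullet> z" "z \<bullet> e = s'"
      unfolding tail_measure_def by (rule slice_measure_pos_imp_point) auto
    then show False using a(2)[of z] by (auto simp: inner_commute)
  qed
  have closed_C: "closed C" using C(1) by (rule compact_imp_closed)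
  \<comment> \<open>The sections at \<open>b\<close> and \<open>- b\<close> are reached as limits, because constancy is known only in between.\<close>
  have dense: "P 1" if P: "closed {r::real. P r}" "\<And>r. 0 \<le> r \<Longrightarrow> r < 1 \<Longrightarrow> P r" for P
  proof -
    have "{0<..<1} \<subseteq> {r. P r}" using P(2) by auto
    then have "closure {0<..<1::real} \<subseteq> {r. P r}" using P(1) by (rule closure_minimal)
    then have "{0..1} \<subseteq> {r. P r}" by simp
    then show ?thesis using subsetD[of "{0..1}" "{r. P r}" 1] by simp
  qed
  have up: "r *\<^sub>R x0 + z \<in> C" if z: "z \<in> C" "z \<bullet> e = 0" and r: "\<bar>r\<bar> \<le> 1" for r z
  proof -
    have "(t * r) *\<^sub>R x0 + z \<in> C" if t: "0 \<le> t" "t < 1" for t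
    proof -
      have "\<bar>t * r\<bar> = t * \<bar>r\<bar>" using t by (simp add: abs_mult)
      also have "\<dots> \<le> t * 1" using t r by (intro mult_left_mono) auto
      finally have "\<bar>t * r\<bar> < 1" using t by simp
      then have "\<bar>t * r * b\<bar> < b" using b by (simp add: abs_mult)
      then show ?thesis using move[OF z, of "t * r * b"] b by (simp add: add.commute)
    qed
    moreover have "closed ((\<lambda>t. (t * r) *\<^sub>R x0 + z) -` C)"
      by (intro closed_vimage closed_C continuous_intros)
    then have "closed {t. (t * r) *\<^sub>R x0 + z \<in> C}" by (simp add: vimage_def)
    ultimately have "(1 * r) *\<^sub>R x0 + z \<in> C" by (intro dense[of "\<lambda>t. (t * r) *\<^sub>R x0 + z \<in> C"]) auto
    then show ?thesis by simp
  qed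
  have down: "x - ((x \<bullet> e) / b) *\<^sub>R x0 \<in> C" if x: "x \<in> C" for x
  proof -
    have zero: "0 \<in> C"
      using convexD[OF C(2) x, of "- x" "1/2" "1/2"] C(3) x by (auto simp: image_iff)
    have "t *\<^sub>R x - (t * ((x \<bullet> e) / b)) *\<^sub>R x0 \<in> C" if t: "0 \<le> t" "t < 1" for t
    proof -
      have "t *\<^sub>R x \<in> C" using convexD[OF C(2) x zero, of t "1 - t"] t by simp
      moreover have "\<bar>t * (x \<bullet> e)\<bar> < b"
      proof -
        have "\<bar>t * (x \<bullet> e)\<bar> \<le> t * b" using width[OF x] t by (simp add: abs_mult mult_left_mono)
        also have "\<dots> < b" using t b by simp
        finally show ?thesis .
      qed
      ultimately show ?thesis using move[of "t *\<^sub>R x" "t * (x \<bullet> e)" 0] b by simp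
    qed
    moreover have "closed ((\<lambda>t. t *\<^sub>R x - (t * ((x \<bullet> e) / b)) *\<^sub>R x0) -` C)"
      by (intro closed_vimage closed_C continuous_intros)
    then have "closed {t. t *\<^sub>R x - (t * ((x \<bullet> e) / b)) *\<^sub>R x0 \<in> C}" by (simp add: vimage_def)
    ultimately have "1 *\<^sub>R x - (1 * ((x \<bullet> e) / b)) *\<^sub>R x0 \<in> C"
      by (intro dense[of "\<lambda>t. t *\<^sub>R x - (t * ((x \<bullet> e) / b)) *\<^sub>R x0 \<in> C"]) auto
    then show ?thesis by simp
  qed
  show thesis
  proof (rule that[OF x0e], intro equalityI subsetI)
    fix x assume x: "x \<in> C"
    have "\<bar>(x \<bullet> e) / b\<bar> \<le> 1" using width[OF x] b by (simp add: abs_divide)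
    moreover have "(x - ((x \<bullet> e) / b) *\<^sub>R x0) \<bullet> e = 0" using x0e b by (simp add: inner_diff_left)
    ultimately show "x \<in> {x. \<exists>r z. \<bar>r\<bar> \<le> 1 \<and> z \<in> C \<and> z \<bullet> e = 0 \<and> x = r *\<^sub>R x0 + z}"
      using down[OF x] by (intro CollectI exI[of _ "(x \<bullet> e) / b"] exI[of _ "x - ((x \<bullet> e) / b) *\<^sub>R x0"]) auto
  qed (use up in auto)
qed

end

end

section \<open>Exponentials of a coordinate\<close>

text \<open>Integrating over the sections orthogonal to \<open>e\<close> reduces both statements to the section function,
which is even and unimodal.  In the case of equality the section function is constant away from
0, and log-concavity excludes a larger value at 0.\<close>

lemma exp_mean_le:
  fixes e :: "'a::euclidean_space"
  assumes e: "e \<in> Basis" and C: "compact C" "convex C" "uminus ` C = C" and int: "interior C \<noteq> {}"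
    and b: "b > 0" and c: "c > 0" and width: "\<And>x. x \<in> C \<Longrightarrow> \<bar>x \<bullet> e\<bar> \<le> b"
  shows "mean C (\<lambda>x. exp (c * (x \<bullet> e))) \<le> sinh (c * b) / (c * b)"
    and "mean C (\<lambda>x. exp (c * (x \<bullet> e))) = sinh (c * b) / (c * b)
      \<Longrightarrow> \<exists>x0. x0 \<bullet> e = b \<and> C = {x. \<exists>r z. \<bar>r\<bar> \<le> 1 \<and> z \<in> C \<and> z \<bullet> e = 0 \<and> x = r *\<^sub>R x0 + z}"
proof -
  let ?g = "slice_measure e C"
  obtain R where R: "C \<subseteq> cball 0 R" by (rule body_bounded[OF e C])
  have borel: "C \<in> sets borel" using C(1) by (rule borel_compact)
  have supp: "?g s = 0" if "b < \<bar>s\<bar>" for s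
  proof -
    have "\<not> 0 < ?g s"
      using width that by (metis slice_measure_pos_imp_point[OF e C] not_less)
    then show ?thesis using slice_measure_nonneg[OF e, of C s] by simp
  qed
  note prems = slice_measure_measurable[OF e borel R] slice_measure_nonneg[OF e] supp
    slice_even[OF e C] slice_unimodal[OF e C] b c
  have exp: "(LINT x:C|lborel. exp (c * (x \<bullet> e))) = (LINT s|lborel. exp (c * s) * ?g s)"
    by (rule integral_slice[OF e borel R]) auto
  have "(LINT x:C|lborel. 1) = (LINT s|lborel. 1 * ?g s)"
    by (rule integral_slice[OF e borel R]) auto
  then have one: "measure lborel C = (LINT s|lborel. ?g s)"
    using emeasure_compact_finite[OF C(1)] borel by (simp add: set_lebesgue_integral_def)
  have pos: "0 < measure lborel C" using measure_pos_of_interior C(1) int by blast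
  show "mean C (\<lambda>x. exp (c * (x \<bullet> e))) \<le> sinh (c * b) / (c * b)"
    using symmetric_unimodal_exp_mean(1)[of ?g, OF prems] pos
    unfolding mean_def exp one by (simp add: divide_le_eq)
  assume "mean C (\<lambda>x. exp (c * (x \<bullet> e))) = sinh (c * b) / (c * b)"
  then have "(LINT s|lborel. exp (c * s) * ?g s) = sinh (c * b) / (c * b) * (LINT s|lborel. ?g s)"
    using pos unfolding mean_def exp one by (simp add: divide_eq_eq)
  then obtain \<kappa> where \<kappa>: "\<And>s. 0 < \<bar>s\<bar> \<Longrightarrow> \<bar>s\<bar> < b \<Longrightarrow> ?g s = \<kappa>"
    using symmetric_unimodal_exp_mean(2)[of ?g, OF prems] by blast
  obtain d where d: "d > 0" "cball 0 d \<subseteq> interior C"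
    using symmetric_interior_zero[OF C(2,3) int] open_contains_cball[of "interior C"] by auto
  define s where "s = min d (b / 2)"
  have s: "s > 0" "s \<le> d" "s < b" using d b by (auto simp: s_def)
  have "s *\<^sub>R e \<in> interior C" using d s e by (intro subsetD[OF d(2)]) simp
  then have "0 < ?g s" using e by (intro slice_measure_pos[OF e borel R]) auto
  then have \<kappa>pos: "\<kappa> > 0" using \<kappa>[of s] s by simp
  have g0: "?g 0 = \<kappa>"
  proof (rule antisym)
    show "\<kappa> \<le> ?g 0" using slice_unimodal[OF e C, of 0 s] \<kappa>[of s] s by simp
    have "?g 0 powr (1/2) * \<kappa> powr (1/2) \<le> \<kappa>"
      using slice_log_concave[OF e C, of "1/2" 0 s] \<kappa>[of s] \<kappa>[of "s / 2"] s by simp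
    then have "(?g 0 powr (1/2) * \<kappa> powr (1/2)) ^ 2 \<le> \<kappa> ^ 2"
      by (intro power_mono) auto
    then have "?g 0 * \<kappa> \<le> \<kappa> * \<kappa>"
      using \<kappa>pos slice_measure_nonneg[OF e, of C 0]
      by (simp add: power_mult_distrib powr_half_sqrt power2_eq_square[of \<kappa>])
    then show "?g 0 \<le> \<kappa>" using \<kappa>pos by simp
  qed
  have const: "?g s = \<kappa>" if "\<bar>s\<bar> < b" for s using \<kappa>[of s] g0 that by (cases "s = 0") auto
  show "\<exists>x0. x0 \<bullet> e = b \<and> C = {x. \<exists>r z. \<bar>r\<bar> \<le> 1 \<and> z \<in> C \<and> z \<bullet> e = 0 \<and> x = r *\<^sub>R x0 + z}"
    by (rule constant_slices_imp_cylinder[OF e C b \<kappa>pos const width int]) blast+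
qed

text \<open>For a straight cylinder the distribution of \<open>x \<bullet> e\<close> is uniform on \<open>{-b..b}\<close>.  The
hypothesis on the mean value only excludes that \<open>D\<close> is a null set.\<close>

lemma cylinder_mean:
  fixes e :: "'a::euclidean_space"
  assumes e: "e \<in> Basis" and D: "compact D" and b: "b > 0" and \<gamma>: "\<gamma> \<noteq> 0"
    and D_iff: "\<And>x. x \<in> D \<longleftrightarrow> \<bar>x \<bullet> e\<bar> \<le> b \<and> x - (x \<bullet> e) *\<^sub>R e \<in> Z"
    and nz: "mean D (\<lambda>x. exp (\<gamma> * (x \<bullet> e))) \<noteq> 0"
  shows "mean D (\<lambda>x. exp (\<gamma> * (x \<bullet> e))) = sinh (\<gamma> * b) / (\<gamma> * b)"
proof -
  have borel: "D \<in> sets borel" using D by (rule borel_compact)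
  obtain R where R: "D \<subseteq> cball 0 R"
    using compact_imp_bounded[OF D] by (auto simp: bounded_iff subset_iff)
  define \<sigma> where "\<sigma> = measure (slice_space e) {y \<in> space (slice_space e). of_coords (y(e := 0)) \<in> Z}"
  have slice: "slice_measure e D s = \<sigma> * indicator {-b..b} s" for s
  proof -
    have "of_coords (y(e := s)) - s *\<^sub>R e = of_coords (y(e := 0))" for y :: "'a \<Rightarrow> real"
      using e by (intro euclidean_eqI[where 'a = 'a]) (auto simp: of_coords_inner inner_diff_left inner_Basis)
    then have "of_coords (y(e := s)) \<in> D \<longleftrightarrow> \<bar>s\<bar> \<le> b \<and> of_coords (y(e := 0)) \<in> Z" for y
      unfolding D_iff of_coords_slice[OF e] by simp
    then show ?thesis by (auto simp: slice_measure_eq[OF e] \<sigma>_def indicator_def abs_le_iff)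
  qed
  have "(LINT x:D|lborel. 1) = (LINT s|lborel. 1 * slice_measure e D s)"
    by (rule integral_slice[OF e borel R]) auto
  then have one: "measure lborel D = \<sigma> * (2 * b)"
    using emeasure_compact_finite[OF D] borel b by (simp add: set_lebesgue_integral_def slice)
  have "(LINT x:D|lborel. exp (\<gamma> * (x \<bullet> e))) = (LINT s|lborel. exp (\<gamma> * s) * slice_measure e D s)"
    by (rule integral_slice[OF e borel R]) auto
  also have "\<dots> = (LINT s|lborel. \<sigma> * (exp (\<gamma> * s) * indicator {-b..b} s))"
    by (simp add: slice algebra_simps)
  also have "\<dots> = \<sigma> * (LINT s|lborel. exp (\<gamma> * s) * indicator {-b..b} s)" by simp
  also have "(LINT s|lborel. exp (\<gamma> * s) * indicator {-b..b} s) = exp (\<gamma> * b) / \<gamma> - exp (\<gamma> * - b) / \<gamma>"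
    using \<gamma> b by (intro integral_FTC_Icc_real) (auto intro!: derivative_eq_intros continuous_intros)
  finally have ex: "(LINT x:D|lborel. exp (\<gamma> * (x \<bullet> e))) = \<sigma> * (2 * sinh (\<gamma> * b) / \<gamma>)"
    by (simp add: sinh_field_def diff_divide_distrib)
  have "\<sigma> \<noteq> 0" using nz unfolding mean_def ex by auto
  then show ?thesis unfolding mean_def ex one using b \<gamma> by (simp add: field_simps)
qed

section \<open>The inequality and its extremal pairs\<close>

lemma min_on_props:
  assumes "compact C" "C \<noteq> {}" "continuous_on C f"
  shows "min_on C f \<in> f ` C" "\<And>x. x \<in> C \<Longrightarrow> min_on C f \<le> f x"
proof -
  obtain x where x: "x \<in> C" "\<And>y. y \<in> C \<Longrightarrow> f x \<le> f y"
    using continuous_attains_inf[OF assms] by blast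
  have "min_on C f = f x"
    unfolding min_on_def by (rule Least_equality) (use x in auto)
  then show "min_on C f \<in> f ` C" "\<And>x. x \<in> C \<Longrightarrow> min_on C f \<le> f x" using x by auto
qed

text \<open>In terms of \<open>h = ln (a / m)\<close> the bound is \<open>a\<close> times the mean value of \<open>cosh\<close> between
\<open>- h\<close> and \<open>h\<close>.\<close>

lemma mean_bound_sinh:
  assumes "0 < m" "m \<noteq> a" "0 < a"
  shows "mean_bound m a = a * (sinh (ln (a / m)) / ln (a / m))"
proof -
  define h where "h = ln (a / m)"
  have am: "a / m = exp h" using assms by (simp add: h_def)
  then have a: "a = m * exp h" using assms by (simp add: field_simps)
  have h: "h \<noteq> 0" using assms a by auto
  have "mean_bound m a = m * ((exp h ^ 2 - 1) / (2 * h))"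
    using assms by (simp add: mean_bound_def am ln_realpow)
  also have "\<dots> = a * (sinh h / h)"
    using h by (simp add: a sinh_field_def exp_minus field_simps power2_eq_square)
  finally show ?thesis by (simp add: h_def)
qed

lemma sinh_gt_arg: "0 < h \<Longrightarrow> h < sinh h" for h :: real
proof -
  assume h: "0 < h"
  obtain z where z: "0 < z" "z < h" "sinh h - sinh 0 = (h - 0) * cosh z"
  proof -
    have "(sinh has_real_derivative cosh x) (at x)" for x :: real
      by (auto intro!: derivative_eq_intros)
    then show thesis using MVT2[OF h, of sinh cosh] that by blast
  qed
  have "1 < cosh z" using z cosh_real_nonneg_less_iff[of 0 z] by simp
  then show ?thesis using z h by simp
qed

text \<open>In dimension 1 the vector \<open>v\<close> may point away from the axis; the map that is then needed is the
reflection, which counts as a rotation there.\<close>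

lemma rotation_to_axis:
  fixes v :: "real^'n"
  obtains T where "rotation T" "T v = norm v *\<^sub>R axis k 1"
proof (cases "2 \<le> CARD('n)")
  case True
  have "norm v = norm (norm v *\<^sub>R (axis k 1 :: real^'n))" by simp
  then obtain T where "orthogonal_transformation T" "det (matrix T) = 1" "T v = norm v *\<^sub>R axis k 1"
    using rotation_exists[OF True] by blast
  then show ?thesis using that[of T] by (simp add: rotation_def)
next
  case False
  have "norm v = norm (norm v *\<^sub>R (axis k 1 :: real^'n))" by simp
  then obtain T :: "real^'n \<Rightarrow> real^'n" where "orthogonal_transformation T" "T v = norm v *\<^sub>R axis k 1"
    by (rule orthogonal_transformation_exists)
  then show ?thesis using that[of T] False by (simp add: rotation_def)
qed

text \<open>The sandwich lemma for \<open>ln f - ln (f 0)\<close>: the function \<open>f\<close> is majorized by an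
exponential whose minimum on \<open>C\<close> is still at least \<open>m\<close>.\<close>

lemma exp_log_affine_bound:
  fixes C :: "'a::euclidean_space set"
  assumes C: "convex C" "uminus ` C = C" "interior C \<noteq> {}"
    and pos: "\<And>x. x \<in> C \<Longrightarrow> 0 < f x" and f: "log_concave_on C f"
    and m: "0 < m" "\<And>x. x \<in> C \<Longrightarrow> m \<le> f x"
  shows "\<exists>v. \<forall>x\<in>C. f x \<le> f 0 * exp (v \<bullet> x) \<and> \<bar>v \<bullet> x\<bar> \<le> ln (f 0 / m)"
proof -
  have zero: "0 \<in> C" using symmetric_interior_zero[OF C] interior_subset by blast
  define k where "k x = ln (f x) - ln (f 0)" for x
  have conc: "concave_on C k"
  proof -
    have f': "concave_on C (\<lambda>x. ln (f x))" using f by (simp add: log_concave_on_def)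
    show ?thesis
      unfolding concave_on_iff
    proof (intro conjI ballI allI impI C(1))
      fix x y and u w :: real assume xy: "x \<in> C" "y \<in> C" and uw: "0 \<le> u" "0 \<le> w" "u + w = 1"
      have "u * ln (f x) + w * ln (f y) \<le> ln (f (u *\<^sub>R x + w *\<^sub>R y))"
        using f' xy uw unfolding concave_on_iff by blast
      moreover have "u * ln (f 0) + w * ln (f 0) = ln (f 0)"
        using uw(3) by (simp add: distrib_right[symmetric])
      ultimately show "u * k x + w * k y \<le> k (u *\<^sub>R x + w *\<^sub>R y)"
        by (simp add: k_def algebra_simps)
    qed
  qed
  have low: "- ln (f 0 / m) \<le> k x" if "x \<in> C" for x
    using m(1) m(2)[OF that] pos[OF zero] pos[OF that] by (simp add: k_def ln_div)
  obtain v where v: "\<And>x. x \<in> C \<Longrightarrow> k x \<le> v \<bullet> x" "\<And>x. x \<in> C \<Longrightarrow> \<bar>v \<bullet> x\<bar> \<le> ln (f 0 / m)"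
    by (rule symmetric_convex_sandwich[OF C conc _ low]) (auto simp: k_def)
  have "f x \<le> f 0 * exp (v \<bullet> x)" if x: "x \<in> C" for x
  proof -
    have "ln (f x) \<le> ln (f 0) + v \<bullet> x" using v(1)[OF x] by (simp add: k_def)
    then have "exp (ln (f x)) \<le> exp (ln (f 0) + v \<bullet> x)" by simp
    then show ?thesis using pos[OF x] pos[OF zero] by (simp add: exp_add)
  qed
  then show ?thesis using v(2) by blast
qed

lemma zero_hyperplane_inner: "zero_hyperplane k = {x. x \<bullet> axis k 1 = 0}"
  by (simp add: zero_hyperplane_def inner_axis)

lemma orthogonal_image_body:
  fixes C :: "(real^'n) set"
  assumes T: "orthogonal_transformation (T :: real^'n \<Rightarrow> real^'n)" and C: "compact C" "convex C" "uminus ` C = C" "interior C \<noteq> {}"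
  shows "linear T" "bij T" "compact (T ` C)" "convex (T ` C)" "uminus ` T ` C = T ` C" "interior (T ` C) \<noteq> {}"
proof -
  show lin: "linear T" using T by (rule orthogonal_transformation_linear)
  show bij: "bij T" using T by (rule orthogonal_transformation_bij)
  show "compact (T ` C)" using C(1) lin by (intro compact_continuous_image linear_continuous_on) (simp add: linear_conv_bounded_linear)
  show "convex (T ` C)" using C(2) lin by (rule convex_linear_image[rotated])
  have "uminus ` T ` C = T ` uminus ` C" using lin by (simp add: image_image linear_neg)
  then show "uminus ` T ` C = T ` C" using C(3) by simp
  show "interior (T ` C) \<noteq> {}"
    using C(4) interior_bijective_linear_image[OF lin bij, of C] by simp
qed

text \<open>The affine function \<open>u\<close> depends only on the coordinate \<open>k\<close>.  A shear along the axis of the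
cylinder preserves this coordinate and makes the cylinder straight, and mean values are invariant
under linear bijections.\<close>

lemma extremal_form_imp_mean:
  fixes C :: "(real^'n) set"
  assumes C: "compact C" "convex C" "uminus ` C = C" "interior C \<noteq> {}"
    and m: "0 < min_on C f" "\<And>x. x \<in> C \<Longrightarrow> min_on C f \<le> f x" and ne: "f 0 \<noteq> min_on C f"
    and cont: "continuous_on C f" and ext: "extremal_form k C f"
  shows "mean C f = mean_bound (min_on C f) (f 0)"
proof -
  let ?e = "axis k 1 :: real^'n"
  have e: "?e \<in> Basis" by simp
  define m where "m = min_on C f"
  obtain T Z x0 u where T: "rotation T" and Z: "Z \<subseteq> zero_hyperplane k"
    and x0: "x0 $ k > 0" and TC: "T ` C = closed_segment (- x0) x0 + Z" and u: "affine_fun u"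
    and f: "\<And>x. x \<in> C \<Longrightarrow> f x = exp (u (T x))"
    and um: "\<And>x. x \<in> zero_hyperplane k \<Longrightarrow> u (- x0 + x) = ln m"
    using ext unfolding extremal_form_def m_def by auto
  have orth: "orthogonal_transformation T" using T by (simp add: rotation_def)
  note body = orthogonal_image_body[OF orth C]
  have zero: "0 \<in> C" using symmetric_interior_zero[OF C(2,3,4)] interior_subset by blast
  obtain l d where l: "linear l" and ul: "\<And>x. u x = l x + d" using u unfolding affine_fun_def by blast
  define b where "b = x0 $ k"
  have b: "b > 0" "x0 \<bullet> ?e = b" using x0 by (auto simp: b_def inner_axis)
  have l0: "l x = 0" if "x \<bullet> ?e = 0" for x
  proof -
    have "u (- x0 + x) = u (- x0 + 0)" using um[of x] um[of 0] that by (simp add: zero_hyperplane_inner)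
    then have "l (- x0 + x) = l (- x0)" unfolding ul by simp
    then show ?thesis unfolding linear_add[OF l] by simp
  qed
  define \<gamma> where "\<gamma> = l ?e"
  have ly: "l y = \<gamma> * (y \<bullet> ?e)" for y
  proof -
    have "l (y - (y \<bullet> ?e) *\<^sub>R ?e) = 0" by (rule l0) (simp add: inner_diff_left inner_axis)
    then show ?thesis using l by (simp add: linear_diff linear_scale \<gamma>_def)
  qed
  have d: "exp d = f 0" using f[OF zero] body(1) l by (simp add: ul linear_0)
  then have f0: "0 < f 0" by (metis exp_gt_zero)
  have "- (\<gamma> * b) + d = ln m" using um[of 0] b by (simp add: zero_hyperplane_inner ul ly)
  then have gb: "\<gamma> * b = ln (f 0 / m)"
  proof -
    have "ln (f 0 / m) = ln (f 0) - ln m" using f0 m(1) by (simp add: ln_div m_def)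
    moreover have "d = ln (f 0)" using d by (metis ln_exp)
    ultimately show ?thesis using \<open>- (\<gamma> * b) + d = ln m\<close> by linarith
  qed
  have "f 0 / m \<noteq> 1" "0 < f 0 / m" using ne m(1) f0 by (auto simp: m_def)
  then have \<gamma>: "\<gamma> \<noteq> 0" using gb by (metis ln_eq_zero_iff mult_zero_left)
  let ?E = "\<lambda>y. exp (\<gamma> * (y \<bullet> ?e))"
  have "mean C f = mean C ((\<lambda>y. f 0 * ?E y) \<circ> T)"
    by (rule mean_cong) (simp add: f ul ly exp_add d)
  also have "\<dots> = mean (T ` C) (\<lambda>y. f 0 * ?E y)"
    using f0 by (intro mean_linear_image[symmetric] body C continuous_intros) auto
  also have "\<dots> = f 0 * mean (T ` C) ?E" by (rule mean_cmult)
  also have "mean (T ` C) ?E = sinh (\<gamma> * b) / (\<gamma> * b)"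
  proof -
    \<comment> \<open>The shear maps \<open>x0\<close> to \<open>b *\<^sub>R ?e\<close> and fixes the hyperplane of \<open>Z\<close>.\<close>
    define A where "A y = y - ((y \<bullet> ?e) / b) *\<^sub>R x0 + (y \<bullet> ?e) *\<^sub>R ?e" for y
    define A' where "A' y = y + ((y \<bullet> ?e) / b) *\<^sub>R x0 - (y \<bullet> ?e) *\<^sub>R ?e" for y
    have Ae: "A y \<bullet> ?e = y \<bullet> ?e" and A'e: "A' y \<bullet> ?e = y \<bullet> ?e" for y
      using b by (auto simp: A_def A'_def inner_add_left inner_diff_left inner_axis_axis)
    have inv: "A' (A y) = y" "A (A' y) = y" for y
      unfolding A'_def[of "A y"] A_def[of "A' y"] Ae A'e by (simp_all add: A_def A'_def)
    have "linear A" unfolding A_def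
      by (intro linearI) (simp_all add: inner_add_left algebra_simps add_divide_distrib)
    have "bij A" by (rule o_bij[of A']) (auto simp: inv fun_eq_iff)
    define D where "D = A ` T ` C"
    have compD: "compact D" unfolding D_def
      using \<open>linear A\<close> by (intro compact_continuous_image[OF linear_continuous_on body(3)]) (simp add: linear_conv_bounded_linear)
    have mean_D: "mean D ?E = mean (T ` C) ?E"
    proof -
      have "mean D ?E = mean (T ` C) (?E \<circ> A)"
        unfolding D_def by (intro mean_linear_image \<open>linear A\<close> \<open>bij A\<close> body continuous_intros) auto
      then show ?thesis by (simp add: o_def Ae)
    qed
    have D_iff: "y \<in> D \<longleftrightarrow> \<bar>y \<bullet> ?e\<bar> \<le> b \<and> y - (y \<bullet> ?e) *\<^sub>R ?e \<in> Z" for y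
    proof -
      have "y \<in> D \<longleftrightarrow> A' y \<in> T ` C"
        unfolding D_def using inv by (metis (no_types, lifting) image_iff)
      also have "\<dots> \<longleftrightarrow> \<bar>y \<bullet> ?e\<bar> \<le> b \<and> y - (y \<bullet> ?e) *\<^sub>R ?e \<in> Z"
      proof
        assume "A' y \<in> T ` C"
        then obtain p z where p: "p \<in> closed_segment (- x0) x0" and z: "z \<in> Z" and eq: "A' y = p + z"
          unfolding TC by (auto simp: set_plus_def)
        obtain t where t: "0 \<le> t" "t \<le> 1" "p = (1 - t) *\<^sub>R (- x0) + t *\<^sub>R x0"
          using p by (auto simp: closed_segment_def)
        have p': "p = (2 * t - 1) *\<^sub>R x0" unfolding t(3) by (simp add: algebra_simps scaleR_2[symmetric])
        have "z \<bullet> ?e = 0" using z Z by (auto simp: zero_hyperplane_inner)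
        then have ye: "y \<bullet> ?e = (2 * t - 1) * b" using A'e[of y] b by (simp add: eq p' inner_add_left)
        have "\<bar>2 * t - 1\<bar> \<le> 1" using t by auto
        then have "\<bar>y \<bullet> ?e\<bar> \<le> b" using b by (simp add: ye abs_mult)
        moreover have "y - (y \<bullet> ?e) *\<^sub>R ?e = z"
          using eq b by (simp add: A'_def p' ye)
        ultimately show "\<bar>y \<bullet> ?e\<bar> \<le> b \<and> y - (y \<bullet> ?e) *\<^sub>R ?e \<in> Z" using z by simp
      next
        assume R: "\<bar>y \<bullet> ?e\<bar> \<le> b \<and> y - (y \<bullet> ?e) *\<^sub>R ?e \<in> Z"
        define t where "t = ((y \<bullet> ?e) / b + 1) / 2"
        have "\<bar>(y \<bullet> ?e) / b\<bar> \<le> 1" using R b by (simp add: abs_divide)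
        then have "(y \<bullet> ?e) / b \<le> 1" "- 1 \<le> (y \<bullet> ?e) / b" by linarith+
        then have t: "0 \<le> t" "t \<le> 1" by (auto simp: t_def)
        have "((y \<bullet> ?e) / b) *\<^sub>R x0 = (2 * t - 1) *\<^sub>R x0" by (simp add: t_def field_simps)
        also have "\<dots> = (1 - t) *\<^sub>R (- x0) + t *\<^sub>R x0" by (simp add: algebra_simps scaleR_2[symmetric])
        finally have "((y \<bullet> ?e) / b) *\<^sub>R x0 \<in> closed_segment (- x0) x0"
          using t by (auto simp: closed_segment_def)
        moreover have "A' y = ((y \<bullet> ?e) / b) *\<^sub>R x0 + (y - (y \<bullet> ?e) *\<^sub>R ?e)" by (simp add: A'_def)
        ultimately show "A' y \<in> T ` C" unfolding TC using R by (auto simp: set_plus_def)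
      qed
      finally show ?thesis .
    qed
    have "mean D ?E \<noteq> 0"
    proof -
      have "min_on C f \<le> mean C f"
        using mean_mono[OF C(1) _ cont, of "\<lambda>_. min_on C f"] m(2) mean_const[OF C(1,4)] by simp
      then have "mean C f \<noteq> 0" using m(1) by simp
      then show ?thesis using calculation mean_D mean_cmult[of "T ` C" "f 0" ?E] by auto
    qed
    then show ?thesis
      using cylinder_mean[OF e compD b(1) \<gamma> D_iff] mean_D by simp
  qed
  finally have "mean C f = f 0 * (sinh (ln (f 0 / m)) / ln (f 0 / m))" unfolding gb .
  then show ?thesis
    using mean_bound_sinh[OF m(1) ne[symmetric] f0] unfolding m_def by (rule trans[OF _ sym])
qed

text \<open>The mean value of \<open>f\<close> is at most that of \<open>f 0 * exp (v \<bullet> x)\<close>, and a rotation that takes \<open>v\<close> to a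
multiple of the axis puts the latter into the form treated before.  Equality in the end forces
equality in both steps: \<open>f\<close> is the exponential, and the rotated body is a cylinder.  If \<open>v = 0\<close>,
the inequality is strict.\<close>

lemma mean_le_and_extremal:
  fixes C :: "(real^'n) set"
  assumes C: "compact C" "convex C" "uminus ` C = C" "interior C \<noteq> {}"
    and pos: "\<And>x. x \<in> C \<Longrightarrow> 0 < f x" and lc: "log_concave_on C f"
    and m: "0 < min_on C f" "\<And>x. x \<in> C \<Longrightarrow> min_on C f \<le> f x" and ne: "f 0 \<noteq> min_on C f"
    and cont: "continuous_on C f"
  shows "mean C f \<le> mean_bound (min_on C f) (f 0)"
    and "mean C f = mean_bound (min_on C f) (f 0) \<Longrightarrow> extremal_form k C f"
proof -
  let ?e = "axis k 1 :: real^'n"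
  have e: "?e \<in> Basis" by simp
  define h where "h = ln (f 0 / min_on C f)"
  have zero: "0 \<in> C" using symmetric_interior_zero[OF C(2,3,4)] interior_subset by blast
  have f0: "min_on C f < f 0" "0 < f 0" using m(2)[OF zero] ne pos[OF zero] by auto
  have h: "h > 0" using f0 m(1) by (simp add: h_def)
  have bound: "mean_bound (min_on C f) (f 0) = f 0 * (sinh h / h)"
    using mean_bound_sinh[OF m(1) ne[symmetric] f0(2)] by (simp add: h_def)
  obtain v where v: "\<And>x. x \<in> C \<Longrightarrow> f x \<le> f 0 * exp (v \<bullet> x)" "\<And>x. x \<in> C \<Longrightarrow> \<bar>v \<bullet> x\<bar> \<le> h"
    using exp_log_affine_bound[OF C(2-4) pos lc m] unfolding h_def by blast
  have contE: "continuous_on C (\<lambda>x. f 0 * exp (v \<bullet> x))" by (intro continuous_intros)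
  have le1: "mean C f \<le> f 0 * mean C (\<lambda>x. exp (v \<bullet> x))"
    using mean_mono[OF C(1) cont contE v(1)] by (simp add: mean_cmult)
  have "mean C f \<le> mean_bound (min_on C f) (f 0) \<and>
    (mean C f = mean_bound (min_on C f) (f 0) \<longrightarrow> extremal_form k C f)"
  proof (cases "v = 0")
    case True
    then have "mean C f \<le> f 0" using le1 by (simp add: mean_const[OF C(1,4)])
    also have "\<dots> < mean_bound (min_on C f) (f 0)"
    proof -
      have "1 < sinh h / h" using sinh_gt_arg[OF h] h by (simp add: less_divide_eq)
      then have "f 0 * 1 < f 0 * (sinh h / h)" using f0(2) by (rule mult_strict_left_mono)
      then show ?thesis unfolding bound by simp
    qed
    finally show ?thesis by simp
  next
    case False
    define c where "c = norm v"
    have c: "c > 0" using False by (simp add: c_def)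
    define b where "b = h / c"
    have b: "b > 0" "c * b = h" using h c by (auto simp: b_def)
    obtain T where rot: "rotation T" and Tv: "T v = c *\<^sub>R ?e" unfolding c_def by (rule rotation_to_axis)
    have orth: "orthogonal_transformation T" using rot by (simp add: rotation_def)
    note body = orthogonal_image_body[OF orth C]
    have vx: "v \<bullet> x = c * (T x \<bullet> ?e)" for x
    proof -
      have "v \<bullet> x = T v \<bullet> T x" using orth by (simp add: orthogonal_transformation_def)
      then show ?thesis by (simp add: Tv inner_commute)
    qed
    have width: "\<bar>y \<bullet> ?e\<bar> \<le> b" if "y \<in> T ` C" for y
      using that v(2) c by (auto simp: vx abs_mult b_def field_simps)
    let ?E = "\<lambda>y. exp (c * (y \<bullet> ?e))"
    have meanT: "mean C (\<lambda>x. exp (v \<bullet> x)) = mean (T ` C) ?E"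
    proof -
      have "mean (T ` C) ?E = mean C (?E \<circ> T)"
        by (intro mean_linear_image body C continuous_intros) auto
      then show ?thesis by (simp add: o_def vx)
    qed
    note mean_T = exp_mean_le[OF e body(3-6) b(1) c width]
    have le2: "mean C (\<lambda>x. exp (v \<bullet> x)) \<le> sinh h / h" unfolding meanT using mean_T(1) by (simp add: b)
    have le: "mean C f \<le> mean_bound (min_on C f) (f 0)"
      unfolding bound using le1 mult_left_mono[OF le2, of "f 0"] f0(2) by simp
    moreover have "extremal_form k C f" if eq: "mean C f = mean_bound (min_on C f) (f 0)"
    proof -
      have eq1: "mean C f = f 0 * mean C (\<lambda>x. exp (v \<bullet> x))"
        using le1 mult_left_mono[OF le2, of "f 0"] f0(2) eq unfolding bound by simp
      then have "f 0 * mean C (\<lambda>x. exp (v \<bullet> x)) = f 0 * (sinh h / h)" using eq unfolding bound by (rule trans[OF sym])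
      then have "mean C (\<lambda>x. exp (v \<bullet> x)) = sinh h / h"
        using f0(2) by (metis mult_left_cancel less_irrefl)
      then have "mean (T ` C) ?E = sinh (c * b) / (c * b)" by (simp add: meanT b)
      then obtain x0 where x0: "x0 \<bullet> ?e = b"
        and TC: "T ` C = {x. \<exists>r z. \<bar>r\<bar> \<le> 1 \<and> z \<in> T ` C \<and> z \<bullet> ?e = 0 \<and> x = r *\<^sub>R x0 + z}"
        using mean_T(2) by blast
      have f_eq: "f x = f 0 * exp (v \<bullet> x)" if "x \<in> C" for x
        by (rule mean_eq_imp_eq[OF C(1,2,4) cont contE v(1) _ that]) (use eq1 in \<open>simp_all add: mean_cmult\<close>)
      define Z where "Z = T ` C \<inter> zero_hyperplane k"
      define u where "u y = c * (y \<bullet> ?e) + ln (f 0)" for y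
      have hyp: "zero_hyperplane k = {x. ?e \<bullet> x = 0}" by (simp add: zero_hyperplane_inner inner_commute)
      have seg: "T ` C = closed_segment (- x0) x0 + Z"
      proof -
        have "p \<in> closed_segment (- x0) x0 \<longleftrightarrow> (\<exists>r. \<bar>r\<bar> \<le> 1 \<and> p = r *\<^sub>R x0)" for p
        proof
          assume "p \<in> closed_segment (- x0) x0"
          then obtain t where t: "0 \<le> t" "t \<le> 1" "p = (1 - t) *\<^sub>R (- x0) + t *\<^sub>R x0"
            by (auto simp: closed_segment_def)
          have "p = (2 * t - 1) *\<^sub>R x0" unfolding t(3) by (simp add: algebra_simps scaleR_2[symmetric])
          then show "\<exists>r. \<bar>r\<bar> \<le> 1 \<and> p = r *\<^sub>R x0" using t by (intro exI[of _ "2 * t - 1"]) auto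
        next
          assume "\<exists>r. \<bar>r\<bar> \<le> 1 \<and> p = r *\<^sub>R x0"
          then obtain r where r: "\<bar>r\<bar> \<le> 1" "p = r *\<^sub>R x0" by blast
          define t where "t = (r + 1) / 2"
          have "p = (2 * t - 1) *\<^sub>R x0" by (simp add: r t_def field_simps)
          also have "\<dots> = (1 - t) *\<^sub>R (- x0) + t *\<^sub>R x0" by (simp add: algebra_simps scaleR_2[symmetric])
          finally show "p \<in> closed_segment (- x0) x0"
            using r(1) by (auto simp: closed_segment_def t_def intro!: exI[of _ t])
        qed
        then have seg_iff: "p \<in> closed_segment (- x0) x0 \<longleftrightarrow> (\<exists>r. \<bar>r\<bar> \<le> 1 \<and> p = r *\<^sub>R x0)" for p .
        have Z_iff: "z \<in> Z \<longleftrightarrow> z \<in> T ` C \<and> z \<bullet> ?e = 0" for z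
          by (simp add: Z_def zero_hyperplane_inner)
        have "x \<in> closed_segment (- x0) x0 + Z \<longleftrightarrow> (\<exists>p z. p \<in> closed_segment (- x0) x0 \<and> z \<in> Z \<and> x = p + z)" for x
          unfolding set_plus_def by blast
        then have "x \<in> closed_segment (- x0) x0 + Z
            \<longleftrightarrow> (\<exists>r z. \<bar>r\<bar> \<le> 1 \<and> z \<in> T ` C \<and> z \<bullet> ?e = 0 \<and> x = r *\<^sub>R x0 + z)" for x
          unfolding seg_iff Z_iff by blast
        moreover have "x \<in> T ` C \<longleftrightarrow> (\<exists>r z. \<bar>r\<bar> \<le> 1 \<and> z \<in> T ` C \<and> z \<bullet> ?e = 0 \<and> x = r *\<^sub>R x0 + z)" for x
          by (subst TC) (rule mem_Collect_eq)
        ultimately show ?thesis by (intro set_eqI) metis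
      qed
      show ?thesis
        unfolding extremal_form_def
      proof (intro exI conjI ballI)
        show "rotation T" by (rule rot)
        show "Z \<subseteq> zero_hyperplane k" by (simp add: Z_def)
        show "compact Z" unfolding Z_def hyp by (intro compact_Int_closed body closed_hyperplane)
        show "convex Z" unfolding Z_def hyp by (intro convex_Int body convex_hyperplane)
        show "aff_dim Z = int CARD('n) - 1"
        proof -
          have "0 \<in> interior (T ` C)" by (rule symmetric_interior_zero[OF body(4-6)])
          moreover have "0 \<in> zero_hyperplane k" by (simp add: zero_hyperplane_def)
          ultimately have "zero_hyperplane k \<inter> interior (T ` C) \<noteq> {}" by blast
          then have "aff_dim (zero_hyperplane k \<inter> T ` C) = aff_dim (zero_hyperplane k)"
            unfolding hyp by (intro aff_dim_convex_Int_nonempty_interior convex_hyperplane)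
          also have "\<dots> = int CARD('n) - 1"
            unfolding hyp by (subst aff_dim_hyperplane) (auto simp: axis_eq_0_iff)
          finally show ?thesis by (simp add: Z_def Int_commute)
        qed
        show "Z = uminus ` Z"
        proof -
          have neg: "- z \<in> Z" if "z \<in> Z" for z
          proof -
            have "- z \<in> uminus ` T ` C" using that unfolding Z_def by (intro imageI) blast
            then show ?thesis using that unfolding body(5) Z_def by (simp add: zero_hyperplane_def)
          qed
          show ?thesis
          proof (intro equalityI subsetI)
            show "z \<in> uminus ` Z" if "z \<in> Z" for z
              by (rule image_eqI[of _ _ "- z"]) (use neg[OF that] in simp_all)
          qed (use neg in auto)
        qed
        show "x0 $ k > 0" using x0 b(1) by (simp add: inner_axis)
        show "T ` C = closed_segment (- x0) x0 + Z" by (rule seg)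
        show "affine_fun u"
          unfolding affine_fun_def
        proof (intro exI conjI allI)
          show "linear (\<lambda>y. c * (y \<bullet> ?e))" by (intro linearI) (auto simp: inner_add_left algebra_simps)
        qed (simp add: u_def)
        show "f x = exp (u (T x))" if "x \<in> C" for x
          using f_eq[OF that] f0(2) by (simp add: u_def vx exp_add mult.commute)
        show "u (- x0 + x) = ln (min_on C f)" if "x \<in> zero_hyperplane k" for x
        proof -
          have "u (- x0 + x) = c * (- b) + ln (f 0)"
            using that x0 by (simp add: u_def zero_hyperplane_inner inner_diff_left)
          then show ?thesis using b(2) f0(2) m(1) by (simp add: h_def ln_div)
        qed
      qed
    qed
    ultimately show ?thesis by blast
  qed
  then show "mean C f \<le> mean_bound (min_on C f) (f 0)"
    "mean C f = mean_bound (min_on C f) (f 0) \<Longrightarrow> extremal_form k C f" by blast+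
qed

theorem theorem0p3:
  fixes C :: "(real^'n) set" and f :: "real^'n \<Rightarrow> real" and k :: 'n
  assumes "compact C" and "convex C" and "aff_dim C = int CARD('n)" and "C = uminus ` C"
    and "\<And>x. x \<in> C \<Longrightarrow> f x > 0"
    and "log_concave_on C f" and "continuous_on C f"
  shows "(1 / measure lebesgue C) * (LINT x:C|lebesgue. f x) \<le> mean_bound (min_on C f) (f 0) \<and>
    ((1 / measure lebesgue C) * (LINT x:C|lebesgue. f x) = mean_bound (min_on C f) (f 0) \<longleftrightarrow>
       f 0 = min_on C f \<or> extremal_form k C f)"
proof -
  have sym: "uminus ` C = C" using assms(4) by simp
  have int: "interior C \<noteq> {}"
  proof -
    have hull: "affine hull C = UNIV" using assms(3) aff_dim_eq_full[of C] by simp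
    have "C \<noteq> {}" using assms(3) by auto
    then show ?thesis
      using rel_interior_interior[OF hull] rel_interior_eq_empty[OF assms(2)] by simp
  qed
  note C = assms(1,2) sym int
  have zero: "0 \<in> C" using symmetric_interior_zero[OF C(2-4)] interior_subset by blast
  have m: "min_on C f \<in> f ` C" "\<And>x. x \<in> C \<Longrightarrow> min_on C f \<le> f x"
    using min_on_props[OF assms(1) _ assms(7)] zero by auto
  have mpos: "0 < min_on C f" using m(1) assms(5) by auto
  have avg: "(1 / measure lebesgue C) * (LINT x:C|lebesgue. f x) = mean C f"
  proof -
    have "(\<lambda>x. indicator C x *\<^sub>R f x) \<in> borel_measurable lborel"
      using compact_set_integrable[OF assms(1,7)] by (simp add: set_integrable_def)
    then have "(LINT x:C|lebesgue. f x) = (LINT x:C|lborel. f x)"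
      unfolding set_lebesgue_integral_def by (rule integral_completion)
    moreover have "measure lebesgue C = measure lborel C"
      using assms(1) by (intro measure_completion) (simp add: borel_compact)
    ultimately show ?thesis by (simp add: mean_def)
  qed
  show ?thesis
  proof (cases "f 0 = min_on C f")
    case True
    have const: "f x = f 0" if x: "x \<in> C" for x
    proof -
      obtain v where v: "\<And>x. x \<in> C \<Longrightarrow> f x \<le> f 0 * exp (v \<bullet> x)" "\<And>x. x \<in> C \<Longrightarrow> \<bar>v \<bullet> x\<bar> \<le> ln (f 0 / min_on C f)"
        using exp_log_affine_bound[OF C(2-4) assms(5,6) mpos m(2)] by blast
      show ?thesis using v(1)[OF x] v(2)[OF x] m(2)[OF x] True mpos by simp
    qed
    have "mean C f = mean C (\<lambda>_. f 0)" by (rule mean_cong) (rule const)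
    then have "mean C f = mean_bound (min_on C f) (f 0)"
      using True by (simp add: mean_const[OF C(1,4)] mean_bound_def)
    then show ?thesis unfolding avg using True by simp
  next
    case False
    note prems = C assms(5,6) mpos m(2) False assms(7)
    have "mean C f \<le> mean_bound (min_on C f) (f 0)"
      by (rule mean_le_and_extremal(1)[OF prems])
    moreover have "mean C f = mean_bound (min_on C f) (f 0) \<longleftrightarrow> extremal_form k C f"
      using mean_le_and_extremal(2)[OF prems, where k = k]
        extremal_form_imp_mean[OF C mpos m(2) False assms(7), where k = k] by (rule iffI)
    ultimately show ?thesis unfolding avg using False by simp
  qed
qed

end
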